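(* Let $\gamma\in[0,1)$ and let $\{F_N\}_{N\ge 2}$, $F_N\in P(\mathbb{S}^{N-1}(\sqrt N))$, be a family of symmetric densities that is log-scalable with constant $C_F>0$. (i) Assume there exists $k>1$ such that $M_{2k}:=\sup_N M_{2k}(\Pi_1(F_N))<\infty$. Then for every $N$, $$\frac{D_{N,\gamma}(F_N)}{N}\ \ge\ \mathcal{C}_{k,\gamma,N}\left(\frac{H_N(F_N)}{N}\right)^{1+\frac{1-\gamma}{k-1}},$$ where $$\mathcal{C}_{k,\gamma,N}=\frac{k-1}{3^{\frac{2k-\gamma k-\gamma}{k-1}}(1-\gamma)}\left(\frac{1-\gamma}{k-\gamma}\right)^{\frac{k-\gamma}{k-1}}\frac{1}{(2C_F)^{\frac{1-\gamma}{k-1}}(1+2M_{2k})^{\frac{1-\gamma}{k-1}}}\,N^{\frac{\gamma-1}{k-1}}.$$ (ii) Assume instead that for some $a,\mu>0$, $M_{exp}:=\sup_N\int_{\mathbb{S}^{N-1}(\sqrt N)}e^{a|v_1|^\mu}F_N(\bm v)\,d\sigma^N<\infty$. Then for every $N$, $$\frac{D_{N,\gamma}(F_N)}{N}\ \ge\ \frac{1}{6\cdot 4^{1-\gamma}\left(\frac{2}{a}\log\left(96C_F\left(\frac{4}{a\mu e}\right)^{\frac{2}{\mu}}e^{\frac{a}{2^{\mu/2}}}M_{exp}\right)+\frac{2}{a}\log\left(\frac{N}{H_N(F_N)/N}\right)\right)^{\frac{2(1-\gamma)}{\mu}}}\ \frac{H_N(F_N)}{N}.$$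
   Context: For $N\ge2$, $\mathbb{S}^{N-1}(\sqrt N)=\{\bm v=(v_1,\dots,v_N)\in\mathbb{R}^N:\sum_i v_i^2=N\}$ and $d\sigma^N$ is the uniform probability measure on it; $P(\mathbb{S}^{N-1}(\sqrt N))$ denotes the probability densities with respect to $d\sigma^N$. $F_N$ is symmetric if it is invariant under permutations of the coordinates. For $i<j$ and $\theta\in\mathbb{R}$, $R_{i,j,\theta}$ is the rotation with $(R_{i,j,\theta}\bm v)_i=v_i\cos\theta+v_j\sin\theta$, $(R_{i,j,\theta}\bm v)_j=-v_i\sin\theta+v_j\cos\theta$, $(R_{i,j,\theta}\bm v)_k=v_k$ for $k\ne i,j$. Let $\psi(x,y)=(x-y)\log(x/y)$. For $\gamma\in[0,1]$ the entropy production is $D_{N,\gamma}(F)=\frac{1}{4\pi}\frac{N}{\binom N2}\sum_{i<j}\int_{\mathbb{S}^{N-1}(\sqrt N)}\int_0^{2\pi}(1+v_i^2+v_j^2)^\gamma\,\psi(F,F\circ R_{i,j,\theta})\,d\theta\,d\sigma^N$, and the relative entropy is $H_N(F)=\int_{\mathbb{S}^{N-1}(\sqrt N)}F\log F\,d\sigma^N$. The first marginal $\Pi_1(F_N)$ is the density on $\mathbb{R}$ with $\int\varphi(v_1)\Pi_1(F_N)(v_1)dv_1=\int\varphi(v_1)F_N\,d\sigma^N$ for bounded continuous $\varphi$. For non-negative $h$ on $\mathbb{R}$, $M_k(h)=\int_{\mathbb{R}}|v|^kh(v)\,dv$. A family $\{F_N\}$ is log-scalable with constant $C_F>0$ (independent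 of $N$) if $\sup_{\bm v\in\mathbb{S}^{N-1}(\sqrt N)}|\log F_N(\bm v)|\le C_FN$ for all $N$. *)

theory Defs
  imports "HOL-Analysis.Analysis" "HOL-Combinatorics.Permutations"
begin

text \<open>Vectors of R^N are represented as extensional functions nat => real on the
index set {..<N} (coordinate v_1 of the paper is v 0 here).\<close>

definition lebN :: "nat \<Rightarrow> (nat \<Rightarrow> real) measure" where
  "lebN N = PiM {..<N} (\<lambda>_. lborel)"

definition sqnorm :: "nat \<Rightarrow> (nat \<Rightarrow> real) \<Rightarrow> real" where
  "sqnorm N v = (\<Sum>i<N. (v i)^2)"

definition sph :: "nat \<Rightarrow> (nat \<Rightarrow> real) set" where
  "sph N = {v \<in> PiE {..<N} (\<lambda>_. UNIV). sqnorm N v = real N}"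

definition ballN :: "nat \<Rightarrow> (nat \<Rightarrow> real) set" where
  "ballN N = {v \<in> PiE {..<N} (\<lambda>_. UNIV). sqnorm N v \<le> real N}"

definition radial :: "nat \<Rightarrow> (nat \<Rightarrow> real) \<Rightarrow> (nat \<Rightarrow> real)" where
  "radial N x = (\<lambda>i\<in>{..<N}. sqrt (real N) * x i / sqrt (sqnorm N x))"

text \<open>Uniform probability measure sigma^N on the sphere, realised as the (normalised)
cone measure: sigma^N(A) = Leb({r v : v in A, 0 < r <= 1}) / Leb(ball), i.e. the image of the
uniform distribution on the ball under radial projection.\<close>
definition sigmaN :: "nat \<Rightarrow> (nat \<Rightarrow> real) measure" where
  "sigmaN N = distr (uniform_measure (lebN N) (ballN N)) (PiM {..<N} (\<lambda>_. borel)) (radial N)"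

definition prob_density :: "nat \<Rightarrow> ((nat \<Rightarrow> real) \<Rightarrow> real) \<Rightarrow> bool" where
  "prob_density N F \<longleftrightarrow> F \<in> borel_measurable (sigmaN N) \<and> (\<forall>v\<in>sph N. 0 \<le> F v)
     \<and> integrable (sigmaN N) F \<and> (\<integral>v. F v \<partial>sigmaN N) = 1"

definition symmetric_density :: "nat \<Rightarrow> ((nat \<Rightarrow> real) \<Rightarrow> real) \<Rightarrow> bool" where
  "symmetric_density N F \<longleftrightarrow>
     (\<forall>p v. p permutes {..<N} \<longrightarrow> v \<in> sph N \<longrightarrow> F (v \<circ> p) = F v)"

definition rot :: "nat \<Rightarrow> nat \<Rightarrow> real \<Rightarrow> (nat \<Rightarrow> real) \<Rightarrow> (nat \<Rightarrow> real)" where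
  "rot i j \<theta> v = v(i := v i * cos \<theta> + v j * sin \<theta>, j := - v i * sin \<theta> + v j * cos \<theta>)"

definition psi :: "real \<Rightarrow> real \<Rightarrow> real" where
  "psi x y = (x - y) * ln (x / y)"

definition entropy_production :: "nat \<Rightarrow> real \<Rightarrow> ((nat \<Rightarrow> real) \<Rightarrow> real) \<Rightarrow> real" where
  "entropy_production N \<gamma> F =
     1 / (4 * pi) * (real N / real (N choose 2)) *
     (\<Sum>i<N. \<Sum>j\<in>{i<..<N}.
        \<integral>v. (LBINT \<theta>=0..2*pi. (1 + (v i)^2 + (v j)^2) powr \<gamma> * psi (F v) (F (rot i j \<theta> v)))
        \<partial>sigmaN N)"

definition rel_entropy :: "nat \<Rightarrow> ((nat \<Rightarrow> real) \<Rightarrow> real) \<Rightarrow> real" where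
  "rel_entropy N F = (\<integral>v. F v * ln (F v) \<partial>sigmaN N)"

text \<open>First marginal Pi_1(F), as the measure Pi_1(F)(x) dx on the real line
(law of v_1 under F d sigma^N).\<close>
definition marginal1 :: "nat \<Rightarrow> ((nat \<Rightarrow> real) \<Rightarrow> real) \<Rightarrow> real measure" where
  "marginal1 N F = distr (density (sigmaN N) (\<lambda>v. ennreal (F v))) lborel (\<lambda>v. v 0)"

definition moment :: "real \<Rightarrow> real measure \<Rightarrow> ennreal" where
  "moment k M = (\<integral>\<^sup>+x. ennreal (\<bar>x\<bar> powr k) \<partial>M)"

definition log_scalable :: "(nat \<Rightarrow> (nat \<Rightarrow> real) \<Rightarrow> real) \<Rightarrow> real \<Rightarrow> bool" where
  "log_scalable F C \<longleftrightarrow> C > 0 \<and>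
     (\<forall>N\<ge>2. \<forall>v\<in>sph N. 0 < F N v \<and> \<bar>ln (F N v)\<bar> \<le> C * real N)"

end

theory Submission
  imports Defs "HOL-Probability.Probability_Measure"
begin

text \<open>The heart of the matter is the inequality \<open>D\<^sub>N\<^sub>,\<^sub>1(F) \<ge> H\<^sub>N(F) / 3\<close>, proved in Villani's way by
  following both sides along the heat flow on the sphere. The flow is run on polynomials, where it is a
  finite system of linear ODEs, and general densities are reached by density. The generator is half the sum of
  the squares of the rotation fields \<open>X i j\<close>, so it commutes with rotations, and for \<open>G = F \<circ> R\<close> the
  quantity \<open>\<psi>(F, G)\<close> is dissipated at the rate \<open>(F + G) |\<nabla> log F - \<nabla> log G|\<^sup>2\<close>. Weighting by
  \<open>v\<^sub>i\<^sup>2 + v\<^sub>j\<^sup>2\<close> and averaging over the angle, the derivative of \<open>log F\<close> along the rotation has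
  mean zero on each circle, so the sum over the pairs is at least a multiple of the Fisher information,
  which is the dissipation of the entropy. A logarithmic Sobolev inequality absorbs the error terms.
  For \<open>\<gamma> < 1\<close> one truncates: the weight \<open>(1 + v\<^sub>i\<^sup>2 + v\<^sub>j\<^sup>2)\<^sup>\<gamma>\<close> is at least
  \<open>R\<^sup>\<gamma>\<^sup>-\<^sup>1 (1 + v\<^sub>i\<^sup>2 + v\<^sub>j\<^sup>2)\<close> below the level \<open>R\<close>, and above it \<open>\<psi>(F, G) \<le> 2 C\<^sub>F N (F + G)\<close>
  and the moment assumption control the loss.\<close>

section \<open>Polynomials and rotation fields\<close>

text \<open>The weight makes the bound uniform in N. Without it the flow gives only
  \<open>2 * Hrel\<close> for the sum over pairs, which the normalisation divides by N - 1. The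
  weight gains a factor N: on the sphere, N times the squared (i,j)-component of the bivector of v
  and W is at most v_i^2 + v_j^2 times its squared norm. The price is that the weight is not
  harmonic. Its image under the generator is 4 N - 2 N (v_i^2 + v_j^2), and the positive part feeds
  back 4 N times the unweighted production; a time-dependent coefficient 1 - 4 N t in front of the
  latter cancels exactly this. Polynomials are kept as syntax because rotation fields preserve the
  degree: existence, smoothness and commutation with all fields then need no PDE theory, and
  curvature is algebra in so(N). The curvature N - 2 vanishes for N = 2. There a single rotation
  group moves any point to any other, angular averages are integrals over the circle, and the
  inequality is a direct computation.\<close>

datatype pol = C real | V nat | Add pol pol | Mul pol pol

primrec pev :: "pol \<Rightarrow> (nat \<Rightarrow> real) \<Rightarrow> real" where
  "pev (C c) v = c"
| "pev (V k) v = v k"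
| "pev (Add p q) v = pev p v + pev q v"
| "pev (Mul p q) v = pev p v * pev q v"

primrec D :: "nat \<Rightarrow> pol \<Rightarrow> pol" where
  "D k (C c) = C 0"
| "D k (V l) = C (if k = l then 1 else 0)"
| "D k (Add p q) = Add (D k p) (D k q)"
| "D k (Mul p q) = Add (Mul (D k p) q) (Mul p (D k q))"

primrec sump :: "('i \<Rightarrow> pol) \<Rightarrow> 'i list \<Rightarrow> pol" where
  "sump f [] = C 0"
| "sump f (x # xs) = Add (f x) (sump f xs)"

lemma pev_sump: "pev (sump f xs) v = (\<Sum>x\<leftarrow>xs. pev (f x) v)"
  by (induction xs) auto

lemma pev_sump_upt [simp]: "pev (sump f [0..<n]) v = (\<Sum>i<n. pev (f i) v)"
  by (simp add: pev_sump interv_sum_list_conv_sum_set_nat atLeast0LessThan)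

lemma D_sump [simp]: "D k (sump f xs) = sump (\<lambda>x. D k (f x)) xs"
  by (induction xs) auto

text \<open>The infinitesimal generator of \<open>rot i j\<close>, tangent to every centred sphere;
  \<open>rot_deriv\<close> makes this precise.\<close>

definition X :: "nat \<Rightarrow> nat \<Rightarrow> pol \<Rightarrow> pol" where
  "X i j p = Add (Mul (V j) (D i p)) (Mul (C (-1)) (Mul (V i) (D j p)))"

lemma pev_X: "pev (X i j p) v = v j * pev (D i p) v - v i * pev (D j p) v"
  by (simp add: X_def)

lemma D_commute: "pev (D k (D l p)) v = pev (D l (D k p)) v"
  by (induction p) (auto simp: algebra_simps)

lemma pev_upd_deriv:
  "((\<lambda>x. pev p (v(k := x))) has_real_derivative pev (D k p) (v(k := x))) (at x)"
proof (induction p)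
  case (V l)
  then show ?case by (cases "k = l") auto
qed (auto intro!: derivative_eq_intros)

text \<open>\<open>D\<close> acts on syntax, so its invariance under equality of functions has to be
  earned: it follows from uniqueness of the partial derivative. It allows an identity between values
  of \<open>pev\<close> to be differentiated again.\<close>

lemma D_cong:
  assumes "pev p = pev q"
  shows "pev (D k p) = pev (D k q)"
proof
  fix v
  have "((\<lambda>x. pev p (v(k := x))) has_real_derivative pev (D k p) v) (at (v k))"
    using pev_upd_deriv[of p v k "v k"] by simp
  moreover have "((\<lambda>x. pev p (v(k := x))) has_real_derivative pev (D k q) v) (at (v k))"
    using pev_upd_deriv[of q v k "v k"] assms by simp
  ultimately show "pev (D k p) v = pev (D k q) v"
    by (rule DERIV_unique)
qed

lemma X_cong: "pev p = pev q \<Longrightarrow> pev (X i j p) = pev (X i j q)"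
  using D_cong[of p q] by (auto simp: pev_X fun_eq_iff)

lemma X_antisym: "pev (X j i p) v = - pev (X i j p) v"
  by (simp add: pev_X)

lemma X_self [simp]: "pev (X i i p) v = 0"
  by (simp add: pev_X)

text \<open>The half compensates for ordered pairs. By \<open>rlap_alt\<close> this is the
  Laplace-Beltrami operator of the unit sphere applied at every radius, so on radius sqrt N it is N
  times the intrinsic Laplacian.\<close>

definition rlap :: "nat \<Rightarrow> pol \<Rightarrow> pol" where
  "rlap N p = Mul (C (1/2)) (sump (\<lambda>i. sump (\<lambda>j. X i j (X i j p)) [0..<N]) [0..<N])"

lemma pev_Lp: "pev (rlap N p) v = (\<Sum>i<N. \<Sum>j<N. pev (X i j (X i j p)) v) / 2"
  by (simp add: rlap_def)

definition Eu :: "nat \<Rightarrow> pol \<Rightarrow> pol" where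
  "Eu N p = sump (\<lambda>k. Mul (V k) (D k p)) [0..<N]"

definition Lap :: "nat \<Rightarrow> pol \<Rightarrow> pol" where
  "Lap N p = sump (\<lambda>k. D k (D k p)) [0..<N]"

lemma pev_Eu: "pev (Eu N p) v = (\<Sum>k<N. v k * pev (D k p) v)"
  by (simp add: Eu_def)

lemma pev_Lap: "pev (Lap N p) v = (\<Sum>k<N. pev (D k (D k p)) v)"
  by (simp add: Lap_def)

lemma pev_D_Eu: "k < N \<Longrightarrow> pev (D k (Eu N p)) v = pev (D k p) v + pev (Eu N (D k p)) v"
proof -
  assume k: "k < N"
  have "pev (D k (Eu N p)) v = (\<Sum>l<N. (if k = l then 1 else 0) * pev (D l p) v + v l * pev (D k (D l p)) v)"
    by (simp add: Eu_def)
  also have "\<dots> = (\<Sum>l<N. (if k = l then pev (D l p) v else 0)) + (\<Sum>l<N. v l * pev (D l (D k p)) v)"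
    by (subst sum.distrib[symmetric], intro sum.cong) (auto simp: D_commute)
  also have "\<dots> = pev (D k p) v + pev (Eu N (D k p)) v"
    using k by (simp add: pev_Eu)
  finally show ?thesis .
qed

lemma Eu_cong: "pev p = pev q \<Longrightarrow> pev (Eu N p) = pev (Eu N q)"
  using D_cong[of p q] by (auto simp: pev_Eu fun_eq_iff)

lemma pev_D_X: "pev (D k (X i j p)) v =
   (if k = j then pev (D i p) v else 0) - (if k = i then pev (D j p) v else 0)
   + v j * pev (D k (D i p)) v - v i * pev (D k (D j p)) v"
  by (simp add: X_def)

lemma Eu_X:
  assumes "i < N" "j < N"
  shows "pev (Eu N (X i j p)) v = pev (X i j (Eu N p)) v"
proof -
  have "pev (Eu N (X i j p)) v = (\<Sum>k<N. (if k = j then v k * pev (D i p) v else 0) - (if k = i then v k * pev (D j p) v else 0)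
      + v j * (v k * pev (D k (D i p)) v) - v i * (v k * pev (D k (D j p)) v))"
    unfolding pev_Eu pev_D_X by (intro sum.cong) (auto simp: algebra_simps)
  also have "\<dots> = v j * pev (D i p) v - v i * pev (D j p) v + v j * pev (Eu N (D i p)) v - v i * pev (Eu N (D j p)) v"
    using assms by (simp add: sum.distrib sum_subtractf sum_distrib_left pev_Eu)
  also have "\<dots> = pev (X i j (Eu N p)) v"
    using assms by (simp add: pev_X pev_D_Eu algebra_simps)
  finally show ?thesis .
qed

lemma pev_D_D_X: "pev (D k (D k (X i j p))) v =
   (if k = j then 2 * pev (D j (D i p)) v else 0) - (if k = i then 2 * pev (D j (D i p)) v else 0)
   + v j * pev (D i (D k (D k p))) v - v i * pev (D j (D k (D k p))) v"
proof -
  have c: "pev (D k (D k (D i p))) v = pev (D i (D k (D k p))) v" for k i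
    using D_commute D_cong[of "D k (D i p)" "D i (D k p)"] by (metis ext)
  show ?thesis
    unfolding X_def by (auto simp: c D_commute[of i j])
qed

lemma Lap_X:
  assumes "i < N" "j < N"
  shows "pev (Lap N (X i j p)) v = pev (X i j (Lap N p)) v"
proof -
  have "pev (Lap N (X i j p)) v = v j * (\<Sum>k<N. pev (D i (D k (D k p))) v) - v i * (\<Sum>k<N. pev (D j (D k (D k p))) v)"
    unfolding pev_Lap pev_D_D_X using assms
    by (simp add: sum.distrib sum_subtractf sum_distrib_left)
  also have "\<dots> = pev (X i j (Lap N p)) v"
    by (simp add: pev_X Lap_def)
  finally show ?thesis .
qed

definition R2 :: "nat \<Rightarrow> pol" where
  "R2 N = sump (\<lambda>k. Mul (V k) (V k)) [0..<N]"

lemma pev_R2: "pev (R2 N) v = sqnorm N v"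
  by (simp add: R2_def sqnorm_def power2_eq_square)

lemma D_R2: "i < N \<Longrightarrow> pev (D i (R2 N)) v = 2 * v i"
proof -
  assume "i < N"
  have "pev (D i (R2 N)) v = (\<Sum>k<N. if i = k then 2 * v k else 0)"
    unfolding R2_def D_sump pev_sump_upt by (intro sum.cong) auto
  then show ?thesis using \<open>i < N\<close> by simp
qed

text \<open>The polar form of the generator, with \<open>Eu\<close> the Euler field. Each ingredient
  commutes with rotations, finite or infinitesimal, which spares the double commutators that the sum
  of squares would require.\<close>

lemma rlap_alt: "pev (rlap N p) v = sqnorm N v * pev (Lap N p) v - pev (Eu N (Eu N p)) v - (real N - 2) * pev (Eu N p) v"
proof -
  let ?d = "\<lambda>i. pev (D i p) v" and ?dd = "\<lambda>i j. pev (D i (D j p)) v"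
  have "pev (X i j (X i j p)) v =
      (v j)^2 * ?dd i i + (v i)^2 * ?dd j j - 2 * (v i * v j * ?dd i j) - v j * ?d j - v i * ?d i
      + (if i = j then 2 * (v i * ?d i) else 0)" for i j
    unfolding pev_X[of i j "X i j p"] pev_D_X using D_commute[of i j p v]
    by (auto simp: algebra_simps power2_eq_square)
  then have "pev (rlap N p) v = (\<Sum>i<N. \<Sum>j<N. (v j)^2 * ?dd i i + (v i)^2 * ?dd j j - 2 * (v i * v j * ?dd i j) - v j * ?d j - v i * ?d i
      + (if i = j then 2 * (v i * ?d i) else 0)) / 2"
    by (simp add: pev_Lp)
  also have "\<dots> = ((\<Sum>i<N. \<Sum>j<N. (v j)^2 * ?dd i i) + (\<Sum>i<N. \<Sum>j<N. (v i)^2 * ?dd j j)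
     - 2 * (\<Sum>i<N. \<Sum>j<N. v i * v j * ?dd i j) - (\<Sum>i<N. \<Sum>j<N. v j * ?d j) - (\<Sum>i<N. \<Sum>j<N. v i * ?d i)
     + (\<Sum>i<N. 2 * (v i * ?d i))) / 2"
    by (simp add: sum.distrib sum_subtractf sum_distrib_left)
  also have "(\<Sum>i<N. \<Sum>j<N. (v j)^2 * ?dd i i) = sqnorm N v * pev (Lap N p) v"
    by (subst sum.swap) (simp add: sqnorm_def pev_Lap sum_product)
  also have "(\<Sum>i<N. \<Sum>j<N. (v i)^2 * ?dd j j) = sqnorm N v * pev (Lap N p) v"
    by (simp add: sqnorm_def pev_Lap sum_product)
  also have "(\<Sum>i<N. \<Sum>j<N. v j * ?d j) = real N * pev (Eu N p) v"
    by (simp add: pev_Eu)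
  also have "(\<Sum>i<N. \<Sum>j<N. v i * ?d i) = real N * pev (Eu N p) v"
    by (simp add: pev_Eu sum_distrib_left)
  also have "(\<Sum>i<N. 2 * (v i * ?d i)) = 2 * pev (Eu N p) v"
    by (simp add: pev_Eu sum_distrib_left)
  also have "(\<Sum>i<N. \<Sum>j<N. v i * v j * ?dd i j) = pev (Eu N (Eu N p)) v - pev (Eu N p) v"
  proof -
    have "pev (Eu N (Eu N p)) v = (\<Sum>k<N. v k * (?d k + (\<Sum>l<N. v l * ?dd l k)))"
      by (simp add: pev_Eu[of N "Eu N p"] pev_D_Eu) (simp add: pev_Eu)
    also have "\<dots> = pev (Eu N p) v + (\<Sum>i<N. \<Sum>j<N. v i * v j * ?dd i j)"
      by (simp add: pev_Eu distrib_left sum.distrib sum_distrib_left D_commute mult.assoc)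
    finally show ?thesis by simp
  qed
  finally show ?thesis by (simp add: field_simps)
qed

lemma rlap_X_commute:
  assumes "i < N" "j < N"
  shows "pev (rlap N (X i j p)) = pev (X i j (rlap N p))"
proof -
  \<comment> \<open>The polar form as a term of the syntax, so that \<open>X_cong\<close> applies to
    it.\<close>
  let ?L = "\<lambda>p. Add (Mul (R2 N) (Lap N p)) (Add (Mul (C (-1)) (Eu N (Eu N p))) (Mul (C (-(real N - 2))) (Eu N p)))"
  have L: "pev (rlap N q) = pev (?L q)" for q
    by (rule ext) (simp add: rlap_alt pev_R2 algebra_simps)
  have E: "pev (Eu N (X i j q)) = pev (X i j (Eu N q))" for q
    using Eu_X[OF assms] by auto
  have "pev (X i j (rlap N p)) v = pev (X i j (?L p)) v" for v
    using X_cong[OF L] by metis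
  also have "\<dots> v = pev (rlap N (X i j p)) v" for v
    unfolding L pev.simps E Eu_cong[OF E]
    using assms by (simp add: pev_X D_R2 Lap_X algebra_simps)
  finally show ?thesis by auto
qed

section \<open>Plane rotations acting on polynomials, and the commutation relations\<close>

primrec rotp :: "nat \<Rightarrow> nat \<Rightarrow> real \<Rightarrow> pol \<Rightarrow> pol" where
  "rotp i j \<theta> (C c) = C c"
| "rotp i j \<theta> (V k) = (if k = j then Add (Mul (C (- sin \<theta>)) (V i)) (Mul (C (cos \<theta>)) (V j))
     else if k = i then Add (Mul (C (cos \<theta>)) (V i)) (Mul (C (sin \<theta>)) (V j)) else V k)"
| "rotp i j \<theta> (Add p q) = Add (rotp i j \<theta> p) (rotp i j \<theta> q)"
| "rotp i j \<theta> (Mul p q) = Mul (rotp i j \<theta> p) (rotp i j \<theta> q)"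

lemma pev_rotp: "pev (rotp i j \<theta> p) v = pev p (rot i j \<theta> v)"
  by (induction p) (auto simp: rot_def)

lemma D_rotp:
  assumes "i \<noteq> j"
  shows "pev (D k (rotp i j \<theta> p)) v =
    (if k = i then cos \<theta> * pev (D i p) (rot i j \<theta> v) - sin \<theta> * pev (D j p) (rot i j \<theta> v)
     else if k = j then sin \<theta> * pev (D i p) (rot i j \<theta> v) + cos \<theta> * pev (D j p) (rot i j \<theta> v)
     else pev (D k p) (rot i j \<theta> v))"
  using assms by (induction p) (auto simp: pev_rotp algebra_simps)

lemma rot_i: "i \<noteq> j \<Longrightarrow> rot i j \<theta> v i = v i * cos \<theta> + v j * sin \<theta>"
  and rot_j: "rot i j \<theta> v j = - v i * sin \<theta> + v j * cos \<theta>"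
  and rot_other: "k \<noteq> i \<Longrightarrow> k \<noteq> j \<Longrightarrow> rot i j \<theta> v k = v k"
  by (auto simp: rot_def)

lemma sum_split_two:
  fixes f :: "nat \<Rightarrow> real"
  assumes "i \<noteq> j" "i < N" "j < N"
  shows "(\<Sum>k<N. f k) = f i + f j + (\<Sum>k\<in>{..<N} - {i, j}. f k)"
proof -
  have "(\<Sum>k<N. f k) = f i + (\<Sum>k\<in>{..<N} - {i}. f k)"
    using assms by (subst sum.remove[of _ i]) auto
  also have "(\<Sum>k\<in>{..<N} - {i}. f k) = f j + (\<Sum>k\<in>{..<N} - {i} - {j}. f k)"
    using assms by (subst sum.remove[of _ j]) auto
  also have "{..<N} - {i} - {j} = {..<N} - {i, j}" by auto
  finally show ?thesis by simp
qed

lemma sqnorm_rot: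
  assumes "i \<noteq> j" "i < N" "j < N"
  shows "sqnorm N (rot i j \<theta> v) = sqnorm N v"
proof -
  have "(v i * cos \<theta> + v j * sin \<theta>)\<^sup>2 + (- v i * sin \<theta> + v j * cos \<theta>)\<^sup>2
     = ((v i)\<^sup>2 + (v j)\<^sup>2) * ((sin \<theta>)\<^sup>2 + (cos \<theta>)\<^sup>2)"
    by algebra
  then show ?thesis
    unfolding sqnorm_def sum_split_two[OF assms] using assms(1)
    by (simp add: rot_i rot_j rot_other)
qed

lemma Eu_rotp:
  assumes "i \<noteq> j" "i < N" "j < N"
  shows "pev (Eu N (rotp i j \<theta> p)) v = pev (Eu N p) (rot i j \<theta> v)"
  unfolding pev_Eu sum_split_two[OF assms] using assms(1)
  by (simp add: D_rotp rot_i rot_j rot_other algebra_simps)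

lemma Lap_rotp:
  assumes "i \<noteq> j" "i < N" "j < N"
  shows "pev (Lap N (rotp i j \<theta> p)) v = pev (Lap N p) (rot i j \<theta> v)"
proof -
  let ?R = "rotp i j \<theta>" and ?w = "rot i j \<theta> v"
  have Di: "pev (D i (?R q)) = pev (Add (Mul (C (cos \<theta>)) (?R (D i q))) (Mul (C (-sin \<theta>)) (?R (D j q))))" for q
    using assms(1) by (auto simp: D_rotp pev_rotp)
  have Dj: "pev (D j (?R q)) = pev (Add (Mul (C (sin \<theta>)) (?R (D i q))) (Mul (C (cos \<theta>)) (?R (D j q))))" for q
    using assms(1) by (auto simp: D_rotp pev_rotp)
  have Dk: "pev (D k (?R q)) = pev (?R (D k q))" if "k \<noteq> i" "k \<noteq> j" for k q
    using assms(1) that by (auto simp: D_rotp pev_rotp)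
  have "pev (D i (D i (?R p))) v = (cos \<theta>)^2 * pev (D i (D i p)) ?w - 2 * cos \<theta> * sin \<theta> * pev (D i (D j p)) ?w
     + (sin \<theta>)^2 * pev (D j (D j p)) ?w"
    unfolding D_cong[OF Di] using assms(1)
    by (simp add: D_rotp D_commute[of j i] algebra_simps power2_eq_square)
  moreover have "pev (D j (D j (?R p))) v = (sin \<theta>)^2 * pev (D i (D i p)) ?w + 2 * cos \<theta> * sin \<theta> * pev (D i (D j p)) ?w
     + (cos \<theta>)^2 * pev (D j (D j p)) ?w"
    unfolding D_cong[OF Dj] using assms(1)
    by (simp add: D_rotp D_commute[of j i] algebra_simps power2_eq_square)
  ultimately have "pev (D i (D i (?R p))) v + pev (D j (D j (?R p))) v
     = ((sin \<theta>)^2 + (cos \<theta>)^2) * (pev (D i (D i p)) ?w + pev (D j (D j p)) ?w)"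
    by algebra
  then have "pev (D i (D i (?R p))) v + pev (D j (D j (?R p))) v = pev (D i (D i p)) ?w + pev (D j (D j p)) ?w"
    by simp
  moreover have "pev (D k (D k (?R p))) v = pev (D k (D k p)) ?w" if "k \<in> {..<N} - {i,j}" for k
    using that D_cong[OF Dk[of k p], of k] Dk[of k "D k p"] by (simp add: pev_rotp)
  ultimately show ?thesis
    unfolding pev_Lap sum_split_two[OF assms] by simp
qed

lemma rlap_rotp:
  assumes "i \<noteq> j" "i < N" "j < N"
  shows "pev (rlap N (rotp i j \<theta> p)) v = pev (rlap N p) (rot i j \<theta> v)"
proof -
  have "pev (Eu N (rotp i j \<theta> q)) = pev (rotp i j \<theta> (Eu N q))" for q
    using Eu_rotp[OF assms] by (auto simp: pev_rotp)
  then have "pev (Eu N (Eu N (rotp i j \<theta> p))) v = pev (Eu N (Eu N p)) (rot i j \<theta> v)"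
    using Eu_cong Eu_rotp[OF assms] by metis
  then show ?thesis
    by (simp add: rlap_alt sqnorm_rot[OF assms] Lap_rotp[OF assms] Eu_rotp[OF assms])
qed

text \<open>Rotations in the same plane commute, so no other field enters here. This is why the
  comparison with the Fisher information can be made pair by pair.\<close>

lemma X_rotp:
  assumes "i \<noteq> j"
  shows "pev (X i j (rotp i j \<theta> p)) v = pev (X i j p) (rot i j \<theta> v)"
  using assms by (simp add: pev_X D_rotp rot_i rot_j algebra_simps)

lemma rot_deriv:
  assumes "i \<noteq> j"
  shows "((\<lambda>\<theta>. pev p (rot i j \<theta> v)) has_real_derivative pev (X i j p) (rot i j \<theta> v)) (at \<theta>)"
proof (induction p)
  case (C c)
  then show ?case by (simp add: pev_X)
next
  case (V k)
  then show ?case using assms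
    by (auto simp: pev_X rot_def intro!: derivative_eq_intros)
next
  case (Add p q)
  then show ?case
    by (auto simp: pev_X algebra_simps intro!: derivative_eq_intros)
next
  case (Mul p q)
  then show ?case
    by (auto simp: pev_X algebra_simps intro!: derivative_eq_intros)
qed

text \<open>The structure constants of so(N): the second derivatives cancel by
  \<open>D_commute\<close>. All curvature in the proof comes from this identity.\<close>

lemma commutator:
  "pev (X i j (X k l p)) v - pev (X k l (X i j p)) v =
    (if i = l then pev (X k j p) v else 0) + (if j = k then pev (X l i p) v else 0)
  + (if i = k then pev (X j l p) v else 0) + (if j = l then pev (X i k p) v else 0)"
  unfolding pev_X[of i j "X k l p"] pev_X[of k l "X i j p"] pev_D_X
  using D_commute[of i k p v] D_commute[of i l p v] D_commute[of j k p v] D_commute[of j l p v]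
  by (auto simp: pev_X algebra_simps)

section \<open>Invariance of the uniform measure on the sphere\<close>

definition bor :: "nat \<Rightarrow> (nat \<Rightarrow> real) measure" where
  "bor N = PiM {..<N} (\<lambda>_. borel)"

lemma space_bor: "space (bor N) = PiE {..<N} (\<lambda>_. UNIV)"
  by (simp add: bor_def space_PiM)

lemma sets_lebN [measurable_cong]: "sets (lebN N) = sets (bor N)"
  unfolding lebN_def bor_def by (intro sets_PiM_cong) auto

lemma space_lebN: "space (lebN N) = PiE {..<N} (\<lambda>_. UNIV)"
  by (simp add: lebN_def space_PiM)

text \<open>Outside the index range an extensional function is constantly \<open>undefined\<close>,
  so later measurability goals need no bound on the index.\<close>

lemma coord_measurable [measurable]: "(\<lambda>v. v k) \<in> borel_measurable (bor N)"
proof (cases "k < N")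
  case True
  then show ?thesis unfolding bor_def by (intro measurable_component_singleton) auto
next
  case False
  have "v k = undefined" if "v \<in> space (bor N)" for v :: "nat \<Rightarrow> real"
    using that False by (auto simp: space_bor)
  then show ?thesis
    by (subst measurable_cong[where g = "\<lambda>_. undefined"]) auto
qed

lemma measurable_borI:
  assumes "\<And>k. k < N \<Longrightarrow> (\<lambda>x. f x k) \<in> borel_measurable M"
    and "\<And>x. x \<in> space M \<Longrightarrow> f x \<in> extensional {..<N}"
  shows "f \<in> measurable M (bor N)"
  unfolding bor_def using assms by (intro measurable_PiM_single') (auto simp: PiE_def)

lemma sqnorm_measurable [measurable]: "sqnorm N \<in> borel_measurable (bor M)"
  unfolding sqnorm_def by measurable

lemma upd_measurable:
  assumes "i < N" "g \<in> borel_measurable (bor N)"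
  shows "(\<lambda>x. x(i := g x)) \<in> measurable (bor N) (bor N)"
proof (rule measurable_borI)
  fix k assume "k < N"
  show "(\<lambda>x. (x(i := g x)) k) \<in> borel_measurable (bor N)"
    using assms(2) by (cases "k = i") auto
qed (use assms in \<open>auto simp: space_bor extensional_def\<close>)

lemma rot_measurable [measurable]:
  assumes "i < N" "j < N"
  shows "rot i j \<theta> \<in> measurable (bor N) (bor N)"
proof (rule measurable_borI)
  fix k assume "k < N"
  consider "k = j" | "k = i" "k \<noteq> j" | "k \<noteq> i" "k \<noteq> j" by blast
  then show "(\<lambda>x. rot i j \<theta> x k) \<in> borel_measurable (bor N)"
    by cases (auto simp: rot_def)
qed (use assms in \<open>auto simp: rot_def space_bor extensional_def\<close>)

definition preserves_lebN :: "nat \<Rightarrow> ((nat \<Rightarrow> real) \<Rightarrow> (nat \<Rightarrow> real)) \<Rightarrow> bool" where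
  "preserves_lebN N T \<longleftrightarrow> T \<in> measurable (bor N) (bor N) \<and> distr (lebN N) (bor N) T = lebN N"

lemma preserves_lebN_comp:
  assumes "preserves_lebN N T" "preserves_lebN N U"
  shows "preserves_lebN N (\<lambda>x. T (U x))"
proof -
  have TU [measurable]: "T \<in> measurable (bor N) (bor N)" "U \<in> measurable (bor N) (bor N)"
    using assms by (auto simp: preserves_lebN_def)
  have [measurable]: "U \<in> measurable (lebN N) (bor N)" by measurable
  have "distr (lebN N) (bor N) (T \<circ> U) = distr (distr (lebN N) (bor N) U) (bor N) T"
    by (subst distr_distr) auto
  also have "\<dots> = lebN N"
    using assms by (simp add: preserves_lebN_def)
  finally show ?thesis by (simp add: preserves_lebN_def o_def)
qed

text \<open>Fubini in coordinate i: with the other coordinates fixed, the shear is a translation of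
  the line.\<close>

lemma shear_preserves_lebN:
  assumes "i < N" "j < N" "i \<noteq> j"
  shows "preserves_lebN N (\<lambda>x. x(i := x i + c * x j))"
proof -
  let ?T = "\<lambda>x :: nat \<Rightarrow> real. x(i := x i + c * x j)"
  have T [measurable]: "?T \<in> measurable (bor N) (bor N)"
    using assms(1) by (intro upd_measurable) measurable
  interpret product_sigma_finite "\<lambda>_ :: nat. lborel :: real measure"
    by standard
  have ins: "insert i ({..<N} - {i}) = {..<N}" using assms(1) by auto
  have fold: "(\<integral>\<^sup>+v. f v \<partial>lebN N) = (\<integral>\<^sup>+x. \<integral>\<^sup>+y. f (x(i := y)) \<partial>lborel \<partial>PiM ({..<N} - {i}) (\<lambda>_. lborel))"
    if "f \<in> borel_measurable (lebN N)" for f :: "(nat \<Rightarrow> real) \<Rightarrow> ennreal"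
    using product_nn_integral_insert[of "{..<N} - {i}" i f] that
    unfolding ins lebN_def by simp
  have "distr (lebN N) (bor N) ?T = lebN N"
  proof (rule measure_eqI)
    fix A assume "A \<in> sets (distr (lebN N) (bor N) ?T)"
    then have A [measurable]: "A \<in> sets (bor N)" by simp
    have A': "A \<in> sets (lebN N)" using A by (simp add: sets_lebN)
    have "emeasure (distr (lebN N) (bor N) ?T) A = (\<integral>\<^sup>+v. indicator A v \<partial>distr (lebN N) (bor N) ?T)"
      by simp
    also have "\<dots> = (\<integral>\<^sup>+v. indicator A (?T v) \<partial>lebN N)"
      by (rule nn_integral_distr) measurable
    also have "\<dots> = (\<integral>\<^sup>+x. \<integral>\<^sup>+y. indicator A (?T (x(i := y))) \<partial>lborel \<partial>PiM ({..<N} - {i}) (\<lambda>_. lborel))"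
      by (rule fold) measurable
    also have "\<dots> = (\<integral>\<^sup>+x. \<integral>\<^sup>+y. indicator A (x(i := y)) \<partial>lborel \<partial>PiM ({..<N} - {i}) (\<lambda>_. lborel))"
    proof (rule nn_integral_cong)
      fix x assume x: "x \<in> space (PiM ({..<N} - {i}) (\<lambda>_. lborel :: real measure))"
      have m: "(\<lambda>y. x(i := y)) \<in> measurable borel (bor N)"
      proof (rule measurable_borI)
        fix k assume "k < N"
        show "(\<lambda>y. (x(i := y)) k) \<in> borel_measurable borel" by (cases "k = i") auto
      qed (use x assms(1) in \<open>auto simp: space_PiM PiE_def extensional_def\<close>)
      have "(\<integral>\<^sup>+y. indicator A (x(i := y)) \<partial>lborel) = (\<integral>\<^sup>+y. indicator A (x(i := c * x j + 1 * y)) \<partial>lborel)"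
        using m by (subst nn_integral_real_affine[of _ 1 "c * x j"]) auto
      then show "(\<integral>\<^sup>+y. indicator A (?T (x(i := y))) \<partial>lborel) = (\<integral>\<^sup>+y. indicator A (x(i := y)) \<partial>lborel)"
        using assms(3) by (simp add: add.commute)
    qed
    also have "\<dots> = (\<integral>\<^sup>+v. indicator A v \<partial>lebN N)"
      by (rule fold[symmetric]) (use A' in measurable)
    also have "\<dots> = emeasure (lebN N) A" using A' by simp
    finally show "emeasure (distr (lebN N) (bor N) ?T) A = emeasure (lebN N) A" .
  qed (simp add: sets_lebN)
  then show ?thesis using T by (simp add: preserves_lebN_def)
qed

lemma rot_add:
  assumes "i \<noteq> j"
  shows "rot i j a (rot i j b v) = rot i j (a + b) v"
  using assms by (auto simp: rot_def fun_eq_iff cos_add sin_add algebra_simps)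

lemma rot_zero [simp]: "rot i j 0 v = v"
  by (auto simp: rot_def fun_eq_iff)

text \<open>A rotation is a product of three shears with parameters tan(\<theta>/2), - sin \<theta>
  and tan(\<theta>/2). This reduces invariance to translations and avoids a change of variables in
  several dimensions.\<close>

lemma rot_preserves_lebN_aux:
  assumes "i < N" "j < N" "i \<noteq> j" "cos (\<theta>/2) \<noteq> 0"
  shows "preserves_lebN N (rot i j \<theta>)"
proof -
  let ?t = "tan (\<theta>/2)"
  let ?A = "\<lambda>x :: nat \<Rightarrow> real. x(i := x i + ?t * x j)" and ?B = "\<lambda>x :: nat \<Rightarrow> real. x(j := x j + (- sin \<theta>) * x i)"
  have s: "sin \<theta> = 2 * sin (\<theta>/2) * cos (\<theta>/2)" using sin_double[of "\<theta>/2"] by simp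
  have c: "cos \<theta> = 2 * (cos (\<theta>/2))^2 - 1" using cos_double_cos[of "\<theta>/2"] by simp
  have sq: "(sin (\<theta>/2))^2 = 1 - (cos (\<theta>/2))^2" by (simp add: sin_squared_eq)
  have 1: "1 - ?t * sin \<theta> = cos \<theta>"
  proof -
    have "?t * sin \<theta> = 2 * (sin (\<theta>/2))^2"
      using assms(4) unfolding tan_def s by (simp add: power2_eq_square)
    then show ?thesis unfolding sq c by simp
  qed
  have "?t * cos \<theta> + ?t = sin \<theta>"
    using assms(4) unfolding tan_def s c by (simp add: field_simps power2_eq_square)
  then have 2: "?t + ?t * cos \<theta> = sin \<theta>" by simp
  have "?A (?B (?A x)) = rot i j \<theta> x" for x
  proof
    fix k
    have "x i + ?t * x j + ?t * (x j - sin \<theta> * (x i + ?t * x j)) =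
       x i * (1 - ?t * sin \<theta>) + x j * (?t + ?t * (1 - ?t * sin \<theta>))" by (simp add: algebra_simps)
    also have "\<dots> = x i * cos \<theta> + x j * sin \<theta>" by (simp only: 1 2)
    finally have a: "x i + ?t * x j + ?t * (x j - sin \<theta> * (x i + ?t * x j)) = x i * cos \<theta> + x j * sin \<theta>" .
    have "x j - sin \<theta> * (x i + ?t * x j) = - x i * sin \<theta> + x j * (1 - ?t * sin \<theta>)"
      by (simp add: algebra_simps)
    then have b: "x j - sin \<theta> * (x i + ?t * x j) = - x i * sin \<theta> + x j * cos \<theta>" by (simp only: 1)
    show "?A (?B (?A x)) k = rot i j \<theta> x k"
      using assms(3) a b by (auto simp: rot_def)
  qed
  moreover have "preserves_lebN N (\<lambda>x. ?A (?B (?A x)))"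
  proof -
    have A: "preserves_lebN N ?A" and B: "preserves_lebN N ?B"
      using assms shear_preserves_lebN[of i N j ?t] shear_preserves_lebN[of j N i "- sin \<theta>"] by auto
    show ?thesis by (rule preserves_lebN_comp[OF A preserves_lebN_comp[OF B A]])
  qed
  ultimately show ?thesis by simp
qed

lemma rot_preserves_lebN:
  assumes "i < N" "j < N" "i \<noteq> j"
  shows "preserves_lebN N (rot i j \<theta>)"
proof (cases "cos (\<theta>/2) = 0")
  case False
  then show ?thesis using rot_preserves_lebN_aux assms by blast
next
  case True
  \<comment> \<open>The half turn has no such factorisation, but cos(\<theta>/2) = 0 forces
    cos(\<theta>/4)^2 = 1/2, so two rotations by \<theta>/2 do.\<close>
  have "cos (\<theta>/2/2) \<noteq> 0"
    using cos_double_cos[of "\<theta>/2/2"] True by auto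
  then have "preserves_lebN N (rot i j (\<theta>/2))"
    using rot_preserves_lebN_aux[of i N j "\<theta>/2"] assms by blast
  from preserves_lebN_comp[OF this this] show ?thesis
    using assms(3) by (simp add: rot_add)
qed

text \<open>Boxes determine the product measure, and on a box the claim is the reindexing of a
  finite product.\<close>

lemma perm_preserves_lebN:
  assumes p: "p permutes {..<N}"
  shows "preserves_lebN N (\<lambda>x. x \<circ> p)"
proof -
  interpret product_sigma_finite "\<lambda>_ :: nat. lborel :: real measure"
    by standard
  have [measurable]: "(\<lambda>x. x \<circ> p) \<in> measurable (bor N) (bor N)"
  proof (rule measurable_borI)
    fix x k assume "x \<in> space (bor N)"
    then show "x \<circ> p \<in> extensional {..<N}"
      using p by (auto simp: space_bor extensional_def permutes_def PiE_def)
  qed (use p in auto)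
  have "distr (lebN N) (bor N) (\<lambda>x. x \<circ> p) = PiM {..<N} (\<lambda>_. lborel)"
  proof (rule PiM_eqI)
    show "sets (distr (lebN N) (bor N) (\<lambda>x. x \<circ> p)) = sets (PiM {..<N} (\<lambda>_. lborel :: real measure))"
      using sets_lebN[of N] by (simp add: lebN_def)
  next
    fix A :: "nat \<Rightarrow> real set" assume A: "\<And>i. i \<in> {..<N} \<Longrightarrow> A i \<in> sets lborel"
    have inv: "inv p permutes {..<N}" using p by (rule permutes_inv)
    have [measurable]: "Pi\<^sub>E {..<N} A \<in> sets (bor N)"
      unfolding bor_def using A by (intro sets_PiM_I_finite) auto
    have "emeasure (distr (lebN N) (bor N) (\<lambda>x. x \<circ> p)) (Pi\<^sub>E {..<N} A) =
       emeasure (lebN N) ((\<lambda>x. x \<circ> p) -` Pi\<^sub>E {..<N} A \<inter> space (lebN N))"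
      by (rule emeasure_distr) auto
    also have "(\<lambda>x. x \<circ> p) -` Pi\<^sub>E {..<N} A \<inter> space (lebN N) = Pi\<^sub>E {..<N} (\<lambda>i. A (inv p i))"
    proof (intro set_eqI iffI)
      fix x assume "x \<in> (\<lambda>x. x \<circ> p) -` Pi\<^sub>E {..<N} A \<inter> space (lebN N)"
      then have x: "x \<circ> p \<in> Pi\<^sub>E {..<N} A" "x \<in> space (lebN N)" by blast+
      show "x \<in> Pi\<^sub>E {..<N} (\<lambda>i. A (inv p i))"
      proof (rule PiE_I)
        fix i assume "i \<in> {..<N}"
        then have "inv p i \<in> {..<N}" using permutes_in_image[OF inv] by blast
        then have "(x \<circ> p) (inv p i) \<in> A (inv p i)" by (rule PiE_mem[OF x(1)])
        then show "x i \<in> A (inv p i)" using permutes_inverses[OF p] by simp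
      next
        fix i assume "i \<notin> {..<N}"
        with x(2) show "x i = undefined" by (auto simp: space_lebN)
      qed
    next
      fix x assume x: "x \<in> Pi\<^sub>E {..<N} (\<lambda>i. A (inv p i))"
      have "x \<circ> p \<in> Pi\<^sub>E {..<N} A"
      proof (rule PiE_I)
        fix i assume "i \<in> {..<N}"
        then have "p i \<in> {..<N}" using permutes_in_image[OF p] by blast
        then have "x (p i) \<in> A (inv p (p i))" by (rule PiE_mem[OF x])
        then show "(x \<circ> p) i \<in> A i" using permutes_inverses[OF p] by simp
      next
        fix i assume i: "i \<notin> {..<N}"
        then have "p i = i" using p by (auto simp: permutes_def)
        then show "(x \<circ> p) i = undefined" using PiE_arb[OF x i] by simp
      qed
      moreover have "x \<in> space (lebN N)" using x by (auto simp: space_lebN PiE_def)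
      ultimately show "x \<in> (\<lambda>x. x \<circ> p) -` Pi\<^sub>E {..<N} A \<inter> space (lebN N)" by blast
    qed
    also have "emeasure (lebN N) (Pi\<^sub>E {..<N} (\<lambda>i. A (inv p i))) = (\<Prod>i<N. emeasure lborel (A (inv p i)))"
      unfolding lebN_def
      using A permutes_in_image[OF inv] by (intro emeasure_PiM) blast+
    also have "\<dots> = (\<Prod>i<N. emeasure lborel (A i))"
      using prod.permute[OF inv, of "\<lambda>i. emeasure lborel (A i)"] by (simp add: o_def)
    finally show "emeasure (distr (lebN N) (bor N) (\<lambda>x. x \<circ> p)) (Pi\<^sub>E {..<N} A) = (\<Prod>i<N. emeasure lborel (A i))" .
  qed auto
  then show ?thesis by (simp add: preserves_lebN_def lebN_def)
qed

section \<open>The uniform measure on the sphere and its symmetries\<close>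

lemma ballN_eq: "ballN N = {v \<in> space (bor N). sqnorm N v \<le> real N}"
  by (simp add: ballN_def space_bor)

lemma ballN_sets [measurable]: "ballN N \<in> sets (bor N)"
  unfolding ballN_eq by measurable

lemma sph_eq: "sph N = {v \<in> space (bor N). sqnorm N v = real N}"
  by (simp add: sph_def space_bor)

lemma sph_sets [measurable]: "sph N \<in> sets (bor N)"
  unfolding sph_eq by measurable

lemma sqnorm_nonneg: "0 \<le> sqnorm N v"
  by (simp add: sqnorm_def sum_nonneg)

lemma coord_le_sqnorm: "i < N \<Longrightarrow> (v i)^2 \<le> sqnorm N v"
  unfolding sqnorm_def by (rule member_le_sum[of i "{..<N}" "\<lambda>i. (v i)^2"]) auto

lemma emeasure_lebN_PiE:
  "(\<And>i. i < N \<Longrightarrow> A i \<in> sets borel) \<Longrightarrow> emeasure (lebN N) (Pi\<^sub>E {..<N} A) = (\<Prod>i<N. emeasure lborel (A i))"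
proof -
  interpret product_sigma_finite "\<lambda>_ :: nat. lborel :: real measure"
    by standard
  assume "\<And>i. i < N \<Longrightarrow> A i \<in> sets borel"
  then show ?thesis unfolding lebN_def by (intro emeasure_PiM) auto
qed

lemma ballN_emeasure:
  shows "emeasure (lebN N) (ballN N) \<noteq> 0" "emeasure (lebN N) (ballN N) \<noteq> \<infinity>"
proof -
  have box: "Pi\<^sub>E {..<N} (\<lambda>_. {-a..a}) \<in> sets (lebN N)" for a :: real
    unfolding sets_lebN bor_def by (intro sets_PiM_I_finite) auto
  have em: "emeasure (lebN N) (Pi\<^sub>E {..<N} (\<lambda>_. {-a..a})) = ennreal (2 * a) ^ N" if "a \<ge> 0" for a :: real
  proof -
    have "emeasure lborel {-a..a} = ennreal (2 * a)" using that by simp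
    then show ?thesis by (subst emeasure_lebN_PiE) (simp_all only: prod_constant card_lessThan, auto)
  qed
  have "Pi\<^sub>E {..<N} (\<lambda>_. {-1..1}) \<subseteq> ballN N"
  proof
    fix v :: "nat \<Rightarrow> real" assume v: "v \<in> Pi\<^sub>E {..<N} (\<lambda>_. {-1..1})"
    have "sqnorm N v \<le> (\<Sum>i<N. 1)"
      unfolding sqnorm_def
    proof (rule sum_mono)
      fix i assume "i \<in> {..<N}"
      then have "v i \<in> {-1..1}" using v by (auto simp: PiE_def Pi_def)
      then show "(v i)\<^sup>2 \<le> 1" by (simp add: abs_square_le_1 abs_le_iff)
    qed
    then show "v \<in> ballN N" using v by (auto simp: ballN_def PiE_def)
  qed
  then have "emeasure (lebN N) (Pi\<^sub>E {..<N} (\<lambda>_. {-1..1})) \<le> emeasure (lebN N) (ballN N)"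
    by (rule emeasure_mono) (simp add: sets_lebN)
  then show "emeasure (lebN N) (ballN N) \<noteq> 0"
    using em[of 1] by auto
  have "ballN N \<subseteq> Pi\<^sub>E {..<N} (\<lambda>_. {-sqrt N..sqrt N})"
  proof
    fix v assume v: "v \<in> ballN N"
    have "v i \<in> {-sqrt N..sqrt N}" if "i < N" for i
    proof -
      have "(v i)^2 \<le> N" using coord_le_sqnorm[OF that, of v] v by (simp add: ballN_def)
      then have "\<bar>v i\<bar> \<le> sqrt N" by (rule real_le_rsqrt[of "\<bar>v i\<bar>", simplified])
      then show ?thesis by auto
    qed
    then show "v \<in> Pi\<^sub>E {..<N} (\<lambda>_. {-sqrt N..sqrt N})" using v by (auto simp: ballN_def PiE_def)
  qed
  then have "emeasure (lebN N) (ballN N) \<le> emeasure (lebN N) (Pi\<^sub>E {..<N} (\<lambda>_. {-sqrt N..sqrt N}))"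
    by (rule emeasure_mono) (rule box)
  also have "\<dots> < \<infinity>" by (subst em) (simp_all add: ennreal_power)
  finally show "emeasure (lebN N) (ballN N) \<noteq> \<infinity>" by simp
qed

lemma radial_measurable [measurable]: "radial N \<in> measurable (bor N) (bor N)"
  unfolding radial_def by (rule measurable_borI) auto

lemma sigmaN_eq: "sigmaN N = distr (uniform_measure (lebN N) (ballN N)) (bor N) (radial N)"
  by (simp add: sigmaN_def bor_def)

lemma sets_sigmaN [measurable_cong]: "sets (sigmaN N) = sets (bor N)"
  by (simp add: sigmaN_eq)

lemma space_sigmaN: "space (sigmaN N) = space (bor N)"
  by (simp add: sigmaN_eq)

lemma prob_space_sigmaN: "prob_space (sigmaN N)"
proof -
  interpret prob_space "uniform_measure (lebN N) (ballN N)"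
    by (rule prob_space_uniform_measure) (use ballN_emeasure in auto)
  show ?thesis unfolding sigmaN_eq by (rule prob_space_distr) measurable
qed

lemma radial_in_sph:
  assumes "sqnorm N x \<noteq> 0"
  shows "radial N x \<in> sph N"
proof -
  have "sqnorm N x > 0" using sqnorm_nonneg[of N x] assms by simp
  have "sqnorm N (radial N x) = (\<Sum>i<N. N / sqnorm N x * (x i)^2)"
    unfolding sqnorm_def[of N "radial N x"]
    using \<open>sqnorm N x > 0\<close> by (intro sum.cong) (auto simp: radial_def power_mult_distrib power_divide)
  also have "\<dots> = N / sqnorm N x * sqnorm N x"
    by (simp add: sqnorm_def sum_distrib_left)
  finally show ?thesis
    using assms by (auto simp: sph_def radial_def)
qed

text \<open>\<open>radial\<close> misses the sphere only where the norm vanishes and the division is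
  by zero. That set lies in the hyperplane of points whose coordinate 0 vanishes, which is
  null.\<close>

lemma AE_sph:
  assumes "0 < N"
  shows "AE v in sigmaN N. v \<in> sph N"
proof -
  have "AE x in lebN N. sqnorm N x \<noteq> 0"
  proof (rule AE_I)
    have "0 \<in> {..<N}" using assms by simp
    show "{x \<in> space (lebN N). \<not> sqnorm N x \<noteq> 0} \<subseteq> Pi\<^sub>E {..<N} (\<lambda>i. if i = 0 then {0} else UNIV)"
    proof
      fix x assume "x \<in> {x \<in> space (lebN N). \<not> sqnorm N x \<noteq> 0}"
      then have "x \<in> PiE {..<N} (\<lambda>_. UNIV)" "x 0 = 0"
        using coord_le_sqnorm[OF assms, of x] by (auto simp: space_lebN)
      then show "x \<in> Pi\<^sub>E {..<N} (\<lambda>i. if i = 0 then {0} else UNIV)"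
        by (auto simp: PiE_def)
    qed
    show "Pi\<^sub>E {..<N} (\<lambda>i. if i = 0 then {0 :: real} else UNIV) \<in> sets (lebN N)"
      unfolding sets_lebN bor_def by (intro sets_PiM_I_finite) auto
    show "emeasure (lebN N) (Pi\<^sub>E {..<N} (\<lambda>i. if i = 0 then {0 :: real} else UNIV)) = 0"
    proof (subst emeasure_lebN_PiE)
      show "(\<Prod>i<N. emeasure lborel (if i = 0 then {0 :: real} else UNIV)) = 0"
        using assms by (intro prod_zero) auto
    qed auto
  qed
  then have "AE x in uniform_measure (lebN N) (ballN N). sqnorm N x \<noteq> 0"
    by (intro AE_uniform_measureI) (auto simp: sets_lebN)
  then show ?thesis
    unfolding sigmaN_eq by (subst AE_distr_iff) (auto intro: radial_in_sph simp flip: sph_eq)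
qed

text \<open>The cone measure inherits every symmetry of Lebesgue measure that preserves the norm,
  hence the ball, and commutes with the radial projection.\<close>

lemma sigmaN_invariant:
  assumes T: "preserves_lebN N T" and nrm: "\<And>x. x \<in> space (bor N) \<Longrightarrow> sqnorm N (T x) = sqnorm N x"
    and rad: "\<And>x. x \<in> space (bor N) \<Longrightarrow> radial N (T x) = T (radial N x)"
  shows "distr (sigmaN N) (bor N) T = sigmaN N"
proof -
  have Tm [measurable]: "T \<in> measurable (bor N) (bor N)"
    using T by (simp add: preserves_lebN_def)
  let ?U = "uniform_measure (lebN N) (ballN N)"
  have U: "distr ?U (bor N) T = ?U"
  proof (rule measure_eqI)
    fix A assume "A \<in> sets (distr ?U (bor N) T)"
    then have A [measurable]: "A \<in> sets (bor N)" by simp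
    have TA: "T -` A \<inter> space (bor N) \<in> sets (bor N)" by measurable
    have "emeasure (distr ?U (bor N) T) A = emeasure ?U (T -` A \<inter> space (bor N))"
      by (subst emeasure_distr) (auto simp: space_lebN space_bor)
    also have "\<dots> = emeasure (lebN N) (ballN N \<inter> (T -` A \<inter> space (bor N))) / emeasure (lebN N) (ballN N)"
      by (rule emeasure_uniform_measure) (use TA in \<open>simp_all add: sets_lebN\<close>)
    also have "ballN N \<inter> (T -` A \<inter> space (bor N)) = T -` (ballN N \<inter> A) \<inter> space (lebN N)"
    proof -
      have "x \<in> ballN N \<longleftrightarrow> T x \<in> ballN N" if "x \<in> space (bor N)" for x
        using that nrm[OF that] measurable_space[OF Tm that] by (simp add: ballN_eq)
      then show ?thesis unfolding space_lebN space_bor by blast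
    qed
    also have "emeasure (lebN N) \<dots> = emeasure (distr (lebN N) (bor N) T) (ballN N \<inter> A)"
      by (rule emeasure_distr[symmetric]) measurable
    also have "\<dots> = emeasure (lebN N) (ballN N \<inter> A)" using T by (simp add: preserves_lebN_def)
    also have "\<dots> / emeasure (lebN N) (ballN N) = emeasure ?U A"
      by (rule emeasure_uniform_measure[symmetric]) (simp_all add: sets_lebN)
    finally show "emeasure (distr ?U (bor N) T) A = emeasure ?U A" .
  qed (simp add: sets_lebN)
  have "distr (sigmaN N) (bor N) T = distr ?U (bor N) (T \<circ> radial N)"
    unfolding sigmaN_eq by (subst distr_distr) auto
  also have "\<dots> = distr ?U (bor N) (radial N \<circ> T)"
    using rad by (intro distr_cong) (auto simp: space_lebN space_bor)
  also have "\<dots> = distr (distr ?U (bor N) T) (bor N) (radial N)"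
    by (subst distr_distr) auto
  also have "\<dots> = sigmaN N" unfolding U sigmaN_eq ..
  finally show ?thesis .
qed

lemma sigmaN_rot:
  assumes "i < N" "j < N" "i \<noteq> j"
  shows "distr (sigmaN N) (bor N) (rot i j \<theta>) = sigmaN N"
proof (rule sigmaN_invariant)
  fix x assume "x \<in> space (bor N)"
  then show "radial N (rot i j \<theta> x) = rot i j \<theta> (radial N x)"
    using assms unfolding radial_def sqnorm_rot[OF assms(3,1,2)] by (auto simp: fun_eq_iff rot_def algebra_simps add_divide_distrib diff_divide_distrib)
qed (use assms sqnorm_rot rot_preserves_lebN in auto)

lemma sigmaN_perm:
  assumes p: "p permutes {..<N}"
  shows "distr (sigmaN N) (bor N) (\<lambda>x. x \<circ> p) = sigmaN N"
proof (rule sigmaN_invariant)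
  have n: "sqnorm N (x \<circ> p) = sqnorm N x" for x
    unfolding sqnorm_def using sum.permute[OF p, of "\<lambda>i. (x i)^2"] by (simp add: o_def)
  then show "sqnorm N (x \<circ> p) = sqnorm N x" for x .
  fix x
  show "radial N (x \<circ> p) = radial N x \<circ> p"
    using permutes_in_image[OF p] by (auto simp: radial_def fun_eq_iff n restrict_def)
qed (rule perm_preserves_lebN[OF p])

section \<open>The heat flow on polynomials\<close>

text \<open>A term of fixed shape whose constants vary continuously in time. This gives joint
  continuity in (t, v), on which the maximum principle and differentiation under the integral rely,
  and the class is closed under \<open>D\<close>, \<open>X\<close> and \<open>rlap\<close>.\<close>

inductive time_pol :: "(real \<Rightarrow> pol) \<Rightarrow> bool" where
  time_pol_C: "continuous_on UNIV c \<Longrightarrow> time_pol (\<lambda>t. C (c t))"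
| time_pol_V: "time_pol (\<lambda>t. V k)"
| time_pol_Add: "time_pol p \<Longrightarrow> time_pol q \<Longrightarrow> time_pol (\<lambda>t. Add (p t) (q t))"
| time_pol_Mul: "time_pol p \<Longrightarrow> time_pol q \<Longrightarrow> time_pol (\<lambda>t. Mul (p t) (q t))"

lemma time_pol_D: "time_pol p \<Longrightarrow> time_pol (\<lambda>t. D k (p t))"
proof (induction rule: time_pol.induct)
  case (time_pol_C c)
  then show ?case using time_pol.time_pol_C[of "\<lambda>_. 0"] by simp
next
  case (time_pol_V l)
  then show ?case using time_pol.time_pol_C[of "\<lambda>_. if k = l then 1 else 0"] by simp
qed (auto intro: time_pol.intros)

lemma time_pol_const: "time_pol (\<lambda>t. p)"
proof (induction p)
  case (C c)
  then show ?case using time_pol.time_pol_C[of "\<lambda>_. c"] by simp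
qed (auto intro: time_pol.intros)

lemma time_pol_sump: "(\<And>x. x \<in> set xs \<Longrightarrow> time_pol (f x)) \<Longrightarrow> time_pol (\<lambda>t. sump (\<lambda>x. f x t) xs)"
  by (induction xs) (auto intro: time_pol.intros time_pol_const)

lemma time_pol_X: "time_pol p \<Longrightarrow> time_pol (\<lambda>t. X i j (p t))"
  unfolding X_def by (intro time_pol_Add time_pol_Mul time_pol_V time_pol_D time_pol_const)

lemma time_pol_Lp: "time_pol p \<Longrightarrow> time_pol (\<lambda>t. rlap N (p t))"
  unfolding rlap_def by (intro time_pol_Mul time_pol_sump time_pol_X time_pol_const)

lemma time_pol_continuous:
  assumes "time_pol p"
  shows "continuous_on UNIV (\<lambda>x. pev (p (fst x)) (snd x))"
  using assms
proof (induction rule: time_pol.induct)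
  case (time_pol_C c)
  have "continuous_on UNIV (c \<circ> fst)"
    by (rule continuous_on_compose) (auto intro: continuous_intros continuous_on_subset[OF time_pol_C])
  then show ?case by (simp add: o_def)
next
  case (time_pol_V k)
  have "continuous_on UNIV (\<lambda>x :: real \<times> (nat \<Rightarrow> real). snd x k)"
    by (rule continuous_on_product_then_coordinatewise) (intro continuous_intros)
  then show ?case by simp
qed (auto intro!: continuous_intros)

lemma time_pol_continuous' [continuous_intros]:
  assumes "time_pol p" "continuous_on A f" "continuous_on A g"
  shows "continuous_on A (\<lambda>x. pev (p (f x)) (g x))"
proof -
  have "continuous_on A ((\<lambda>x. pev (p (fst x)) (snd x)) \<circ> (\<lambda>x. (f x, g x)))"
    by (rule continuous_on_compose)
      (auto intro!: continuous_intros assms continuous_on_subset[OF time_pol_continuous])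
  then show ?thesis by (simp add: o_def)
qed

lemma pev_continuous [continuous_intros]:
  assumes "continuous_on A g"
  shows "continuous_on A (\<lambda>x. pev p (g x))"
  using time_pol_continuous'[OF time_pol_const[of p] _ assms, of "\<lambda>_. 0"] by simp

lemma rot_continuous [continuous_intros]:
  fixes A :: "'a::t2_space set"
  assumes "continuous_on A f" "continuous_on A g"
  shows "continuous_on A (\<lambda>x. rot i j (f x) (g x))"
proof (rule continuous_on_coordinatewise_then_product)
  fix k
  have g: "continuous_on A (\<lambda>x. g x l)" for l
    using assms(2) by (rule continuous_on_product_then_coordinatewise)
  consider "k = j" | "k = i" "k \<noteq> j" | "k \<noteq> i" "k \<noteq> j" by blast
  then show "continuous_on A (\<lambda>x. rot i j (f x) (g x) k)"
    by cases (auto simp: rot_def intro!: continuous_intros g assms(1))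
qed

text \<open>The exponential series of the matrix: \<open>a n\<close> is the row vector c0 A^n,
  bounded entrywise by B M^n, so the series converges for all t and may be differentiated
  termwise.\<close>

lemma linear_ode:
  fixes A :: "'w \<Rightarrow> 'w \<Rightarrow> real" and c0 :: "'w \<Rightarrow> real"
  assumes W: "finite W"
  shows "\<exists>c. \<forall>w\<in>W. c w 0 = c0 w \<and>
    (\<forall>t. (c w has_real_derivative (\<Sum>w'\<in>W. c w' t * A w' w)) (at t))"
proof -
  define a where "a = rec_nat c0 (\<lambda>_ b w. \<Sum>w'\<in>W. b w' * A w' w)"
  have a0: "a 0 w = c0 w" and aS: "a (Suc n) w = (\<Sum>w'\<in>W. a n w' * A w' w)" for n w
    by (simp_all add: a_def)
  define M where "M = (\<Sum>w'\<in>W. \<Sum>w\<in>W. \<bar>A w' w\<bar>)"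
  define B where "B = (\<Sum>w\<in>W. \<bar>c0 w\<bar>)"
  have M0: "0 \<le> M" "0 \<le> B" by (auto simp: M_def B_def intro!: sum_nonneg)
  have bound: "\<bar>a n w\<bar> \<le> B * M ^ n" if "w \<in> W" for n w
    using that
  proof (induction n arbitrary: w)
    case 0
    then show ?case using member_le_sum[of w W "\<lambda>w. \<bar>c0 w\<bar>"] W by (simp add: a0 B_def)
  next
    case (Suc n)
    have "\<bar>a (Suc n) w\<bar> \<le> (\<Sum>w'\<in>W. \<bar>a n w'\<bar> * \<bar>A w' w\<bar>)"
      unfolding aS by (rule order_trans[OF sum_abs]) (simp add: abs_mult)
    also have "\<dots> \<le> (\<Sum>w'\<in>W. B * M ^ n * (\<Sum>w\<in>W. \<bar>A w' w\<bar>))"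
    proof (rule sum_mono)
      fix w' assume "w' \<in> W"
      then show "\<bar>a n w'\<bar> * \<bar>A w' w\<bar> \<le> B * M ^ n * (\<Sum>w\<in>W. \<bar>A w' w\<bar>)"
        using Suc member_le_sum[of w W "\<lambda>w. \<bar>A w' w\<bar>"] W M0
        by (intro mult_mono) auto
    qed
    also have "\<dots> = B * M ^ Suc n" by (simp add: M_def sum_distrib_left[symmetric])
    finally show ?case .
  qed
  have summ: "summable (\<lambda>n. a n w / fact n * t ^ n)" if "w \<in> W" for w t
  proof (rule summable_comparison_test)
    have "summable (\<lambda>n. B * (inverse (fact n) * (M * \<bar>t\<bar>) ^ n))"
      by (intro summable_mult summable_exp)
    then show "summable (\<lambda>n. B * M ^ n * \<bar>t\<bar> ^ n / fact n)"
      by (simp add: power_mult_distrib field_simps)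
    show "\<exists>N. \<forall>n\<ge>N. norm (a n w / fact n * t ^ n) \<le> B * M ^ n * \<bar>t\<bar> ^ n / fact n"
      using bound[OF that] by (auto simp: abs_mult power_abs intro!: divide_right_mono mult_right_mono)
  qed
  define c where "c = (\<lambda>w t. \<Sum>n. a n w / fact n * t ^ n)"
  have "(c w has_real_derivative (\<Sum>w'\<in>W. c w' t * A w' w)) (at t)" if w: "w \<in> W" for w t
  proof -
    have "(c w has_real_derivative (\<Sum>n. diffs (\<lambda>n. a n w / fact n) n * t ^ n)) (at t)"
      unfolding c_def by (rule termdiffs_strong_converges_everywhere) (rule summ[OF w])
    also have "(\<lambda>n. diffs (\<lambda>n. a n w / fact n) n * t ^ n) = (\<lambda>n. \<Sum>w'\<in>W. A w' w * (a n w' / fact n * t ^ n))"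
    proof
      fix n
      have "diffs (\<lambda>n. a n w / fact n) n = a (Suc n) w / fact n"
        by (simp add: diffs_def field_simps del: of_nat_Suc)
      then show "diffs (\<lambda>n. a n w / fact n) n * t ^ n = (\<Sum>w'\<in>W. A w' w * (a n w' / fact n * t ^ n))"
        by (simp add: aS sum_distrib_left sum_divide_distrib mult_ac)
    qed
    also have "(\<Sum>n. \<Sum>w'\<in>W. A w' w * (a n w' / fact n * t ^ n)) = (\<Sum>w'\<in>W. \<Sum>n. A w' w * (a n w' / fact n * t ^ n))"
      by (rule suminf_sum) (intro summable_mult summ)
    also have "\<dots> = (\<Sum>w'\<in>W. c w' t * A w' w)"
      unfolding c_def
      by (intro sum.cong refl, subst suminf_mult) (use summ in \<open>auto simp: mult.commute\<close>)
    finally show ?thesis .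
  qed
  moreover have "c w 0 = c0 w" for w
    unfolding c_def by (subst powser_zero) (simp add: a0)
  ultimately show ?thesis by blast
qed

section \<open>Finite-dimensional spaces of polynomial functions, and existence of the flow\<close>

primrec word_pol :: "nat list \<Rightarrow> pol" where
  "word_pol [] = C 1"
| "word_pol (k # xs) = Mul (V k) (word_pol xs)"

text \<open>Words of length at most d in K letters span a finite-dimensional space. The predicate
  speaks of functions and not of terms, because \<open>X\<close> and \<open>rlap\<close> produce
  larger terms for functions of the same degree.\<close>

inductive wordspan :: "nat \<Rightarrow> nat \<Rightarrow> ((nat \<Rightarrow> real) \<Rightarrow> real) \<Rightarrow> bool" for K d where
  wordspan_wd: "set xs \<subseteq> {..<K} \<Longrightarrow> length xs \<le> d \<Longrightarrow> wordspan K d (pev (word_pol xs))"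
| wordspan_scale: "wordspan K d f \<Longrightarrow> wordspan K d (\<lambda>v. c * f v)"
| wordspan_add: "wordspan K d f \<Longrightarrow> wordspan K d g \<Longrightarrow> wordspan K d (\<lambda>v. f v + g v)"

lemma wordspan_const: "wordspan K d (\<lambda>v. c)"
  using wordspan_scale[OF wordspan_wd[of "[]" K d], of c] by simp

lemma wordspan_sum: "(\<And>i. i \<in> I \<Longrightarrow> wordspan K d (f i)) \<Longrightarrow> wordspan K d (\<lambda>v. \<Sum>i\<in>I. f i v)"
  by (induction I rule: infinite_finite_induct) (auto intro: wordspan_const wordspan_add)

lemma wordspan_mono: "wordspan K d f \<Longrightarrow> K \<le> K' \<Longrightarrow> d \<le> d' \<Longrightarrow> wordspan K' d' f"
proof (induction rule: wordspan.induct)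
  case (wordspan_wd xs)
  then show ?case by (intro wordspan.wordspan_wd) auto
qed (auto intro: wordspan.intros)

lemma wordspan_coord: "wordspan K d f \<Longrightarrow> k < K \<Longrightarrow> wordspan K (Suc d) (\<lambda>v. v k * f v)"
proof (induction rule: wordspan.induct)
  case (wordspan_wd xs)
  have "pev (word_pol (k # xs)) = (\<lambda>v. v k * pev (word_pol xs) v)" by auto
  then show ?case using wordspan.wordspan_wd[of "k # xs" K "Suc d"] wordspan_wd by auto
next
  case (wordspan_scale f c)
  then show ?case using wordspan.wordspan_scale[of K "Suc d" "\<lambda>v. v k * f v" c] by (simp add: mult_ac)
next
  case (wordspan_add f g)
  then show ?case using wordspan.wordspan_add[of K "Suc d" "\<lambda>v. v k * f v" "\<lambda>v. v k * g v"] by (simp add: distrib_left)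
qed

lemma wordspan_wd_mult: "wordspan K d g \<Longrightarrow> set xs \<subseteq> {..<K} \<Longrightarrow> wordspan K (length xs + d) (\<lambda>v. pev (word_pol xs) v * g v)"
proof (induction xs)
  case (Cons k xs)
  then have "wordspan K (Suc (length xs + d)) (\<lambda>v. v k * (pev (word_pol xs) v * g v))"
    by (intro wordspan_coord) auto
  then show ?case by (simp add: mult_ac)
qed auto

lemma wordspan_mult: "wordspan K d f \<Longrightarrow> wordspan K e g \<Longrightarrow> wordspan K (d + e) (\<lambda>v. f v * g v)"
proof (induction rule: wordspan.induct)
  case (wordspan_wd xs)
  then show ?case by (intro wordspan_mono[OF wordspan_wd_mult]) auto
next
  case (wordspan_scale f c)
  then show ?case using wordspan.wordspan_scale[of K "d + e" "\<lambda>v. f v * g v" c] by (simp add: mult_ac)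
next
  case (wordspan_add f h)
  then show ?case using wordspan.wordspan_add[of K "d + e" "\<lambda>v. f v * g v" "\<lambda>v. h v * g v"] by (simp add: distrib_right)
qed

lemma pol_sp: "\<exists>K d. wordspan K d (pev p)"
proof (induction p)
  case (C c)
  have "pev (C c) = (\<lambda>_. c)" by auto
  then show ?case using wordspan_const by auto
next
  case (V k)
  have "pev (V k) = pev (word_pol [k])" by auto
  moreover have "wordspan (Suc k) 1 (pev (word_pol [k]))" by (rule wordspan_wd) auto
  ultimately show ?case by metis
next
  case (Add p q)
  then obtain K d K' d' where "wordspan K d (pev p)" "wordspan K' d' (pev q)" by blast
  then have "wordspan (max K K') (max d d') (\<lambda>v. pev p v + pev q v)"
    by (intro wordspan_add) (auto intro: wordspan_mono)
  moreover have "pev (Add p q) = (\<lambda>v. pev p v + pev q v)" by auto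
  ultimately show ?case by auto
next
  case (Mul p q)
  then obtain K d K' d' where "wordspan K d (pev p)" "wordspan K' d' (pev q)" by blast
  then have "wordspan (max K K') (d + d') (\<lambda>v. pev p v * pev q v)"
    by (intro wordspan_mult) (auto intro: wordspan_mono)
  moreover have "pev (Mul p q) = (\<lambda>v. pev p v * pev q v)" by auto
  ultimately show ?case by auto
qed

definition words :: "nat \<Rightarrow> nat \<Rightarrow> nat list set" where
  "words K d = {xs. set xs \<subseteq> {..<K} \<and> length xs \<le> d}"

lemma finite_words: "finite (words K d)"
  unfolding words_def by (rule finite_lists_length_le) simp

lemma wordspan_coeffs: "wordspan K d f \<Longrightarrow> \<exists>c. \<forall>v. f v = (\<Sum>w\<in>words K d. c w * pev (word_pol w) v)"
proof (induction rule: wordspan.induct)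
  case (wordspan_wd xs)
  then have "xs \<in> words K d" by (auto simp: words_def)
  then have "pev (word_pol xs) v = (\<Sum>w\<in>words K d. (if w = xs then 1 else 0) * pev (word_pol w) v)" for v
    using finite_words by (simp add: if_distrib[of "\<lambda>x. x * _"] cong: if_cong)
  then show ?case by (intro exI[of _ "\<lambda>w. if w = xs then 1 else 0"]) blast
next
  case (wordspan_scale f c)
  then obtain a where "\<forall>v. f v = (\<Sum>w\<in>words K d. a w * pev (word_pol w) v)" by blast
  then have "\<forall>v. c * f v = (\<Sum>w\<in>words K d. (c * a w) * pev (word_pol w) v)"
    by (simp add: sum_distrib_left mult_ac)
  then show ?case by (rule exI[of _ "\<lambda>w. c * a w"])
next
  case (wordspan_add f g)
  then obtain a b where "\<forall>v. f v = (\<Sum>w\<in>words K d. a w * pev (word_pol w) v)"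
    "\<forall>v. g v = (\<Sum>w\<in>words K d. b w * pev (word_pol w) v)" by blast
  then have "\<forall>v. f v + g v = (\<Sum>w\<in>words K d. (a w + b w) * pev (word_pol w) v)"
    by (simp add: sum.distrib distrib_right)
  then show ?case by (rule exI[of _ "\<lambda>w. a w + b w"])
qed

lemma X_sump: "pev (X i j (sump f xs)) v = (\<Sum>x\<leftarrow>xs. pev (X i j (f x)) v)"
  by (induction xs) (auto simp: pev_X algebra_simps)

lemma X_scale: "pev (X i j (Mul (C c) p)) = pev (Mul (C c) (X i j p))"
  by (auto simp: pev_X algebra_simps)

lemma X_Add: "pev (X i j (Add p q)) v = pev (X i j p) v + pev (X i j q) v"
  by (simp add: pev_X algebra_simps)

lemma X_Mul: "pev (X i j (Mul p q)) v = pev (X i j p) v * pev q v + pev p v * pev (X i j q) v"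
  by (simp add: pev_X algebra_simps)

text \<open>Differentiation lowers the degree by one and the linear coefficient restores it. This is
  why the heat equation closes up in finite dimension.\<close>

lemma wordspan_X_wd:
  assumes "i < K" "j < K"
  shows "set xs \<subseteq> {..<K} \<Longrightarrow> wordspan K (length xs) (pev (X i j (word_pol xs)))"
proof (induction xs)
  case Nil
  have "pev (X i j (word_pol [])) = (\<lambda>v. 0)" by (auto simp: pev_X)
  then show ?case using wordspan_const by simp
next
  case (Cons k xs)
  have 1: "wordspan K (Suc (length xs)) (\<lambda>v. v k * pev (X i j (word_pol xs)) v)"
    using Cons by (intro wordspan_coord) auto
  have 2: "wordspan K (Suc (length xs)) (\<lambda>v. v l * pev (word_pol xs) v)" if "l < K" for l
    using Cons that by (intro wordspan_coord wordspan_wd) auto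
  have "wordspan K (Suc (length xs)) (\<lambda>v. (if i = k then 1 else 0) * (v j * pev (word_pol xs) v)
      + ((if j = k then -1 else 0) * (v i * pev (word_pol xs) v) + v k * pev (X i j (word_pol xs)) v))"
    using assms by (intro wordspan_add wordspan_scale 1 2)
  also have "(\<lambda>v. (if i = k then 1 else 0) * (v j * pev (word_pol xs) v)
      + ((if j = k then -1 else 0) * (v i * pev (word_pol xs) v) + v k * pev (X i j (word_pol xs)) v)) = pev (X i j (word_pol (k # xs)))"
    by (auto simp: X_Mul pev_X fun_eq_iff algebra_simps)
  finally show ?case by simp
qed

lemma wordspan_X:
  assumes "i < K" "j < K" "wordspan K d (pev p)"
  shows "wordspan K d (pev (X i j p))"
proof -
  obtain c where c: "\<forall>v. pev p v = (\<Sum>w\<in>words K d. c w * pev (word_pol w) v)"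
    using wordspan_coeffs[OF assms(3)] by blast
  obtain ws where ws: "set ws = words K d" "distinct ws"
    using finite_distinct_list[OF finite_words] by blast
  have p: "pev p = pev (sump (\<lambda>w. Mul (C (c w)) (word_pol w)) ws)"
    using c ws by (auto simp: pev_sump sum_list_distinct_conv_sum_set)
  then have "pev (X i j p) = (\<lambda>v. \<Sum>w\<in>words K d. c w * pev (X i j (word_pol w)) v)"
    unfolding X_cong[OF p] using ws by (simp add: fun_eq_iff X_sump X_scale sum_list_distinct_conv_sum_set)
  moreover have "wordspan K d (\<lambda>v. \<Sum>w\<in>words K d. c w * pev (X i j (word_pol w)) v)"
  proof (intro wordspan_sum wordspan_scale)
    fix w assume "w \<in> words K d"
    then show "wordspan K d (pev (X i j (word_pol w)))"
      using assms(1,2) by (intro wordspan_mono[OF wordspan_X_wd, of i K j w]) (auto simp: words_def)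
  qed
  ultimately show ?thesis by simp
qed

lemma wordspan_Lp:
  assumes "N \<le> K" "wordspan K d (pev p)"
  shows "wordspan K d (pev (rlap N p))"
proof -
  have "wordspan K d (\<lambda>v. (1/2) * (\<Sum>i<N. \<Sum>j<N. pev (X i j (X i j p)) v))"
    using assms by (intro wordspan_scale wordspan_sum wordspan_X) auto
  also have "(\<lambda>v. (1/2) * (\<Sum>i<N. \<Sum>j<N. pev (X i j (X i j p)) v)) = pev (rlap N p)"
    by (auto simp: pev_Lp)
  finally show ?thesis .
qed

lemma rlap_sump_scale:
  "pev (rlap N (sump (\<lambda>w. Mul (C (c w)) (f w)) ws)) v = (\<Sum>w\<leftarrow>ws. c w * pev (rlap N (f w)) v)"
proof -
  have 1: "pev (X i j (sump (\<lambda>w. Mul (C (c w)) (g w)) ws)) = pev (sump (\<lambda>w. Mul (C (c w)) (X i j (g w))) ws)" for i j g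
    by (simp add: fun_eq_iff X_sump X_scale pev_sump)
  have 2: "pev (X i j (X i j (sump (\<lambda>w. Mul (C (c w)) (f w)) ws))) v = (\<Sum>w\<leftarrow>ws. c w * pev (X i j (X i j (f w))) v)" for i j
    using X_cong[OF 1, of i j i j f] 1[of i j "\<lambda>w. X i j (f w)"] by (simp add: pev_sump)
  show ?thesis
    unfolding pev_Lp 2
    by (induction ws) (simp_all add: sum.distrib sum_distrib_left[symmetric] add_divide_distrib)
qed

text \<open>On the coefficients of words the heat equation is a linear ODE. The last clause, that
  every rotation derivative solves the same equation, is the commutation of the generator with the
  fields; it drives all estimates on gradients.\<close>

theorem heat_flow:
  obtains u where "time_pol u" "pev (u 0) = pev p"
    "\<And>t v. ((\<lambda>t. pev (u t) v) has_real_derivative pev (rlap N (u t)) v) (at t)"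
    "\<And>i j t v. i < N \<Longrightarrow> j < N \<Longrightarrow>
       ((\<lambda>t. pev (X i j (u t)) v) has_real_derivative pev (rlap N (X i j (u t))) v) (at t)"
proof -
  obtain K d where "wordspan K d (pev p)" using pol_sp by blast
  \<comment> \<open>At least N letters are taken, since the fields with indices below N may
    introduce coordinates absent from p.\<close>
  then have wordspan: "wordspan (max K N) d (pev p)" by (auto intro: wordspan_mono)
  define W where "W = words (max K N) d"
  have W: "finite W" by (simp add: W_def finite_words)
  obtain c0 where c0: "\<And>v. pev p v = (\<Sum>w\<in>W. c0 w * pev (word_pol w) v)"
    using wordspan_coeffs[OF wordspan] unfolding W_def by blast
  \<comment> \<open>Words remember the order of their factors and so are not linearly independent. A
    is one of many matrices that represent the generator, and any of them solves the equation for
    the functions.\<close>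
  have "\<exists>a. \<forall>v. pev (rlap N (word_pol w)) v = (\<Sum>w'\<in>W. a w' * pev (word_pol w') v)" if "w \<in> W" for w
    unfolding W_def using that
    by (intro wordspan_coeffs wordspan_Lp wordspan_wd) (auto simp: W_def words_def)
  then obtain A where A: "\<And>w v. w \<in> W \<Longrightarrow> pev (rlap N (word_pol w)) v = (\<Sum>w'\<in>W. A w w' * pev (word_pol w') v)"
    by metis
  obtain c where c: "\<And>w. w \<in> W \<Longrightarrow> c w 0 = c0 w"
    "\<And>w t. w \<in> W \<Longrightarrow> (c w has_real_derivative (\<Sum>w'\<in>W. c w' t * A w' w)) (at t)"
    using linear_ode[OF W, of c0 A] by blast
  obtain ws where ws: "set ws = W" "distinct ws" using finite_distinct_list[OF W] by blast
  define c' where "c' = (\<lambda>w t. \<Sum>w'\<in>W. c w' t * A w' w)"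
  define u where "u = (\<lambda>t. sump (\<lambda>w. Mul (C (c w t)) (word_pol w)) ws)"
  define u' where "u' = (\<lambda>t. sump (\<lambda>w. Mul (C (c' w t)) (word_pol w)) ws)"
  have cont: "continuous_on UNIV (c w)" if "w \<in> W" for w
    using c(2)[OF that] by (auto intro!: continuous_at_imp_continuous_on DERIV_isCont)
  have pev_u: "pev (u t) v = (\<Sum>w\<in>W. c w t * pev (word_pol w) v)"
    and pev_u': "pev (u' t) v = (\<Sum>w\<in>W. c' w t * pev (word_pol w) v)" for t v
    using ws by (simp_all add: u_def u'_def pev_sump sum_list_distinct_conv_sum_set)
  have X_u: "pev (X i j (u t)) v = (\<Sum>w\<in>W. c w t * pev (X i j (word_pol w)) v)"
    and X_u': "pev (X i j (u' t)) v = (\<Sum>w\<in>W. c' w t * pev (X i j (word_pol w)) v)" for i j t v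
    using ws by (simp_all add: u_def u'_def X_sump X_scale sum_list_distinct_conv_sum_set)
  have L_u: "pev (rlap N (u t)) = pev (u' t)" for t
  proof
    fix v
    have "pev (rlap N (u t)) v = (\<Sum>w\<in>W. c w t * pev (rlap N (word_pol w)) v)"
      using ws by (simp add: u_def rlap_sump_scale sum_list_distinct_conv_sum_set)
    also have "\<dots> = (\<Sum>w\<in>W. \<Sum>w'\<in>W. c w t * A w w' * pev (word_pol w') v)"
      by (simp add: A sum_distrib_left mult.assoc)
    also have "\<dots> = (\<Sum>w'\<in>W. \<Sum>w\<in>W. c w t * A w w' * pev (word_pol w') v)"
      by (rule sum.swap)
    also have "\<dots> = pev (u' t) v"
      by (simp add: pev_u' c'_def sum_distrib_right)
    finally show "pev (rlap N (u t)) v = pev (u' t) v" .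
  qed
  have d: "(c w has_real_derivative c' w t) (at t)" if "w \<in> W" for w t
    using c(2)[OF that] by (simp add: c'_def)
  show thesis
  proof
    show "time_pol u" unfolding u_def
      using cont ws by (intro time_pol_sump time_pol_Mul time_pol_C time_pol_const) auto
    show "pev (u 0) = pev p" by (auto simp: pev_u c0 c(1))
    show "((\<lambda>t. pev (u t) v) has_real_derivative pev (rlap N (u t)) v) (at t)" for t v
      unfolding L_u pev_u pev_u'
      by (rule DERIV_sum) (rule DERIV_cmult_right, rule d)
    show "((\<lambda>t. pev (X i j (u t)) v) has_real_derivative pev (rlap N (X i j (u t))) v) (at t)"
      if "i < N" "j < N" for i j t v
      unfolding rlap_X_commute[OF that] X_cong[OF L_u] X_u X_u'
      by (rule DERIV_sum) (rule DERIV_cmult_right, rule d)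
  qed
qed

section \<open>Integration by parts and the maximum principle\<close>

lemma sqnorm_continuous: "continuous_on A (sqnorm N)"
  using pev_continuous[OF continuous_on_id, of A "R2 N"] by (simp add: pev_R2)

text \<open>In the space of all functions on the naturals, the sphere is a closed subset of a
  product of compact intervals and, from index N on, singletons {undefined}; Tychonoff
  applies.\<close>

lemma compact_sph: "compact (sph N)"
proof -
  define K where "K = PiE (UNIV :: nat set) (\<lambda>i. if i < N then {-sqrt N..sqrt N} else {undefined :: real})"
  have "compactin (product_topology (\<lambda>_. euclidean) (UNIV :: nat set)) K"
    unfolding K_def by (subst compactin_PiE) auto
  then have K: "compact K" by (simp add: euclidean_product_topology)
  have "v i \<in> {-sqrt N..sqrt N}" if "i < N" "v \<in> sph N" for v i
  proof -
    have "(v i)^2 \<le> N" using coord_le_sqnorm[OF that(1), of v] that by (simp add: sph_def)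
    then have "\<bar>v i\<bar> \<le> sqrt N" by (rule real_le_rsqrt[of "\<bar>v i\<bar>", simplified])
    then show ?thesis by auto
  qed
  then have "sph N = K \<inter> {v. sqnorm N v = N}"
    by (auto simp: K_def sph_def PiE_def extensional_def Pi_def split: if_splits)
  moreover have "closed {v. sqnorm N v = N}"
    by (rule closed_Collect_eq) (auto intro: continuous_intros sqnorm_continuous)
  ultimately show ?thesis using K by (simp add: compact_Int_closed)
qed

lemma rot_sph:
  assumes "i < N" "j < N" "i \<noteq> j" "v \<in> sph N"
  shows "rot i j \<theta> v \<in> sph N"
  using assms sqnorm_rot[OF assms(3,1,2), of \<theta> v]
  by (auto simp: sph_def PiE_def extensional_def) (auto simp: rot_def)

text \<open>Instantiated by the sphere, the interval of angles and their product. Continuous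
  functions are bounded and integrable on all three, so differentiation under the integral is proved
  once.\<close>

locale compact_measure = finite_measure M for M :: "'a :: t2_space measure" +
  assumes cpt: "compact (space M)"
    and cont_meas: "\<And>f :: 'a \<Rightarrow> real. continuous_on (space M) f \<Longrightarrow> f \<in> borel_measurable M"
begin

lemma cont_integrable:
  fixes f :: "'a \<Rightarrow> real"
  assumes "continuous_on (space M) f"
  shows "integrable M f"
proof -
  obtain B where "\<And>x. x \<in> space M \<Longrightarrow> norm (f x) \<le> B"
    using compact_imp_bounded[OF compact_continuous_image[OF assms cpt]]
    unfolding bounded_iff by auto
  then show ?thesis
    by (intro integrable_const_bound[of _ B] cont_meas assms) auto
qed

text \<open>Dominated convergence along sequences: by the mean value inequality the difference
  quotients are bounded by the maximum of \<phi>' over a compact set. Derivatives are taken within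
  the interval because the flow is known to be positive, and its logarithm smooth, for t \<ge> 0
  only.\<close>

lemma deriv_integral:
  fixes \<phi> \<phi>' :: "real \<Rightarrow> 'a \<Rightarrow> real"
  assumes d: "\<And>t x. t \<in> {a..b} \<Longrightarrow> x \<in> space M \<Longrightarrow>
      ((\<lambda>t. \<phi> t x) has_real_derivative \<phi>' t x) (at t within {a..b})"
    and c: "\<And>t. t \<in> {a..b} \<Longrightarrow> continuous_on (space M) (\<phi> t)"
    and c': "continuous_on ({a..b} \<times> space M) (\<lambda>x. \<phi>' (fst x) (snd x))"
    and t: "t \<in> {a..b}"
  shows "((\<lambda>t. \<integral>x. \<phi> t x \<partial>M) has_real_derivative (\<integral>x. \<phi>' t x \<partial>M)) (at t within {a..b})"
proof -
  have "compact ({a..b} \<times> space M)" by (intro compact_Times cpt compact_Icc)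
  then obtain B where B: "\<And>t x. t \<in> {a..b} \<Longrightarrow> x \<in> space M \<Longrightarrow> norm (\<phi>' t x) \<le> B"
    using compact_imp_bounded[OF compact_continuous_image[OF c']]
    unfolding bounded_iff by fastforce
  have ct: "continuous_on (space M) (\<phi>' t)"
  proof -
    have "continuous_on (space M) ((\<lambda>x. \<phi>' (fst x) (snd x)) \<circ> (\<lambda>x. (t, x)))"
      by (rule continuous_on_compose) (use t in \<open>auto intro!: continuous_intros continuous_on_subset[OF c']\<close>)
    then show ?thesis by (simp add: o_def)
  qed
  show ?thesis
    unfolding has_field_derivative_iff tendsto_at_iff_sequentially
  proof (intro allI impI)
    fix X :: "nat \<Rightarrow> real" assume X: "\<forall>i. X i \<in> {a..b} - {t}" "X \<longlonglongrightarrow> t"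
    have "(\<lambda>n. \<integral>x. (\<phi> (X n) x - \<phi> t x) / (X n - t) \<partial>M) \<longlonglongrightarrow> (\<integral>x. \<phi>' t x \<partial>M)"
    proof (rule integral_dominated_convergence[where w = "\<lambda>_. B"])
      show "\<phi>' t \<in> borel_measurable M" by (rule cont_meas[OF ct])
      have [measurable]: "\<phi> s \<in> borel_measurable M" if "s \<in> {a..b}" for s
        using c[OF that] by (rule cont_meas)
      show "(\<lambda>x. (\<phi> (X n) x - \<phi> t x) / (X n - t)) \<in> borel_measurable M" for n
        using X t by (intro borel_measurable_divide borel_measurable_diff) auto
      show "AE x in M. (\<lambda>n. (\<phi> (X n) x - \<phi> t x) / (X n - t)) \<longlonglongrightarrow> \<phi>' t x"
      proof (rule AE_I2)
        fix x assume "x \<in> space M"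
        from d[OF t this] X show "(\<lambda>n. (\<phi> (X n) x - \<phi> t x) / (X n - t)) \<longlonglongrightarrow> \<phi>' t x"
          unfolding has_field_derivative_iff tendsto_at_iff_sequentially by (auto simp: o_def)
      qed
      show "AE x in M. norm ((\<phi> (X n) x - \<phi> t x) / (X n - t)) \<le> B" for n
      proof (rule AE_I2)
        fix x assume x: "x \<in> space M"
        have "X n \<in> {a..b}" "X n \<noteq> t" using X by auto
        then have "norm (\<phi> (X n) x - \<phi> t x) \<le> B * norm (X n - t)"
          using d x B t by (intro field_differentiable_bound[of "{a..b}" "\<lambda>t. \<phi> t x" "\<lambda>t. \<phi>' t x"]) auto
        then show "norm ((\<phi> (X n) x - \<phi> t x) / (X n - t)) \<le> B"
          using \<open>X n \<noteq> t\<close> by (simp add: norm_divide divide_le_eq)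
      qed
    qed simp
    also have "(\<lambda>n. \<integral>x. (\<phi> (X n) x - \<phi> t x) / (X n - t) \<partial>M) =
       (\<lambda>s. ((\<integral>x. \<phi> s x \<partial>M) - (\<integral>x. \<phi> t x \<partial>M)) / (s - t)) \<circ> X"
    proof
      fix n
      have "X n \<in> {a..b}" using X by auto
      then show "(\<integral>x. (\<phi> (X n) x - \<phi> t x) / (X n - t) \<partial>M) =
        ((\<lambda>s. ((\<integral>x. \<phi> s x \<partial>M) - (\<integral>x. \<phi> t x \<partial>M)) / (s - t)) \<circ> X) n"
        using cont_integrable[OF c] t by simp
    qed
    finally show "((\<lambda>s. ((\<integral>x. \<phi> s x \<partial>M) - (\<integral>x. \<phi> t x \<partial>M)) / (s - t)) \<circ> X) \<longlonglongrightarrow> (\<integral>x. \<phi>' t x \<partial>M)" .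
  qed
qed

end

text \<open>Restriction to the sphere turns almost sure statements into pointwise ones and makes the
  underlying space compact.\<close>

definition SN :: "nat \<Rightarrow> (nat \<Rightarrow> real) measure" where
  "SN N = restrict_space (sigmaN N) (sph N)"

lemma sph_sets_sigmaN [measurable]: "sph N \<in> sets (sigmaN N)"
  by (simp add: sets_sigmaN)

lemma sph_subset: "sph N \<subseteq> space (bor N)"
  by (auto simp: sph_eq)

lemma space_SN: "space (SN N) = sph N"
  using sph_subset by (auto simp: SN_def space_restrict_space space_sigmaN)

lemma measurable_SN1: "f \<in> measurable (bor N) M \<Longrightarrow> f \<in> measurable (SN N) M"
  unfolding SN_def by (rule measurable_restrict_space1) measurable

lemma id_measurable_bor: "(\<lambda>v. v) \<in> measurable (bor N) (borel :: (nat \<Rightarrow> real) measure)"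
proof -
  have "(\<lambda>v. v) \<in> measurable (bor N) (PiM UNIV (\<lambda>_. borel))"
    by (rule measurable_PiM_single') (auto simp: space_PiM)
  then show ?thesis
    using measurable_cong_sets[OF refl sets_PiM_equal_borel] by blast
qed

lemma prob_space_SN:
  assumes "0 < N"
  shows "prob_space (SN N)"
  unfolding SN_def
proof (rule prob_space_restrict_space)
  interpret prob_space "sigmaN N" by (rule prob_space_sigmaN)
  show "emeasure (sigmaN N) (sph N) = 1"
    using AE_sph[OF assms] by (subst emeasure_eq_1_AE) auto
qed simp

lemma compact_measure_SN:
  assumes "0 < N"
  shows "compact_measure (SN N)"
proof -
  interpret prob_space "SN N" by (rule prob_space_SN[OF assms])
  show ?thesis
  proof
    show "compact (space (SN N))" by (simp add: space_SN compact_sph)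
    fix f :: "(nat \<Rightarrow> real) \<Rightarrow> real" assume "continuous_on (space (SN N)) f"
    then have f: "f \<in> borel_measurable (restrict_space borel (sph N))"
      unfolding space_SN by (rule borel_measurable_continuous_on_restrict)
    have "(\<lambda>v. v) \<in> measurable (SN N) (restrict_space borel (sph N))"
      by (rule measurable_restrict_space2) (auto simp: space_SN intro: measurable_SN1 id_measurable_bor)
    from measurable_compose[OF this f] show "f \<in> borel_measurable (SN N)" .
  qed
qed

lemma integral_SN:
  fixes f :: "(nat \<Rightarrow> real) \<Rightarrow> real"
  assumes "0 < N" "f \<in> borel_measurable (bor N)"
  shows "integral\<^sup>L (SN N) f = integral\<^sup>L (sigmaN N) f"
proof -
  have [measurable]: "f \<in> borel_measurable (sigmaN N)" using assms(2) by measurable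
  have "integral\<^sup>L (SN N) f = (\<integral>x. indicator (sph N) x *\<^sub>R f x \<partial>sigmaN N)"
    unfolding SN_def by (rule integral_restrict_space) measurable
  also have "\<dots> = integral\<^sup>L (sigmaN N) f"
    using AE_sph[OF assms(1)] by (intro integral_cong_AE) auto
  finally show ?thesis .
qed

lemma rot_measurable_SN:
  assumes "i < N" "j < N" "i \<noteq> j"
  shows "rot i j \<theta> \<in> measurable (SN N) (SN N)"
proof -
  have "rot i j \<theta> \<in> measurable (bor N) (sigmaN N)"
    using rot_measurable[OF assms(1,2)] measurable_cong_sets[OF refl sets_sigmaN] by blast
  then have "rot i j \<theta> \<in> measurable (SN N) (sigmaN N)" by (rule measurable_SN1)
  then show ?thesis
    unfolding SN_def[of N]
    by (intro measurable_restrict_space2) (use assms rot_sph in \<open>auto simp: SN_def[symmetric] space_SN\<close>)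
qed

lemma SN_rot:
  assumes "i < N" "j < N" "i \<noteq> j"
  shows "distr (SN N) (SN N) (rot i j \<theta>) = SN N"
proof (rule measure_eqI)
  note [measurable] = rot_measurable_SN[OF assms, of \<theta>] rot_measurable[OF assms(1,2), of \<theta>]
  fix A assume "A \<in> sets (distr (SN N) (SN N) (rot i j \<theta>))"
  then have A: "A \<in> sets (SN N)" by simp
  then have As: "A \<subseteq> sph N" using sets.sets_into_space space_SN by metis
  have Ab: "A \<in> sets (bor N)"
    using A by (auto simp: SN_def sets_restrict_space_iff sets_sigmaN)
  have em: "emeasure (SN N) B = emeasure (sigmaN N) B" if "B \<subseteq> sph N" for B
    unfolding SN_def by (rule emeasure_restrict_space) (use that in auto)
  have "emeasure (distr (SN N) (SN N) (rot i j \<theta>)) A = emeasure (SN N) (rot i j \<theta> -` A \<inter> space (SN N))"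
    by (rule emeasure_distr) (use A in auto)
  also have "\<dots> = emeasure (sigmaN N) (rot i j \<theta> -` A \<inter> sph N)"
    by (simp add: em space_SN)
  also have "rot i j \<theta> -` A \<inter> sph N = rot i j \<theta> -` A \<inter> space (sigmaN N)"
  proof -
    have "v \<in> sph N" if "v \<in> space (bor N)" "rot i j \<theta> v \<in> A" for v
    proof -
      have "rot i j \<theta> v \<in> sph N" using that As by auto
      then show ?thesis using that(1) sqnorm_rot[OF assms(3,1,2), of \<theta> v] by (auto simp: sph_eq)
    qed
    then show ?thesis using sph_subset by (auto simp: space_sigmaN)
  qed
  also have "emeasure (sigmaN N) \<dots> = emeasure (distr (sigmaN N) (bor N) (rot i j \<theta>)) A"
    by (rule emeasure_distr[symmetric]) (use Ab in auto)
  also have "\<dots> = emeasure (SN N) A"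
    using As by (simp add: sigmaN_rot[OF assms] em)
  finally show "emeasure (distr (SN N) (SN N) (rot i j \<theta>)) A = emeasure (SN N) A" .
qed simp

lemma integral_SN_rot:
  fixes f :: "(nat \<Rightarrow> real) \<Rightarrow> real"
  assumes "i < N" "j < N" "i \<noteq> j" and f: "f \<in> borel_measurable (SN N)"
  shows "(\<integral>v. f (rot i j \<theta> v) \<partial>SN N) = (\<integral>v. f v \<partial>SN N)"
  using integral_distr[OF rot_measurable_SN[OF assms(1-3)] f, of \<theta>]
  by (simp add: SN_rot[OF assms(1-3)])

text \<open>By the group law, derivatives at angle zero, known at all points of the sphere, give the
  derivative at any angle of an orbit.\<close>

lemma rot_deriv_shift:
  assumes ij: "i < N" "j < N" "i \<noteq> j"
    and d: "\<And>v. v \<in> sph N \<Longrightarrow> ((\<lambda>\<theta>. h (rot i j \<theta> v)) has_real_derivative h' v) (at 0)"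
    and v: "v \<in> sph N"
  shows "((\<lambda>\<theta>. h (rot i j \<theta> v)) has_real_derivative h' (rot i j t v)) (at t)"
proof -
  have "((\<lambda>\<theta>. \<theta> - t) has_real_derivative 1) (at t)" by (auto intro!: derivative_eq_intros)
  then show ?thesis
    using DERIV_chain2[of "\<lambda>\<theta>. h (rot i j \<theta> (rot i j t v))" "h' (rot i j t v)" "\<lambda>\<theta>. \<theta> - t" t 1 UNIV]
      d[OF rot_sph[OF ij v, of t]] ij(3) by (simp add: rot_add)
qed

text \<open>By invariance the integral of h composed with a rotation does not depend on the angle;
  its derivative at angle zero is the integral of h'.\<close>

lemma int_deriv_zero:
  fixes h h' :: "(nat \<Rightarrow> real) \<Rightarrow> real"
  assumes ij: "i < N" "j < N" "i \<noteq> j"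
    and d: "\<And>v. v \<in> sph N \<Longrightarrow> ((\<lambda>\<theta>. h (rot i j \<theta> v)) has_real_derivative h' v) (at 0)"
    and c: "continuous_on (sph N) h" and c': "continuous_on (sph N) h'"
  shows "(\<integral>v. h' v \<partial>SN N) = 0"
proof -
  interpret compact_measure "SN N" by (rule compact_measure_SN) (use ij in auto)
  have "((\<lambda>t. \<integral>v. h (rot i j t v) \<partial>SN N) has_real_derivative (\<integral>v. h' (rot i j 0 v) \<partial>SN N)) (at 0 within {-1..1})"
  proof (rule deriv_integral)
    fix t v assume v: "v \<in> space (SN N)"
    then have "v \<in> sph N" by (simp add: space_SN)
    from rot_deriv_shift[where h = h and h' = h', OF ij d this]
    show "((\<lambda>t. h (rot i j t v)) has_real_derivative h' (rot i j t v)) (at t within {- 1..1})"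
      by (auto intro: DERIV_subset)
  next
    fix t
    show "continuous_on (space (SN N)) (\<lambda>v. h (rot i j t v))"
      using rot_sph[OF ij] by (intro continuous_on_compose2[OF c] continuous_intros) (auto simp: space_SN)
  next
    show "continuous_on ({- 1..1} \<times> space (SN N)) (\<lambda>x. h' (rot i j (fst x) (snd x)))"
      using rot_sph[OF ij] by (intro continuous_on_compose2[OF c'] continuous_intros) (auto simp: space_SN)
  qed auto
  then have "((\<lambda>t. \<integral>v. h (rot i j t v) \<partial>SN N) has_real_derivative (\<integral>v. h' v \<partial>SN N)) (at 0)"
    by (simp add: at_within_Icc_at)
  moreover have "(\<lambda>t. \<integral>v. h (rot i j t v) \<partial>SN N) = (\<lambda>t. \<integral>v. h v \<partial>SN N)"
    using cont_meas[of h] c by (simp add: integral_SN_rot[OF ij] space_SN)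
  ultimately show ?thesis using DERIV_unique DERIV_const by metis
qed

lemma ibp:
  fixes g g' h h' :: "(nat \<Rightarrow> real) \<Rightarrow> real"
  assumes ij: "i < N" "j < N" "i \<noteq> j"
    and dg: "\<And>v. v \<in> sph N \<Longrightarrow> ((\<lambda>\<theta>. g (rot i j \<theta> v)) has_real_derivative g' v) (at 0)"
    and dh: "\<And>v. v \<in> sph N \<Longrightarrow> ((\<lambda>\<theta>. h (rot i j \<theta> v)) has_real_derivative h' v) (at 0)"
    and c: "continuous_on (sph N) g" "continuous_on (sph N) g'" "continuous_on (sph N) h" "continuous_on (sph N) h'"
  shows "(\<integral>v. g v * h' v \<partial>SN N) = - (\<integral>v. g' v * h v \<partial>SN N)"
proof -
  interpret compact_measure "SN N" by (rule compact_measure_SN) (use ij in auto)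
  have "(\<integral>v. g' v * h v + g v * h' v \<partial>SN N) = 0"
    by (rule int_deriv_zero[OF ij, of "\<lambda>v. g v * h v"])
      (auto intro!: derivative_eq_intros dg dh continuous_intros c)
  moreover have "integrable (SN N) (\<lambda>v. g' v * h v)" "integrable (SN N) (\<lambda>v. g v * h' v)"
    by (auto intro!: cont_integrable continuous_intros c simp: space_SN)
  ultimately show ?thesis by simp
qed

section \<open>The maximum principle\<close>

lemma second_deriv_max:
  fixes g g' :: "real \<Rightarrow> real"
  assumes g: "\<And>x. (g has_real_derivative g' x) (at x)"
    and g': "(g' has_real_derivative d) (at 0)" and mx: "\<And>x. g x \<le> g 0"
  shows "d \<le> 0"
proof (rule ccontr)
  assume "\<not> d \<le> 0"
  have 0: "g' 0 = 0" using DERIV_local_max[OF g, of 1 0] mx by auto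
  obtain e where e: "e > 0" "\<And>h. 0 < h \<Longrightarrow> h < e \<Longrightarrow> g' 0 < g' (0 + h)"
    using DERIV_pos_inc_right[OF g'] \<open>\<not> d \<le> 0\<close> by auto
  obtain z where z: "0 < z" "z < e/2" "g (e/2) - g 0 = (e/2 - 0) * g' z"
    using MVT2[of 0 "e/2" g g'] e(1) g by auto
  then have "g' z > 0" using e 0 by auto
  then have "(e/2 - 0) * g' z > 0" using e(1) by (intro mult_pos_pos) auto
  then show False using mx[of "e/2"] z(3) by linarith
qed

lemma rlap_max:
  assumes "v \<in> sph N" and mx: "\<And>w. w \<in> sph N \<Longrightarrow> pev p w \<le> pev p v"
  shows "pev (rlap N p) v \<le> 0"
proof -
  have "pev (X i j (X i j p)) v \<le> 0" if "i < N" "j < N" for i j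
  proof (cases "i = j")
    case False
    show ?thesis
    proof (rule second_deriv_max)
      show "((\<lambda>\<theta>. pev p (rot i j \<theta> v)) has_real_derivative pev (X i j p) (rot i j x v)) (at x)" for x
        by (rule rot_deriv[OF False])
      show "((\<lambda>\<theta>. pev (X i j p) (rot i j \<theta> v)) has_real_derivative pev (X i j (X i j p)) v) (at 0)"
        using rot_deriv[OF False, of "X i j p" v 0] by simp
      show "pev p (rot i j x v) \<le> pev p (rot i j 0 v)" for x
        using mx[OF rot_sph[OF that False assms(1)]] by simp
    qed
  qed simp
  then have "(\<Sum>i<N. \<Sum>j<N. pev (X i j (X i j p)) v) \<le> 0"
    by (intro sum_nonpos) auto
  then show ?thesis by (simp add: pev_Lp)
qed

text \<open>Subtracting \<delta> t makes the inequality strict. At a maximum over the space-time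
  cylinder with positive time the generator is nonpositive, so the function decreases strictly in
  time there and was larger just before. Hence the maximum sits at time 0.\<close>

lemma max_principle:
  assumes p: "time_pol p"
    and d: "\<And>t v. t \<in> {0..T} \<Longrightarrow> v \<in> sph N \<Longrightarrow> ((\<lambda>t. pev (p t) v) has_real_derivative p' t v) (at t)"
    and le: "\<And>t v. t \<in> {0..T} \<Longrightarrow> v \<in> sph N \<Longrightarrow> p' t v \<le> pev (rlap N (p t)) v"
    and init: "\<And>v. v \<in> sph N \<Longrightarrow> pev (p 0) v \<le> m"
    and T: "0 \<le> T" and v: "v \<in> sph N"
  shows "pev (p T) v \<le> m"
proof (rule field_le_epsilon)
  fix e :: real assume e: "e > 0"
  \<comment> \<open>The + 1 covers T = 0.\<close>
  define \<delta> where "\<delta> = e / (T + 1)"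
  have \<delta>: "\<delta> > 0" "\<delta> * T \<le> e" using e T by (auto simp: \<delta>_def field_simps)
  let ?f = "\<lambda>x. pev (p (fst x)) (snd x) - \<delta> * fst x"
  have "continuous_on ({0..T} \<times> sph N) ?f"
    by (intro continuous_intros p)
  moreover have "{0..T} \<times> sph N \<noteq> {}" using T v by auto
  ultimately obtain y where y: "y \<in> {0..T} \<times> sph N" "\<And>x. x \<in> {0..T} \<times> sph N \<Longrightarrow> ?f x \<le> ?f y"
    using continuous_attains_sup[of "{0..T} \<times> sph N" ?f] compact_Times[OF compact_Icc compact_sph] by blast
  obtain s w where sw: "y = (s, w)" by (cases y)
  have s: "s \<in> {0..T}" and w: "w \<in> sph N" using y sw by auto
  have "s = 0"
  proof (rule ccontr)
    assume "s \<noteq> 0"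
    have "pev (rlap N (p s)) w \<le> 0"
    proof (rule rlap_max[OF w])
      fix w' assume "w' \<in> sph N"
      then show "pev (p s) w' \<le> pev (p s) w" using y(2)[of "(s, w')"] s sw by simp
    qed
    then have neg: "p' s w - \<delta> < 0" using le[OF s w] \<delta> by simp
    have "((\<lambda>t. pev (p t) w - \<delta> * t) has_real_derivative p' s w - \<delta>) (at s)"
      by (auto intro!: derivative_eq_intros d s w)
    \<comment> \<open>Only earlier times are inspected, so the final time s = T needs no separate
      treatment.\<close>
    from DERIV_neg_dec_left[OF this neg] obtain r where
      r: "r > 0" "\<And>h. 0 < h \<Longrightarrow> h < r \<Longrightarrow> pev (p s) w - \<delta> * s < pev (p (s - h)) w - \<delta> * (s - h)" by auto
    define h where "h = min (r/2) s"
    have h: "0 < h" "h < r" "h \<le> s" using r s \<open>s \<noteq> 0\<close> by (auto simp: h_def)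
    have "s - h \<in> {0..T}" using h s by auto
    then show False using r(2)[OF h(1,2)] y(2)[of "(s - h, w)"] w sw by auto
  qed
  then have "?f (T, v) \<le> pev (p 0) w"
    using y(2)[of "(T, v)"] T v sw by simp
  also have "\<dots> \<le> m" by (rule init[OF w])
  finally show "pev (p T) v \<le> m + e" using \<delta> by simp
qed

section \<open>The curvature bound\<close>

lemma rlap_scale: "pev (rlap N (Mul (C c) p)) v = c * pev (rlap N p) v"
  by (simp add: pev_Lp X_cong[OF X_scale] X_scale sum_distrib_left)

lemma rlap_Add: "pev (rlap N (Add p q)) v = pev (rlap N p) v + pev (rlap N q) v"
proof -
  have "pev (X i j (Add p q)) = pev (Add (X i j p) (X i j q))" for i j
    by (auto simp: X_Add)
  from X_cong[OF this] show ?thesis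
    by (simp add: pev_Lp X_Add sum.distrib add_divide_distrib)
qed

lemma rlap_zero: "pev (rlap N (C 0)) v = 0"
  by (simp add: pev_Lp pev_X X_def)

lemma rlap_sump: "pev (rlap N (sump f xs)) v = (\<Sum>x\<leftarrow>xs. pev (rlap N (f x)) v)"
  by (induction xs) (simp_all add: rlap_Add rlap_zero)

text \<open>The carre du champ identity. The double sum runs over ordered pairs and so is twice the
  squared gradient.\<close>

lemma rlap_square:
  "pev (rlap N (Mul y y)) v = 2 * pev y v * pev (rlap N y) v + (\<Sum>k<N. \<Sum>l<N. (pev (X k l y) v)^2)"
proof -
  have "pev (X k l (Mul y y)) = pev (Mul (C 2) (Mul y (X k l y)))" for k l
    by (auto simp: X_Mul)
  from X_cong[OF this] have "pev (X k l (X k l (Mul y y))) v = 2 * pev y v * pev (X k l (X k l y)) v + 2 * (pev (X k l y) v)^2" for k l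
    by (simp add: X_scale X_Mul power2_eq_square algebra_simps)
  then show ?thesis
    by (simp add: pev_Lp sum.distrib sum_distrib_left add_divide_distrib mult_ac sum_divide_distrib)
qed

lemma ibp_L:
  fixes g :: "(nat \<Rightarrow> real) \<Rightarrow> real"
  assumes dg: "\<And>k l v. k < N \<Longrightarrow> l < N \<Longrightarrow> k \<noteq> l \<Longrightarrow> v \<in> sph N \<Longrightarrow>
      ((\<lambda>\<theta>. g (rot k l \<theta> v)) has_real_derivative g' k l v) (at 0)"
    and c: "continuous_on (sph N) g" "\<And>k l. continuous_on (sph N) (g' k l)" and N: "0 < N"
  shows "(\<integral>v. g v * pev (rlap N p) v \<partial>SN N) = - (\<Sum>k<N. \<Sum>l<N. \<integral>v. g' k l v * pev (X k l p) v \<partial>SN N) / 2"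
proof -
  interpret compact_measure "SN N" by (rule compact_measure_SN[OF N])
  have i: "integrable (SN N) (\<lambda>v. g v * pev (X k l (X k l p)) v)" for k l
    by (intro cont_integrable continuous_intros) (simp_all add: space_SN c)
  have "(\<integral>v. g v * pev (rlap N p) v \<partial>SN N) = (\<integral>v. (\<Sum>k<N. \<Sum>l<N. g v * pev (X k l (X k l p)) v) / 2 \<partial>SN N)"
    by (simp add: pev_Lp sum_distrib_left)
  also have "\<dots> = (\<Sum>k<N. \<Sum>l<N. \<integral>v. g v * pev (X k l (X k l p)) v \<partial>SN N) / 2"
    using i by (simp add: Bochner_Integration.integral_sum)
  also have "\<dots> = (\<Sum>k<N. \<Sum>l<N. - (\<integral>v. g' k l v * pev (X k l p) v \<partial>SN N)) / 2"
  proof -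
    have "(\<integral>v. g v * pev (X k l (X k l p)) v \<partial>SN N) = - (\<integral>v. g' k l v * pev (X k l p) v \<partial>SN N)"
      if kl: "k < N" "l < N" for k l
    proof (cases "k = l")
      case False
      show ?thesis
      proof (rule ibp[OF kl False])
        fix v
        show "((\<lambda>\<theta>. pev (X k l p) (rot k l \<theta> v)) has_real_derivative pev (X k l (X k l p)) v) (at 0)"
          using rot_deriv[OF False, of "X k l p" v 0] by simp
      qed (use dg kl False c in \<open>auto intro: continuous_intros\<close>)
    qed simp
    then show ?thesis by simp
  qed
  finally show ?thesis by (simp add: sum_negf)
qed

text \<open>The Casimir constant of the structure constants. With Q the double sum on the right,
  each of the four squares contributes N Q. Of the six cross products two contain some
  \<open>B i i\<close> and vanish, and the other four contribute - 2 Q each, so the total is (4 N -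
  8) Q.\<close>

lemma comm_square_sum:
  fixes B :: "nat \<Rightarrow> nat \<Rightarrow> real"
  assumes anti: "\<And>i j. B j i = - B i j"
  shows "(\<Sum>i<N. \<Sum>j<N. \<Sum>k<N. \<Sum>l<N.
     ((if i = l then B k j else 0) + (if j = k then B l i else 0)
    + (if i = k then B j l else 0) + (if j = l then B i k else 0))^2) = 4 * (real N - 2) * (\<Sum>i<N. \<Sum>j<N. (B i j)^2)"
proof -
  let ?Q = "\<Sum>i<N. \<Sum>j<N. (B i j)^2"
  have B0: "B i i = 0" for i using anti[of i i] by simp
  have sw: "(\<Sum>i<N. \<Sum>j<N. (B j i)^2) = ?Q" by (rule sum.swap)
  have sq: "((if i = l then B k j else 0) + (if j = k then B l i else 0)
    + (if i = k then B j l else 0) + (if j = l then B i k else 0))^2 =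
    (if i = l then (B k j)^2 else 0) + (if j = k then (B l i)^2 else 0)
    + (if i = k then (B j l)^2 else 0) + (if j = l then (B i k)^2 else 0)
    - (if i = l then if i = k then 2 * (B i j)^2 else 0 else 0)
    - (if i = l then if j = l then 2 * (B j k)^2 else 0 else 0)
    - (if j = k then if i = k then 2 * (B i l)^2 else 0 else 0)
    - (if j = k then if j = l then 2 * (B i j)^2 else 0 else 0)" for i j k l
    using anti[of j k] anti[of i j] anti[of i l] B0
    by (auto simp: power2_eq_square algebra_simps)
  have "(\<Sum>i<N. \<Sum>j<N. \<Sum>k<N. \<Sum>l<N. if i = l then (B k j)^2 else 0) = real N * ?Q"
  proof -
    have "(\<Sum>i<N. \<Sum>j<N. \<Sum>k<N. \<Sum>l<N. if i = l then (B k j)^2 else 0) = (\<Sum>i<N. \<Sum>j<N. \<Sum>k<N. (B k j)^2)"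
      by (intro sum.cong refl) auto
    also have "\<dots> = real N * ?Q" using sw by simp
    finally show ?thesis .
  qed
  moreover have "(\<Sum>i<N. \<Sum>j<N. \<Sum>k<N. \<Sum>l<N. if j = k then (B l i)^2 else 0) = real N * ?Q"
  proof -
    have "(\<Sum>i<N. \<Sum>j<N. \<Sum>k<N. \<Sum>l<N. if j = k then (B l i)^2 else 0) = (\<Sum>i<N. \<Sum>j<N. \<Sum>l<N. \<Sum>k<N. if j = k then (B l i)^2 else 0)"
      by (intro sum.cong refl sum.swap)
    also have "\<dots> = (\<Sum>i<N. \<Sum>j<N. \<Sum>l<N. (B l i)^2)"
      by (intro sum.cong refl) auto
    also have "\<dots> = real N * ?Q" using sw by (simp add: sum_distrib_left[symmetric])
    finally show ?thesis .
  qed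
  moreover have "(\<Sum>i<N. \<Sum>j<N. \<Sum>k<N. \<Sum>l<N. if i = k then (B j l)^2 else 0) = real N * ?Q"
  proof -
    have "(\<Sum>i<N. \<Sum>j<N. \<Sum>k<N. \<Sum>l<N. if i = k then (B j l)^2 else 0) = (\<Sum>i<N. \<Sum>j<N. \<Sum>l<N. \<Sum>k<N. if i = k then (B j l)^2 else 0)"
      by (intro sum.cong refl sum.swap)
    also have "\<dots> = (\<Sum>i<N. \<Sum>j<N. \<Sum>l<N. (B j l)^2)"
      by (intro sum.cong refl) auto
    also have "\<dots> = real N * ?Q" by simp
    finally show ?thesis .
  qed
  moreover have "(\<Sum>i<N. \<Sum>j<N. \<Sum>k<N. \<Sum>l<N. if j = l then (B i k)^2 else 0) = real N * ?Q"
  proof -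
    have "(\<Sum>i<N. \<Sum>j<N. \<Sum>k<N. \<Sum>l<N. if j = l then (B i k)^2 else 0) = (\<Sum>i<N. \<Sum>j<N. \<Sum>k<N. (B i k)^2)"
      by (intro sum.cong refl) auto
    also have "\<dots> = real N * ?Q" by (simp add: sum_distrib_left[symmetric])
    finally show ?thesis .
  qed
  moreover have "(\<Sum>i<N. \<Sum>j<N. \<Sum>k<N. \<Sum>l<N. if i = l then if i = k then 2 * (B i j)^2 else 0 else 0) = 2 * ?Q"
    by (simp add: sum_distrib_left)
  moreover have "(\<Sum>i<N. \<Sum>j<N. \<Sum>k<N. \<Sum>l<N. if j = k then if j = l then 2 * (B i j)^2 else 0 else 0) = 2 * ?Q"
  proof -
    have "(\<Sum>i<N. \<Sum>j<N. \<Sum>k<N. \<Sum>l<N. if j = k then if j = l then 2 * (B i j)^2 else 0 else 0)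
       = (\<Sum>i<N. \<Sum>j<N. \<Sum>l<N. \<Sum>k<N. if j = k then if j = l then 2 * (B i j)^2 else 0 else 0)"
      by (intro sum.cong refl sum.swap)
    then show ?thesis by (simp add: sum_distrib_left)
  qed
  moreover have "(\<Sum>i<N. \<Sum>j<N. \<Sum>k<N. \<Sum>l<N. if i = l then if j = l then 2 * (B j k)^2 else 0 else 0) = 2 * ?Q"
  proof -
    have "(\<Sum>i<N. \<Sum>j<N. \<Sum>k<N. \<Sum>l<N. if i = l then if j = l then 2 * (B j k)^2 else 0 else 0) =
       (\<Sum>i<N. \<Sum>k<N. \<Sum>j<N. \<Sum>l<N. if i = l then if j = l then 2 * (B j k)^2 else 0 else 0)"
      by (intro sum.cong refl sum.swap)
    also have "\<dots> = (\<Sum>i<N. \<Sum>k<N. \<Sum>j<N. if j = i then 2 * (B j k)^2 else 0)"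
      by (intro sum.cong refl) auto
    finally show ?thesis by (simp add: sum_distrib_left)
  qed
  moreover have "(\<Sum>i<N. \<Sum>j<N. \<Sum>k<N. \<Sum>l<N. if j = k then if i = k then 2 * (B i l)^2 else 0 else 0) = 2 * ?Q"
  proof -
    have "(\<Sum>i<N. \<Sum>j<N. \<Sum>k<N. \<Sum>l<N. if j = k then if i = k then 2 * (B i l)^2 else 0 else 0) =
       (\<Sum>i<N. \<Sum>j<N. \<Sum>l<N. \<Sum>k<N. if j = k then if i = k then 2 * (B i l)^2 else 0 else 0)"
      by (intro sum.cong refl sum.swap)
    also have "\<dots> = (\<Sum>i<N. \<Sum>j<N. \<Sum>l<N. if i = j then 2 * (B i l)^2 else 0)"
      by (intro sum.cong refl) auto
    also have "\<dots> = (\<Sum>i<N. \<Sum>l<N. \<Sum>j<N. if i = j then 2 * (B i l)^2 else 0)"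
      by (intro sum.cong refl sum.swap)
    finally show ?thesis by (simp add: sum_distrib_left)
  qed
  ultimately show ?thesis
    unfolding sq sum.distrib sum_subtractf by (simp add: algebra_simps)
qed

text \<open>Only the antisymmetric part of \<open>M\<close> is controlled, namely by the structure constants of
  the rotation algebra; this loses a factor of two against the Ricci curvature of the sphere.\<close>

lemma curvature_bound:
  fixes M :: "nat \<Rightarrow> nat \<Rightarrow> nat \<Rightarrow> nat \<Rightarrow> real" and p :: pol
  assumes "\<And>i j k l. M i j k l - M k l i j = pev (X i j (X k l p)) v - pev (X k l (X i j p)) v"
  shows "(real N - 2) * (\<Sum>i<N. \<Sum>j<N. (pev (X i j p) v)^2) \<le> (\<Sum>i<N. \<Sum>j<N. \<Sum>k<N. \<Sum>l<N. (M k l i j)^2)"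
proof -
  let ?S = "\<Sum>i<N. \<Sum>j<N. \<Sum>k<N. \<Sum>l<N. (M k l i j)^2"
  have sw: "(\<Sum>i<N. \<Sum>j<N. \<Sum>k<N. \<Sum>l<N. (M i j k l)^2) = ?S"
  proof -
    have "(\<Sum>i<N. \<Sum>j<N. \<Sum>k<N. \<Sum>l<N. (M i j k l)^2) = (\<Sum>i<N. \<Sum>k<N. \<Sum>j<N. \<Sum>l<N. (M i j k l)^2)"
      by (intro sum.cong refl sum.swap)
    also have "\<dots> = (\<Sum>k<N. \<Sum>i<N. \<Sum>l<N. \<Sum>j<N. (M i j k l)^2)"
      by (subst sum.swap) (intro sum.cong refl sum.swap)
    also have "\<dots> = (\<Sum>k<N. \<Sum>l<N. \<Sum>i<N. \<Sum>j<N. (M i j k l)^2)"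
      by (intro sum.cong refl sum.swap)
    finally show ?thesis .
  qed
  have "4 * (real N - 2) * (\<Sum>i<N. \<Sum>j<N. (pev (X i j p) v)^2) =
     (\<Sum>i<N. \<Sum>j<N. \<Sum>k<N. \<Sum>l<N. (M i j k l - M k l i j)^2)"
    unfolding assms commutator
    by (rule comm_square_sum[symmetric]) (rule X_antisym)
  also have "\<dots> \<le> (\<Sum>i<N. \<Sum>j<N. \<Sum>k<N. \<Sum>l<N. 2 * (M i j k l)^2 + 2 * (M k l i j)^2)"
  proof (intro sum_mono)
    fix i j k l
    have "0 \<le> (M i j k l + M k l i j)^2" by simp
    then show "(M i j k l - M k l i j)^2 \<le> 2 * (M i j k l)^2 + 2 * (M k l i j)^2"
      by (simp add: power2_eq_square algebra_simps)
  qed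
  also have "\<dots> = 4 * ?S"
    using sw by (simp add: sum.distrib sum_distrib_left[symmetric])
  finally have "4 * ((real N - 2) * (\<Sum>i<N. \<Sum>j<N. (pev (X i j p) v)^2)) \<le> 4 * ?S"
    by (simp only: mult.assoc)
  then show ?thesis by linarith
qed

section \<open>Entropy and Fisher information along the heat flow\<close>

lemma rot_lipschitz:
  assumes "i \<noteq> j" "\<And>\<theta>. \<bar>pev (X i j p) (rot i j \<theta> v)\<bar> \<le> K"
  shows "\<bar>pev p (rot i j \<theta> v) - pev p v\<bar> \<le> K * \<bar>\<theta>\<bar>"
  using field_differentiable_bound[of UNIV "\<lambda>\<theta>. pev p (rot i j \<theta> v)" "\<lambda>\<theta>. pev (X i j p) (rot i j \<theta> v)" K \<theta> 0]
    rot_deriv[OF assms(1)] assms(2) by simp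

lemma kill_coordinate:
  assumes "i \<noteq> j"
  shows "\<exists>\<theta>. \<bar>\<theta>\<bar> \<le> 2 \<and> rot i j \<theta> v j = 0"
proof (cases "v i = 0")
  case True
  then show ?thesis using pi_half_le_two by (intro exI[of _ "pi/2"]) (simp add: rot_j)
next
  case False
  let ?\<theta> = "arctan (v j / v i)"
  have c: "cos ?\<theta> \<noteq> 0" by simp
  have "sin ?\<theta> = v j / v i * cos ?\<theta>"
    using tan_arctan[of "v j / v i"] c by (simp add: tan_def field_simps)
  then have "rot i j ?\<theta> v j = 0" using False by (simp add: rot_j)
  moreover have "\<bar>?\<theta>\<bar> \<le> 2"
    using arctan_lbound[of "v j / v i"] arctan_ubound[of "v j / v i"] pi_half_le_two by linarith
  ultimately show ?thesis by blast
qed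

text \<open>Every point of the sphere is joined to a pole by \<open>N\<close> plane rotations.\<close>

lemma pole_distance:
  assumes N: "2 \<le> N" and K: "\<And>i j v. i < N \<Longrightarrow> j < N \<Longrightarrow> i \<noteq> j \<Longrightarrow> v \<in> sph N \<Longrightarrow> \<bar>pev (X i j p) v\<bar> \<le> K"
    and v: "v \<in> sph N"
  shows "\<bar>pev p v - pev p ((\<lambda>k\<in>{..<N}. if k = 0 then sqrt N else 0))\<bar> \<le> K * (2 * real N + 2)"
proof -
  let ?e = "\<lambda>k\<in>{..<N}. if k = 0 then sqrt N else 0"
  have "n < N \<Longrightarrow> \<exists>w\<in>sph N. (\<forall>k. 1 \<le> k \<and> k \<le> n \<longrightarrow> w k = 0) \<and> \<bar>pev p v - pev p w\<bar> \<le> K * (2 * real n)" for n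
  proof (induction n)
    case 0
    then show ?case using v by (intro bexI[of _ v]) auto
  next
    case (Suc n)
    then obtain w where w: "w \<in> sph N" "\<And>k. 1 \<le> k \<and> k \<le> n \<Longrightarrow> w k = 0" "\<bar>pev p v - pev p w\<bar> \<le> K * (2 * real n)"
      by auto
    obtain \<theta> where \<theta>: "\<bar>\<theta>\<bar> \<le> 2" "rot 0 (Suc n) \<theta> w (Suc n) = 0"
      using kill_coordinate[of 0 "Suc n" w] by auto
    let ?w = "rot 0 (Suc n) \<theta> w"
    have "K \<ge> 0" using K[of 0 1 v] N v by (auto intro: order_trans[OF abs_ge_zero])
    have "\<bar>pev p ?w - pev p w\<bar> \<le> K * \<bar>\<theta>\<bar>"
      using Suc.prems w by (intro rot_lipschitz K rot_sph) auto
    also have "\<dots> \<le> K * 2" using \<theta> \<open>K \<ge> 0\<close> by (intro mult_left_mono) auto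
    finally have "\<bar>pev p v - pev p ?w\<bar> \<le> K * (2 * real (Suc n))"
      using w(3) by (simp add: algebra_simps)
    moreover have "?w k = 0" if "1 \<le> k \<and> k \<le> Suc n" for k
      using that \<theta> w(2)[of k] by (cases "k = Suc n") (auto simp: rot_other)
    moreover have "?w \<in> sph N" using Suc.prems w by (intro rot_sph) auto
    ultimately show ?case by blast
  qed
  from this[of "N - 1"] N obtain w where w: "w \<in> sph N" "\<And>k. 1 \<le> k \<and> k \<le> N - 1 \<Longrightarrow> w k = 0"
    "\<bar>pev p v - pev p w\<bar> \<le> K * (2 * real (N - 1))" by auto
  have wk: "w k = (if k = 0 then w 0 else 0)" if "k < N" for k
    using w(2)[of k] that by auto
  have "(w 0)^2 = N"
  proof -
    have "sqnorm N w = (\<Sum>k<N. if k = 0 then (w 0)^2 else 0)"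
      unfolding sqnorm_def
    proof (intro sum.cong refl)
      fix k assume "k \<in> {..<N}"
      then show "(w k)^2 = (if k = 0 then (w 0)^2 else 0)" by (subst wk) auto
    qed
    then show ?thesis using w(1) N by (simp add: sph_def)
  qed
  then have w0: "w 0 = sqrt N \<or> w 0 = - sqrt N"
    by (metis power2_eq_iff real_sqrt_pow2 of_nat_0_le_iff)
  have "K \<ge> 0" using K[of 0 1 v] N v by (auto intro: order_trans[OF abs_ge_zero])
  \<comment> \<open>Only the pole and its antipode remain, and a half turn in the plane (0,1), of
    angle pi < 4, exchanges them.\<close>
  have "\<bar>pev p w - pev p ?e\<bar> \<le> K * 4"
  proof (cases "w 0 = sqrt N")
    case True
    have "w k = (if k = 0 then sqrt N else 0)" if "k < N" for k
      using wk[OF that] True by presburger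
    then have "w = ?e"
      using w(1) by (auto simp: sph_def fun_eq_iff PiE_def extensional_def)
    then show ?thesis using \<open>K \<ge> 0\<close> by simp
  next
    case False
    then have f: "w 0 = - sqrt N" using w0 by simp
    have "rot 0 1 pi w k = (if k = 0 then sqrt N else 0)" if "k < N" for k
      using wk[OF that] w(2)[of 1] f N by (cases "k = 1") (auto simp: rot_def)
    moreover have "rot 0 1 pi w \<in> sph N" using N w by (intro rot_sph) auto
    ultimately have "rot 0 1 pi w = ?e"
      by (auto simp: sph_def fun_eq_iff PiE_def extensional_def)
    moreover have "\<bar>pev p (rot 0 1 pi w) - pev p w\<bar> \<le> K * \<bar>pi\<bar>"
      using N w by (intro rot_lipschitz K rot_sph) auto
    moreover have "K * \<bar>pi\<bar> \<le> K * 4"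
      using \<open>K \<ge> 0\<close> pi_less_4 by (intro mult_left_mono) auto
    ultimately show ?thesis by (simp add: abs_minus_commute)
  qed
  moreover have "K * (2 * real (N - 1)) + K * 4 = K * (2 * real N + 2)"
    using N by (simp add: of_nat_diff algebra_simps)
  ultimately show ?thesis using w(3) by linarith
qed

lemma double_sum_halves:
  fixes a b c :: "nat \<Rightarrow> nat \<Rightarrow> real"
  assumes "\<And>k l. a k l + b k l = 2 * c k l"
  shows "- (\<Sum>k<N. \<Sum>l<N. a k l) / 2 + - (\<Sum>k<N. \<Sum>l<N. b k l) / 2 = - (\<Sum>k<N. \<Sum>l<N. c k l)"
proof -
  have "(\<Sum>k<N. \<Sum>l<N. a k l) + (\<Sum>k<N. \<Sum>l<N. b k l) = 2 * (\<Sum>k<N. \<Sum>l<N. c k l)"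
    by (simp add: sum.distrib[symmetric] assms sum_distrib_left)
  then show ?thesis by simp
qed

text \<open>The output of \<open>heat_flow\<close> for an initial value bounded below by m. No total
  mass is prescribed, since polynomial approximants of a density need not have mass 1.\<close>

locale heat =
  fixes N :: nat and u :: "real \<Rightarrow> pol" and m :: real
  assumes N: "2 \<le> N" and time_pol_u: "time_pol u"
    and d_u: "\<And>t v. ((\<lambda>t. pev (u t) v) has_real_derivative pev (rlap N (u t)) v) (at t)"
    and d_Xu: "\<And>i j t v. i < N \<Longrightarrow> j < N \<Longrightarrow>
       ((\<lambda>t. pev (X i j (u t)) v) has_real_derivative pev (rlap N (X i j (u t))) v) (at t)"
    and m: "0 < m" and init: "\<And>v. v \<in> sph N \<Longrightarrow> m \<le> pev (u 0) v"
begin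

sublocale SN: compact_measure "SN N"
  by (rule compact_measure_SN) (use N in auto)

sublocale SN: prob_space "SN N"
  by (rule prob_space_SN) (use N in auto)

lemma u_ge:
  assumes "0 \<le> t" "v \<in> sph N"
  shows "m \<le> pev (u t) v"
proof -
  have "pev (Mul (C (-1)) (u t)) v \<le> - m"
  proof (rule max_principle[where N = N and p' = "\<lambda>t v. - pev (rlap N (u t)) v" and T = t and p = "\<lambda>t. Mul (C (-1)) (u t)"])
    show "time_pol (\<lambda>t. Mul (C (- 1)) (u t))" by (intro time_pol_Mul time_pol_const time_pol_u)
  qed (use assms init in \<open>auto simp: rlap_scale intro!: derivative_eq_intros d_u\<close>)
  then show ?thesis by simp
qed

lemma u_pos: "0 \<le> t \<Longrightarrow> v \<in> sph N \<Longrightarrow> 0 < pev (u t) v"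
  using u_ge[of t v] m by simp

definition H :: "real \<Rightarrow> real" where
  "H t = (\<integral>v. pev (u t) v * ln (pev (u t) v) \<partial>SN N)"

text \<open>The Fisher information in the direction of one rotation field. It is kept separate for
  each pair because the production of that pair is compared with it.\<close>

definition J :: "nat \<Rightarrow> nat \<Rightarrow> real \<Rightarrow> real" where
  "J i j t = (\<integral>v. (pev (X i j (u t)) v)^2 / pev (u t) v \<partial>SN N)"

definition I :: "real \<Rightarrow> real" where
  "I t = (\<Sum>i<N. \<Sum>j<N. J i j t) / 2"

lemma H_deriv:
  assumes t: "t \<in> {0..T}"
  shows "(H has_real_derivative - I t) (at t within {0..T})"
proof -
  have "(H has_real_derivative (\<integral>v. (ln (pev (u t) v) + 1) * pev (rlap N (u t)) v \<partial>SN N)) (at t within {0..T})"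
    unfolding H_def
  proof (rule SN.deriv_integral[OF _ _ _ t])
    fix s v assume "s \<in> {0..T}" "v \<in> space (SN N)"
    then have "pev (u s) v > 0" using u_pos by (auto simp: space_SN)
    then show "((\<lambda>t. pev (u t) v * ln (pev (u t) v)) has_real_derivative (ln (pev (u s) v) + 1) * pev (rlap N (u s)) v) (at s within {0..T})"
      by (auto intro!: derivative_eq_intros DERIV_subset[OF d_u] simp: field_simps)
  next
    fix s assume "s \<in> {0..T}"
    then show "continuous_on (space (SN N)) (\<lambda>v. pev (u s) v * ln (pev (u s) v))"
      using u_pos[of s] by (intro continuous_intros) (force simp: space_SN)+
  next
    show "continuous_on ({0..T} \<times> space (SN N)) (\<lambda>x. (ln (pev (u (fst x)) (snd x)) + 1) * pev (rlap N (u (fst x))) (snd x))"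
      using u_pos by (intro continuous_intros time_pol_u time_pol_Lp) (force simp: space_SN)+
  qed
  also have "(\<integral>v. (ln (pev (u t) v) + 1) * pev (rlap N (u t)) v \<partial>SN N) =
      - (\<Sum>k<N. \<Sum>l<N. \<integral>v. pev (X k l (u t)) v / pev (u t) v * pev (X k l (u t)) v \<partial>SN N) / 2"
  proof (rule ibp_L)
    have p: "pev (u t) v \<noteq> 0" "pev (u t) v > 0" if "v \<in> sph N" for v
      using u_pos[of t v] t that by auto
    fix k l v assume "k < N" "l < N" "k \<noteq> l" "v \<in> sph N"
    then show "((\<lambda>\<theta>. ln (pev (u t) (rot k l \<theta> v)) + 1) has_real_derivative pev (X k l (u t)) v / pev (u t) v) (at 0)"
      using p by (auto intro!: derivative_eq_intros rot_deriv)
  next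
    show "continuous_on (sph N) (\<lambda>v. ln (pev (u t) v) + 1)"
      using u_pos[of t] t by (intro continuous_intros) force+
    show "continuous_on (sph N) (\<lambda>v. pev (X k l (u t)) v / pev (u t) v)" for k l
      using u_pos[of t] t by (intro continuous_intros) force+
  qed (use N in auto)
  also have "\<dots> = - I t"
    by (simp add: I_def J_def power2_eq_square)
  finally show ?thesis .
qed

lemma mass:
  assumes "0 \<le> t"
  shows "(\<integral>v. pev (u t) v \<partial>SN N) = (\<integral>v. pev (u 0) v \<partial>SN N)"
proof (cases "t = 0")
  case False
  then have t0: "0 < t" using assms by simp
  have d: "((\<lambda>t. \<integral>v. pev (u t) v \<partial>SN N) has_real_derivative 0) (at s within {0..t})" if s: "s \<in> {0..t}" for s
  proof -
    have "((\<lambda>t. \<integral>v. pev (u t) v \<partial>SN N) has_real_derivative (\<integral>v. pev (rlap N (u s)) v \<partial>SN N)) (at s within {0..t})"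
    proof (rule SN.deriv_integral[OF _ _ _ s])
      show "continuous_on ({0..t} \<times> space (SN N)) (\<lambda>x. pev (rlap N (u (fst x))) (snd x))"
        by (intro continuous_intros time_pol_Lp time_pol_u)
    qed (auto intro!: continuous_intros DERIV_subset[OF d_u])
    moreover have "(\<integral>v. 1 * pev (rlap N (u s)) v \<partial>SN N) = - (\<Sum>k<N. \<Sum>l<N. \<integral>v. 0 * pev (X k l (u s)) v \<partial>SN N) / 2"
      by (rule ibp_L) (use N in \<open>auto intro!: continuous_intros\<close>)
    ultimately show ?thesis by simp
  qed
  show ?thesis
    using has_field_derivative_zero_constant[of "{0..t}" "\<lambda>t. \<integral>v. pev (u t) v \<partial>SN N"] d assms
    by force
qed simp

text \<open>Both y = X i j u and u solve the heat equation, and y^2 / u is convex in (y, u). The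
  dissipation of its integral is therefore governed by the Hessian in the direction (X k l y, X k l
  u), which is 2 (X k l y - y X k l u / u)^2 / u.\<close>

lemma J_deriv:
  assumes t: "t \<in> {0..T}" and ij: "i < N" "j < N"
  shows "(J i j has_real_derivative - (\<Sum>k<N. \<Sum>l<N. \<integral>v.
     (pev (X k l (X i j (u t))) v - pev (X i j (u t)) v * pev (X k l (u t)) v / pev (u t) v)^2 / pev (u t) v \<partial>SN N))
     (at t within {0..T})"
proof -
  define y where "y = (\<lambda>t. X i j (u t))"
  have yt: "X i j (u t) = y t" for t by (simp add: y_def)
  have ty: "time_pol y" unfolding y_def by (rule time_pol_X[OF time_pol_u])
  have dy: "((\<lambda>t. pev (y t) v) has_real_derivative pev (rlap N (y t)) v) (at t)" for t v
    unfolding y_def by (rule d_Xu[OF ij])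
  have p: "pev (u s) v > 0" "pev (u s) v \<noteq> 0" if "s \<in> {0..T}" "v \<in> sph N" for s v
    using u_pos[of s v] that by auto
  let ?u = "pev (u t)" and ?y = "pev (y t)" and ?Xu = "\<lambda>k l. pev (X k l (u t))" and ?Xy = "\<lambda>k l. pev (X k l (y t))"
  have c: "continuous_on (sph N) (\<lambda>v. 2 * ?y v / ?u v)" "continuous_on (sph N) (\<lambda>v. - ((?y v)^2 / (?u v)^2))"
    "\<And>k l. continuous_on (sph N) (\<lambda>v. 2 * (?Xy k l v / ?u v - ?y v * ?Xu k l v / (?u v)^2))"
    "\<And>k l. continuous_on (sph N) (\<lambda>v. - 2 * ?y v * ?Xy k l v / (?u v)^2 + 2 * (?y v)^2 * ?Xu k l v / (?u v)^3)"
    using p[OF t] by (auto intro!: continuous_intros)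
  have "(J i j has_real_derivative (\<integral>v. 2 * ?y v / ?u v * pev (rlap N (y t)) v + (- ((?y v)^2 / (?u v)^2)) * pev (rlap N (u t)) v \<partial>SN N))
     (at t within {0..T})"
    unfolding J_def yt
  proof (rule SN.deriv_integral[OF _ _ _ t])
    fix s v assume "s \<in> {0..T}" "v \<in> space (SN N)"
    then show "((\<lambda>t. (pev (y t) v)\<^sup>2 / pev (u t) v) has_real_derivative
       2 * pev (y s) v / pev (u s) v * pev (rlap N (y s)) v + - ((pev (y s) v)\<^sup>2 / (pev (u s) v)\<^sup>2) * pev (rlap N (u s)) v) (at s within {0..T})"
      using p[of s v] by (auto intro!: derivative_eq_intros DERIV_subset[OF d_u] DERIV_subset[OF dy] simp: space_SN field_simps power2_eq_square)
  next
    fix s assume "s \<in> {0..T}"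
    then show "continuous_on (space (SN N)) (\<lambda>v. (pev (y s) v)\<^sup>2 / pev (u s) v)"
      using p by (auto simp: space_SN intro!: continuous_intros)
  next
    show "continuous_on ({0..T} \<times> space (SN N)) (\<lambda>x. 2 * pev (y (fst x)) (snd x) / pev (u (fst x)) (snd x) * pev (rlap N (y (fst x))) (snd x) +
       - ((pev (y (fst x)) (snd x))\<^sup>2 / (pev (u (fst x)) (snd x))\<^sup>2) * pev (rlap N (u (fst x))) (snd x))"
      using p by (intro continuous_intros time_pol_u ty time_pol_Lp) (auto simp: space_SN)
  qed
  also have "(\<integral>v. 2 * ?y v / ?u v * pev (rlap N (y t)) v + (- ((?y v)^2 / (?u v)^2)) * pev (rlap N (u t)) v \<partial>SN N) =
     (\<integral>v. 2 * ?y v / ?u v * pev (rlap N (y t)) v \<partial>SN N) + (\<integral>v. (- ((?y v)^2 / (?u v)^2)) * pev (rlap N (u t)) v \<partial>SN N)"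
    by (intro Bochner_Integration.integral_add SN.cont_integrable continuous_on_mult[OF c(1)[folded space_SN]]
          continuous_on_mult[OF c(2)[folded space_SN]] continuous_intros)
  also have "(\<integral>v. 2 * ?y v / ?u v * pev (rlap N (y t)) v \<partial>SN N) =
     - (\<Sum>k<N. \<Sum>l<N. \<integral>v. (2 * (?Xy k l v / ?u v - ?y v * ?Xu k l v / (?u v)^2)) * ?Xy k l v \<partial>SN N) / 2"
  proof (rule ibp_L[OF _ c(1,3)])
    fix k l v assume "k < N" "l < N" "k \<noteq> l" "v \<in> sph N"
    then show "((\<lambda>\<theta>. 2 * ?y (rot k l \<theta> v) / ?u (rot k l \<theta> v)) has_real_derivative
        2 * (?Xy k l v / ?u v - ?y v * ?Xu k l v / (?u v)^2)) (at 0)"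
      using p[OF t, of v] by (auto intro!: derivative_eq_intros rot_deriv simp: field_simps power2_eq_square)
  qed (use N in auto)
  also have "(\<integral>v. (- ((?y v)^2 / (?u v)^2)) * pev (rlap N (u t)) v \<partial>SN N) =
     - (\<Sum>k<N. \<Sum>l<N. \<integral>v. (- 2 * ?y v * ?Xy k l v / (?u v)^2 + 2 * (?y v)^2 * ?Xu k l v / (?u v)^3) * ?Xu k l v \<partial>SN N) / 2"
  proof (rule ibp_L[OF _ c(2,4)])
    fix k l v assume "k < N" "l < N" "k \<noteq> l" "v \<in> sph N"
    then show "((\<lambda>\<theta>. - ((?y (rot k l \<theta> v))^2 / (?u (rot k l \<theta> v))^2)) has_real_derivative
        - 2 * ?y v * ?Xy k l v / (?u v)^2 + 2 * (?y v)^2 * ?Xu k l v / (?u v)^3) (at 0)"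
      using p[OF t, of v] by (auto intro!: derivative_eq_intros rot_deriv simp: field_simps power2_eq_square power3_eq_cube)
  qed (use N in auto)
  also have "- (\<Sum>k<N. \<Sum>l<N. \<integral>v. (2 * (?Xy k l v / ?u v - ?y v * ?Xu k l v / (?u v)^2)) * ?Xy k l v \<partial>SN N) / 2
     + - (\<Sum>k<N. \<Sum>l<N. \<integral>v. (- 2 * ?y v * ?Xy k l v / (?u v)^2 + 2 * (?y v)^2 * ?Xu k l v / (?u v)^3) * ?Xu k l v \<partial>SN N) / 2
     = - (\<Sum>k<N. \<Sum>l<N. \<integral>v. (?Xy k l v - ?y v * ?Xu k l v / ?u v)^2 / ?u v \<partial>SN N)"
  proof (rule double_sum_halves)
    fix k l
    have "(\<integral>v. (2 * (?Xy k l v / ?u v - ?y v * ?Xu k l v / (?u v)^2)) * ?Xy k l v \<partial>SN N)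
      + (\<integral>v. (- 2 * ?y v * ?Xy k l v / (?u v)^2 + 2 * (?y v)^2 * ?Xu k l v / (?u v)^3) * ?Xu k l v \<partial>SN N)
      = (\<integral>v. 2 * ((?Xy k l v - ?y v * ?Xu k l v / ?u v)^2 / ?u v) \<partial>SN N)"
    proof (subst Bochner_Integration.integral_add[symmetric])
      show "integrable (SN N) (\<lambda>v. (2 * (?Xy k l v / ?u v - ?y v * ?Xu k l v / (?u v)^2)) * ?Xy k l v)"
        "integrable (SN N) (\<lambda>v. (- 2 * ?y v * ?Xy k l v / (?u v)^2 + 2 * (?y v)^2 * ?Xu k l v / (?u v)^3) * ?Xu k l v)"
        by (intro SN.cont_integrable continuous_on_mult[OF c(3)[folded space_SN]]
          continuous_on_mult[OF c(4)[folded space_SN]] continuous_intros)+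
      show "(\<integral>v. (2 * (?Xy k l v / ?u v - ?y v * ?Xu k l v / (?u v)^2)) * ?Xy k l v +
         (- 2 * ?y v * ?Xy k l v / (?u v)^2 + 2 * (?y v)^2 * ?Xu k l v / (?u v)^3) * ?Xu k l v \<partial>SN N)
        = (\<integral>v. 2 * ((?Xy k l v - ?y v * ?Xu k l v / ?u v)^2 / ?u v) \<partial>SN N)"
      proof (rule Bochner_Integration.integral_cong[OF refl])
        fix v assume "v \<in> space (SN N)"
        then have "?u v \<noteq> 0" using p[OF t] by (auto simp: space_SN)
        then show "(2 * (?Xy k l v / ?u v - ?y v * ?Xu k l v / (?u v)^2)) * ?Xy k l v +
         (- 2 * ?y v * ?Xy k l v / (?u v)^2 + 2 * (?y v)^2 * ?Xu k l v / (?u v)^3) * ?Xu k l v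
         = 2 * ((?Xy k l v - ?y v * ?Xu k l v / ?u v)^2 / ?u v)"
          by (simp add: field_simps power2_eq_square power3_eq_cube)
      qed
    qed
    then show "(\<integral>v. (2 * (?Xy k l v / ?u v - ?y v * ?Xu k l v / (?u v)^2)) * ?Xy k l v \<partial>SN N)
      + (\<integral>v. (- 2 * ?y v * ?Xy k l v / (?u v)^2 + 2 * (?y v)^2 * ?Xu k l v / (?u v)^3) * ?Xu k l v \<partial>SN N)
      = 2 * (\<integral>v. (?Xy k l v - ?y v * ?Xu k l v / ?u v)^2 / ?u v \<partial>SN N)"
      by (simp only: Bochner_Integration.integral_mult_right_zero)
  qed
  finally show ?thesis unfolding y_def .
qed

end

section \<open>Curvature decay of gradient and Fisher information; the logarithmic Sobolev
  inequality\<close>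

lemma nonincreasing_within:
  fixes f f' :: "real \<Rightarrow> real"
  assumes "\<And>x. x \<in> {a..b} \<Longrightarrow> (f has_real_derivative f' x) (at x within {a..b})"
    and "\<And>x. x \<in> {a..b} \<Longrightarrow> f' x \<le> 0" and "a \<le> b"
  shows "f b \<le> f a"
proof (cases "a = b")
  case False
  then have "a < b" using assms(3) by simp
  then obtain x where "x \<in> {a<..<b}" "f b - f a = f' x * (b - a)"
    using mvt_simple[of a b f "\<lambda>x. (*) (f' x)"] assms(1) unfolding has_field_derivative_def by auto
  moreover from this have "f' x * (b - a) \<le> 0"
    using assms(2)[of x] \<open>a < b\<close> by (intro mult_nonpos_nonneg) auto
  ultimately show ?thesis by simp
qed simp

lemma rlap_sump_upt: "pev (rlap N (sump f [0..<n])) v = (\<Sum>i<n. pev (rlap N (f i)) v)"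
  by (simp add: rlap_sump interv_sum_list_conv_sum_set_nat atLeast0LessThan)

context heat
begin

definition I' :: "real \<Rightarrow> real" where
  "I' t = - (\<Sum>i<N. \<Sum>j<N. \<Sum>k<N. \<Sum>l<N. \<integral>v.
     (pev (X k l (X i j (u t))) v - pev (X i j (u t)) v * pev (X k l (u t)) v / pev (u t) v)^2 / pev (u t) v \<partial>SN N) / 2"

lemma I_deriv:
  assumes t: "t \<in> {0..T}"
  shows "(I has_real_derivative I' t) (at t within {0..T})"
proof -
  have "((\<lambda>t. (\<Sum>i<N. \<Sum>j<N. J i j t) / 2) has_real_derivative (\<Sum>i<N. \<Sum>j<N. - (\<Sum>k<N. \<Sum>l<N. \<integral>v.
     (pev (X k l (X i j (u t))) v - pev (X i j (u t)) v * pev (X k l (u t)) v / pev (u t) v)^2 / pev (u t) v \<partial>SN N)) / 2)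
     (at t within {0..T})"
    by (intro DERIV_cdivide DERIV_sum J_deriv[OF t]) auto
  then show ?thesis
    unfolding I'_def sum_negf by (simp add: I_def[abs_def])
qed

text \<open>The correction X i j u X k l u / u is symmetric in the two pairs. The array of
  differences therefore has the antisymmetric part of X k l (X i j u), and
  \<open>curvature_bound\<close> applies pointwise.\<close>

lemma I'_le:
  assumes t: "0 \<le> t"
  shows "I' t \<le> - (real N - 2) * I t"
proof -
  let ?u = "pev (u t)" and ?B = "\<lambda>i j. pev (X i j (u t))"
  let ?M = "\<lambda>k l i j v. pev (X k l (X i j (u t))) v - ?B i j v * ?B k l v / ?u v"
  have p: "?u v > 0" "?u v \<noteq> 0" if "v \<in> sph N" for v
    using u_pos[OF t that] by auto
  have iM: "integrable (SN N) (\<lambda>v. (?M k l i j v)^2 / ?u v)" for i j k l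
  proof -
    have "continuous_on (sph N) (\<lambda>v. (?M k l i j v)^2 / ?u v)"
      using p by (auto intro!: continuous_intros)
    then show ?thesis by (intro SN.cont_integrable) (simp only: space_SN)
  qed
  have iB: "integrable (SN N) (\<lambda>v. (?B i j v)^2 / ?u v)" for i j
  proof -
    have "continuous_on (sph N) (\<lambda>v. (?B i j v)^2 / ?u v)"
      using p by (auto intro!: continuous_intros)
    then show ?thesis by (intro SN.cont_integrable) (simp only: space_SN)
  qed
  have "(real N - 2) * (\<Sum>i<N. \<Sum>j<N. J i j t) = (\<integral>v. (real N - 2) * (\<Sum>i<N. \<Sum>j<N. (?B i j v)^2 / ?u v) \<partial>SN N)"
    using iB by (simp add: J_def Bochner_Integration.integral_sum)
  also have "\<dots> \<le> (\<integral>v. (\<Sum>i<N. \<Sum>j<N. \<Sum>k<N. \<Sum>l<N. (?M k l i j v)^2 / ?u v) \<partial>SN N)"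
  proof (rule integral_mono)
    fix v assume "v \<in> space (SN N)"
    then have v: "v \<in> sph N" by (simp add: space_SN)
    have "(real N - 2) * (\<Sum>i<N. \<Sum>j<N. (?B i j v)^2) \<le> (\<Sum>i<N. \<Sum>j<N. \<Sum>k<N. \<Sum>l<N. (?M k l i j v)^2)"
      by (rule curvature_bound[where M = "\<lambda>k l i j. ?M k l i j v"]) (simp add: mult.commute)
    from divide_right_mono[OF this less_imp_le[OF p(1)[OF v]]]
    show "(real N - 2) * (\<Sum>i<N. \<Sum>j<N. (?B i j v)^2 / ?u v) \<le> (\<Sum>i<N. \<Sum>j<N. \<Sum>k<N. \<Sum>l<N. (?M k l i j v)^2 / ?u v)"
      by (simp add: sum_divide_distrib sum_distrib_left)
  qed (intro Bochner_Integration.integrable_mult_right Bochner_Integration.integrable_sum iM iB)+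
  also have "\<dots> = (\<Sum>i<N. \<Sum>j<N. \<Sum>k<N. \<Sum>l<N. \<integral>v. (?M k l i j v)^2 / ?u v \<partial>SN N)"
    using iM by (simp add: Bochner_Integration.integral_sum)
  finally have "(real N - 2) * (\<Sum>i<N. \<Sum>j<N. J i j t) / 2 \<le>
     (\<Sum>i<N. \<Sum>j<N. \<Sum>k<N. \<Sum>l<N. \<integral>v. (?M k l i j v)^2 / ?u v \<partial>SN N) / 2"
    by (rule divide_right_mono) simp
  then show ?thesis
    unfolding I_def I'_def
    by (simp only: mult_minus_left minus_divide_left[symmetric] times_divide_eq_right neg_le_iff_le)
qed

lemma I_nonneg:
  assumes t: "0 \<le> t"
  shows "0 \<le> I t"
  unfolding I_def J_def
  using u_pos[OF t] by (intro divide_nonneg_pos sum_nonneg Bochner_Integration.integral_nonneg)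
    (auto simp: space_SN intro!: divide_nonneg_pos)

text \<open>The maximum principle for exp((N - 2) t) times the squared gradient: by
  \<open>curvature_bound\<close> the squares of second derivatives that the generator produces
  dominate the term from differentiating the exponential.\<close>

lemma gradient_decay:
  obtains G where "\<And>t v. 0 \<le> t \<Longrightarrow> v \<in> sph N \<Longrightarrow>
    (\<Sum>i<N. \<Sum>j<N. (pev (X i j (u t)) v)^2) \<le> G * exp (- (real N - 2) * t)"
proof -
  define Q where "Q = (\<lambda>t. sump (\<lambda>i. sump (\<lambda>j. Mul (X i j (u t)) (X i j (u t))) [0..<N]) [0..<N])"
  have tQ: "time_pol Q" unfolding Q_def by (intro time_pol_sump time_pol_Mul time_pol_X time_pol_u)
  have evQ: "pev (Q t) v = (\<Sum>i<N. \<Sum>j<N. (pev (X i j (u t)) v)^2)" for t v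
    by (simp add: Q_def power2_eq_square)
  let ?p = "\<lambda>t. Mul (C (exp ((real N - 2) * t))) (Q t)"
  have c: "continuous_on (sph N) (pev (Q 0))" by (intro continuous_intros)
  obtain G where G': "\<And>v. v \<in> sph N \<Longrightarrow> norm (pev (Q 0) v) \<le> G"
    using compact_imp_bounded[OF compact_continuous_image[OF c compact_sph]] unfolding bounded_iff by auto
  have G: "pev (Q 0) v \<le> G" if "v \<in> sph N" for v using G'[OF that] by simp
  have "pev (?p t) v \<le> G" if t: "0 \<le> t" and v: "v \<in> sph N" for t v
  proof (rule max_principle[where N = N and T = t and p = ?p and v = v and p' = "\<lambda>t v. exp ((real N - 2) * t) *
       ((real N - 2) * (\<Sum>i<N. \<Sum>j<N. (pev (X i j (u t)) v)^2) +
        (\<Sum>i<N. \<Sum>j<N. 2 * pev (X i j (u t)) v * pev (rlap N (X i j (u t))) v))"])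
    show "time_pol ?p" by (intro time_pol_Mul time_pol_C tQ continuous_intros)
  next
    fix s v
    have dB: "((\<lambda>t. (pev (X i j (u t)) v)^2) has_real_derivative 2 * pev (X i j (u s)) v * pev (rlap N (X i j (u s))) v) (at s)"
      if "i < N" "j < N" for i j
      by (auto intro!: derivative_eq_intros d_Xu that)
    have "((\<lambda>t. pev (Q t) v) has_real_derivative (\<Sum>i<N. \<Sum>j<N. 2 * pev (X i j (u s)) v * pev (rlap N (X i j (u s))) v)) (at s)"
      unfolding evQ by (intro DERIV_sum dB) auto
    then have "((\<lambda>t. exp ((real N - 2) * t) * pev (Q t) v) has_real_derivative
       exp ((real N - 2) * s) * (real N - 2) * pev (Q s) v + exp ((real N - 2) * s) * (\<Sum>i<N. \<Sum>j<N. 2 * pev (X i j (u s)) v * pev (rlap N (X i j (u s))) v)) (at s)"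
      by (auto intro!: derivative_eq_intros)
    then show "((\<lambda>t. pev (?p t) v) has_real_derivative exp ((real N - 2) * s) *
       ((real N - 2) * (\<Sum>i<N. \<Sum>j<N. (pev (X i j (u s)) v)^2) +
        (\<Sum>i<N. \<Sum>j<N. 2 * pev (X i j (u s)) v * pev (rlap N (X i j (u s))) v))) (at s)"
      by (simp add: evQ distrib_left mult.assoc)
  next
    fix s v
    have "(real N - 2) * (\<Sum>i<N. \<Sum>j<N. (pev (X i j (u s)) v)^2) \<le> (\<Sum>i<N. \<Sum>j<N. \<Sum>k<N. \<Sum>l<N. (pev (X k l (X i j (u s))) v)^2)"
      by (rule curvature_bound[where M = "\<lambda>k l i j. pev (X k l (X i j (u s))) v"]) simp
    moreover have "pev (rlap N (?p s)) v = exp ((real N - 2) * s) * (\<Sum>i<N. \<Sum>j<N. 2 * pev (X i j (u s)) v * pev (rlap N (X i j (u s))) v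
        + (\<Sum>k<N. \<Sum>l<N. (pev (X k l (X i j (u s))) v)^2))"
      by (simp add: rlap_scale Q_def rlap_sump_upt rlap_square)
    ultimately show "exp ((real N - 2) * s) *
       ((real N - 2) * (\<Sum>i<N. \<Sum>j<N. (pev (X i j (u s)) v)^2) +
        (\<Sum>i<N. \<Sum>j<N. 2 * pev (X i j (u s)) v * pev (rlap N (X i j (u s))) v)) \<le> pev (rlap N (?p s)) v"
      by (simp add: sum.distrib)
  next
    fix v assume "v \<in> sph N"
    then show "pev (?p 0) v \<le> G" using G by simp
  qed (use t v in auto)
  then have "pev (Q t) v \<le> G * exp (- (real N - 2) * t)" if "0 \<le> t" "v \<in> sph N" for t v
    using that by (simp add: exp_minus field_simps exp_diff)
  then show thesis using that unfolding evQ by blast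
qed

definition ub :: real where "ub = (\<integral>v. pev (u 0) v \<partial>SN N)"

text \<open>Entropy relative to the mean \<open>ub\<close>, which the flow preserves by
  \<open>mass\<close>.\<close>

definition Hrel :: "real \<Rightarrow> real" where "Hrel t = H t - ub * ln ub"

lemma ub_pos: "ub > 0"
proof -
  have "m = (\<integral>v. m \<partial>SN N)" by (simp add: SN.prob_space)
  also have "\<dots> \<le> ub" unfolding ub_def
    using init by (intro integral_mono SN.cont_integrable continuous_intros) (auto simp: space_SN)
  finally show ?thesis using m by simp
qed

text \<open>The inequality ln x \<le> x - 1 at x = u / ub turns a small oscillation into a small
  relative entropy.\<close>

lemma Hrel_le_osc:
  assumes t: "0 \<le> t" and o: "\<And>v w. v \<in> sph N \<Longrightarrow> w \<in> sph N \<Longrightarrow> \<bar>pev (u t) v - pev (u t) w\<bar> \<le> c"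
  shows "Hrel t \<le> c"
proof -
  have iu: "integrable (SN N) (pev (u t))" by (intro SN.cont_integrable continuous_intros)
  have mt: "(\<integral>v. pev (u t) v \<partial>SN N) = ub" by (simp add: ub_def mass[OF t])
  have iH: "integrable (SN N) (\<lambda>v. pev (u t) v * ln (pev (u t) v))"
    using u_pos[OF t] by (intro SN.cont_integrable continuous_intros) (force simp: space_SN)+
  have close: "pev (u t) v - ub \<le> c" if v: "v \<in> sph N" for v
  proof -
    have "pev (u t) v - c = (\<integral>w. pev (u t) v - c \<partial>SN N)" by (simp add: SN.prob_space)
    also have "\<dots> \<le> (\<integral>w. pev (u t) w \<partial>SN N)"
    proof (rule integral_mono[OF _ iu])
      fix w assume "w \<in> space (SN N)"
      then show "pev (u t) v - c \<le> pev (u t) w" using o[OF v, of w] by (auto simp: space_SN)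
    qed simp
    finally show ?thesis using mt by simp
  qed
  have "H t - ub * ln ub = (\<integral>v. pev (u t) v * ln (pev (u t) v) - pev (u t) v * ln ub \<partial>SN N)"
    using iH iu mt by (simp add: H_def)
  also have "\<dots> \<le> (\<integral>v. c / ub * pev (u t) v \<partial>SN N)"
  proof (rule integral_mono)
    fix v assume "v \<in> space (SN N)"
    then have v: "v \<in> sph N" by (simp add: space_SN)
    have p: "pev (u t) v > 0" by (rule u_pos[OF t v])
    have "ln (pev (u t) v) - ln ub \<le> pev (u t) v / ub - 1"
      using ln_le_minus_one[of "pev (u t) v / ub"] p ub_pos by (simp add: ln_div)
    also have "\<dots> \<le> c / ub"
      using divide_right_mono[OF close[OF v], of ub] ub_pos by (simp add: diff_divide_distrib)
    finally have "pev (u t) v * (ln (pev (u t) v) - ln ub) \<le> pev (u t) v * (c / ub)"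
      using p by (intro mult_left_mono) auto
    then show "pev (u t) v * ln (pev (u t) v) - pev (u t) v * ln ub \<le> c / ub * pev (u t) v"
      by (simp add: algebra_simps)
  qed (use iH iu in auto)
  also have "\<dots> = c" using mt ub_pos by simp
  finally show ?thesis by (simp add: Hrel_def)
qed

text \<open>The gradient decays uniformly and every point is within bounded rotation distance of the
  pole, so the oscillation tends to 0. N \<ge> 3 makes the rate N - 2 at least 1.\<close>

lemma Hrel_tendsto:
  assumes N3: "3 \<le> N" and e: "0 < e"
  shows "\<exists>T0\<ge>0. \<forall>T\<ge>T0. Hrel T \<le> e"
proof -
  obtain G where G: "\<And>t v. 0 \<le> t \<Longrightarrow> v \<in> sph N \<Longrightarrow>
    (\<Sum>i<N. \<Sum>j<N. (pev (X i j (u t)) v)^2) \<le> G * exp (- (real N - 2) * t)"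
    using gradient_decay by blast
  have bound: "Hrel t \<le> 2 * (sqrt (G * exp (- t)) * (2 * real N + 2))" if t: "0 \<le> t" "sph N \<noteq> {}" for t
  proof (rule Hrel_le_osc[OF t(1)])
    obtain v0 where "v0 \<in> sph N" using t by auto
    have "0 \<le> (\<Sum>i<N. \<Sum>j<N. (pev (X i j (u t)) v0)^2)" by (intro sum_nonneg) auto
    then have "0 \<le> G * exp (- (real N - 2) * t)" using G[OF t(1) \<open>v0 \<in> sph N\<close>] by linarith
    then have G0: "G \<ge> 0" by (simp add: zero_le_mult_iff)
    have K: "\<bar>pev (X i j (u t)) v\<bar> \<le> sqrt (G * exp (- t))" if "i < N" "j < N" "i \<noteq> j" "v \<in> sph N" for i j v
    proof (rule real_le_rsqrt)
      have "(pev (X i j (u t)) v)^2 \<le> (\<Sum>j<N. (pev (X i j (u t)) v)^2)"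
        using that by (intro member_le_sum) auto
      also have "\<dots> \<le> (\<Sum>i<N. \<Sum>j<N. (pev (X i j (u t)) v)^2)"
        using that by (intro member_le_sum[of i "{..<N}" "\<lambda>i. \<Sum>j<N. (pev (X i j (u t)) v)^2"] sum_nonneg) auto
      also have "\<dots> \<le> G * exp (- (real N - 2) * t)" by (rule G[OF t(1) that(4)])
      also have "\<dots> \<le> G * exp (- t)"
      proof -
        have "1 * t \<le> (real N - 2) * t" using N3 t(1) by (intro mult_right_mono) auto
        then have "- (real N - 2) * t \<le> - t" by (simp only: mult_1 mult_minus_left neg_le_iff_le)
        then show ?thesis using G0 by (intro mult_left_mono) auto
      qed
      finally show "\<bar>pev (X i j (u t)) v\<bar>\<^sup>2 \<le> G * exp (- t)" by simp
    qed
    fix v w assume "v \<in> sph N" "w \<in> sph N"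
    from pole_distance[OF N K this(1)] pole_distance[OF N K this(2)]
    show "\<bar>pev (u t) v - pev (u t) w\<bar> \<le> 2 * (sqrt (G * exp (- t)) * (2 * real N + 2))" by linarith
  qed
  have ne: "sph N \<noteq> {}" using SN.not_empty by (simp add: space_SN)
  have "((\<lambda>t. 2 * (sqrt (G * exp (- t)) * (2 * real N + 2))) \<longlongrightarrow> 2 * (sqrt (G * 0) * (2 * real N + 2))) at_top"
    by (intro tendsto_intros filterlim_compose[OF exp_at_bot] filterlim_uminus_at_bot_at_top)
  then have "\<forall>\<^sub>F t in at_top. 2 * (sqrt (G * exp (- t)) * (2 * real N + 2)) < e"
    using e by (intro order_tendstoD(2)) auto
  then obtain T0 where "\<And>t. t \<ge> T0 \<Longrightarrow> 2 * (sqrt (G * exp (- t)) * (2 * real N + 2)) < e"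
    unfolding eventually_at_top_linorder by blast
  then have "\<forall>T\<ge>max T0 0. Hrel T \<le> e" using bound[OF _ ne] by (meson less_imp_le max.bounded_iff order_trans)
  then show ?thesis by (intro exI[of _ "max T0 0"]) auto
qed

lemma Hrel_deriv: "t \<in> {0..T} \<Longrightarrow> (Hrel has_real_derivative - I t) (at t within {0..T})"
  unfolding Hrel_def by (auto intro!: derivative_eq_intros H_deriv)

text \<open>The Bakry-Emery argument: since Hrel' = - I and I' \<le> - (N - 2) I, the difference I -
  (N - 2) Hrel is nonincreasing, and at late times it is at least - e.\<close>

lemma log_sobolev:
  assumes N3: "3 \<le> N" and s: "0 \<le> s"
  shows "(real N - 2) * Hrel s \<le> I s"
proof (rule field_le_epsilon)
  fix e :: real assume e: "0 < e"
  define d where "d = e / (real N - 2)"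
  have d: "d > 0" using e N3 by (simp add: d_def)
  obtain T0 where T0: "T0 \<ge> 0" "\<And>T. T \<ge> T0 \<Longrightarrow> Hrel T \<le> d" using Hrel_tendsto[OF N3 d] by auto
  define T where "T = max T0 s"
  have T: "s \<le> T" "Hrel T \<le> d" using T0 by (auto simp: T_def)
  have "I T - (real N - 2) * Hrel T \<le> I s - (real N - 2) * Hrel s"
  proof (rule nonincreasing_within[OF _ _ T(1)])
    fix x assume x: "x \<in> {s..T}"
    have "((\<lambda>t. I t - (real N - 2) * Hrel t) has_real_derivative I' x - (real N - 2) * (- I x)) (at x within {0..T})"
      using x s by (intro DERIV_diff DERIV_cmult I_deriv Hrel_deriv) auto
    then show "((\<lambda>t. I t - (real N - 2) * Hrel t) has_real_derivative I' x - (real N - 2) * (- I x)) (at x within {s..T})"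
      by (rule DERIV_subset) (use s in auto)
    have "0 \<le> x" using x s by simp
    from I'_le[OF this] show "I' x - (real N - 2) * (- I x) \<le> 0"
      by (simp only: mult_minus_left mult_minus_right diff_minus_eq_add)
  qed
  moreover have "(real N - 2) * Hrel T \<le> e"
    using mult_left_mono[OF T(2), of "real N - 2"] N3 by (simp add: d_def)
  moreover have "0 \<le> I T" using T s by (intro I_nonneg) auto
  ultimately show "(real N - 2) * Hrel s \<le> I s + e" by linarith
qed

end

section \<open>The dissipation of the entropy production\<close>

definition TH :: "real measure" where
  "TH = density (restrict_space lborel {0..2*pi}) (\<lambda>_. ennreal (1 / (2*pi)))"

lemma space_TH: "space TH = {0..2*pi}"
  by (simp add: TH_def space_restrict_space)

lemma sets_TH: "sets TH = sets (restrict_space borel {0..2*pi})"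
  by (simp add: TH_def sets_restrict_space)

lemma prob_space_TH: "prob_space TH"
proof
  have "emeasure TH (space TH) = ennreal (1 / (2*pi)) * emeasure (restrict_space lborel {0..2*pi}) {0..2*pi}"
    unfolding space_TH unfolding TH_def
    by (rule emeasure_density_const) (simp add: sets_restrict_space_iff)
  also have "\<dots> = ennreal (1 / (2*pi)) * ennreal (2*pi)"
    by (simp add: emeasure_restrict_space)
  also have "\<dots> = 1"
    by (simp add: ennreal_mult[symmetric])
  finally show "emeasure TH (space TH) = 1" .
qed

lemma integral_TH:
  assumes "g \<in> borel_measurable (restrict_space borel {0..2*pi})"
  shows "(\<integral>\<theta>. g \<theta> \<partial>TH) = (LINT \<theta>:{0..2*pi}|lborel. g \<theta>) / (2*pi)"
proof -
  have "(\<integral>\<theta>. g \<theta> \<partial>TH) = (\<integral>\<theta>. (1 / (2*pi)) *\<^sub>R g \<theta> \<partial>restrict_space lborel {0..2*pi})"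
    unfolding TH_def using assms by (intro integral_density) (auto cong: measurable_cong_sets sets_restrict_space_cong)
  also have "\<dots> = (LINT \<theta>:{0..2*pi}|lborel. g \<theta>) / (2*pi)"
    by (simp add: integral_restrict_space set_lebesgue_integral_def)
  finally show ?thesis .
qed

lemma integral_TH_deriv:
  assumes "\<And>\<theta>. (F has_real_derivative f \<theta>) (at \<theta>)" "continuous_on {0..2*pi} f" "F (2*pi) = F 0"
  shows "(\<integral>\<theta>. f \<theta> \<partial>TH) = 0"
proof -
  have "(LINT \<theta>:{0..2*pi}|lborel. f \<theta>) = F (2*pi) - F 0"
    unfolding set_lebesgue_integral_def
    using assms by (intro integral_FTC_atLeastAtMost)
      (auto simp: has_real_derivative_iff_has_vector_derivative[symmetric] intro: DERIV_subset)
  then show ?thesis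
    using assms(2,3) by (subst integral_TH) (auto intro: borel_measurable_continuous_on_restrict)
qed

text \<open>Pairs of a velocity and an independent uniform angle. Continuous integrands are
  integrable on this compact product, so Fubini is available in both orders.\<close>

definition PM :: "nat \<Rightarrow> ((nat \<Rightarrow> real) \<times> real) measure" where
  "PM N = SN N \<Otimes>\<^sub>M TH"

lemma space_PM: "space (PM N) = sph N \<times> {0..2*pi}"
  by (simp add: PM_def space_pair_measure space_SN space_TH)

lemma pair_prob_space_PM: "0 < N \<Longrightarrow> pair_prob_space (SN N) TH"
  using prob_space_SN prob_space_TH
  by (simp add: pair_prob_space_def pair_sigma_finite_def prob_space_imp_sigma_finite)

lemma measurable_snd_PM: "snd \<in> borel_measurable (PM N)"
proof -
  have "(\<lambda>x. x) \<in> borel_measurable TH"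
    using measurable_cong_sets[OF sets_TH refl] measurable_restrict_space1[OF measurable_ident_sets[OF refl]] by (auto simp: id_def)
  then show ?thesis
    unfolding PM_def by (rule measurable_compose[OF measurable_snd])
qed

lemma compact_measure_PM:
  assumes "0 < N"
  shows "compact_measure (PM N)"
proof -
  interpret pair_prob_space "SN N" TH by (rule pair_prob_space_PM[OF assms])
  interpret Q: prob_space "PM N" unfolding PM_def by (rule P.prob_space_axioms)
  show ?thesis
  proof
    show "compact (space (PM N))" by (simp add: space_PM compact_sph compact_Times)
    fix f :: "(nat \<Rightarrow> real) \<times> real \<Rightarrow> real" assume "continuous_on (space (PM N)) f"
    then have f: "f \<in> borel_measurable (restrict_space borel (sph N \<times> {0..2*pi}))"
      unfolding space_PM by (rule borel_measurable_continuous_on_restrict)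
    have 1: "fst \<in> measurable (PM N) (borel :: (nat \<Rightarrow> real) measure)"
      unfolding PM_def by (rule measurable_compose[OF measurable_fst measurable_SN1[OF id_measurable_bor]])
    note 2 = measurable_snd_PM[of N]
    have "(\<lambda>x. x) \<in> measurable (PM N) (restrict_space borel (sph N \<times> {0..2*pi}))"
    proof (rule measurable_restrict_space2)
      show "(\<lambda>x. x) \<in> space (PM N) \<rightarrow> sph N \<times> {0..2*pi}" by (simp add: space_PM)
      show "(\<lambda>x. x) \<in> borel_measurable (PM N)"
        using measurable_Pair[OF 1 2] by (simp add: borel_prod)
    qed
    from measurable_compose[OF this f] show "f \<in> borel_measurable (PM N)" .
  qed
qed

lemma integral_PM_fst:
  fixes f :: "_ \<Rightarrow> real"
  assumes "0 < N" "integrable (PM N) f"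
  shows "(\<integral>v. (\<integral>\<theta>. f (v, \<theta>) \<partial>TH) \<partial>SN N) = (\<integral>x. f x \<partial>PM N)"
proof -
  interpret pair_prob_space "SN N" TH by (rule pair_prob_space_PM[OF assms(1)])
  show ?thesis using integral_fst'[of f] assms(2) by (simp add: PM_def)
qed

lemma integral_PM_snd:
  fixes f :: "_ \<Rightarrow> real"
  assumes "0 < N" "integrable (PM N) f"
  shows "(\<integral>\<theta>. (\<integral>v. f (v, \<theta>) \<partial>SN N) \<partial>TH) = (\<integral>x. f x \<partial>PM N)"
    and "integrable TH (\<lambda>\<theta>. \<integral>v. f (v, \<theta>) \<partial>SN N)"
proof -
  interpret pair_prob_space "SN N" TH by (rule pair_prob_space_PM[OF assms(1)])
  show "(\<integral>\<theta>. (\<integral>v. f (v, \<theta>) \<partial>SN N) \<partial>TH) = (\<integral>x. f x \<partial>PM N)"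
    using integral_snd[of "\<lambda>x y. f (x, y)"] assms(2) by (simp add: PM_def case_prod_eta)
  show "integrable TH (\<lambda>\<theta>. \<integral>v. f (v, \<theta>) \<partial>SN N)"
    using integrable_snd[of "\<lambda>x y. f (x, y)"] assms(2) by (simp add: PM_def case_prod_eta)
qed

lemma integral_PM_mono_snd:
  fixes f g :: "_ \<Rightarrow> real"
  assumes "0 < N" "integrable (PM N) f" "integrable (PM N) g"
    "\<And>\<theta>. \<theta> \<in> {0..2*pi} \<Longrightarrow> (\<integral>v. f (v, \<theta>) \<partial>SN N) \<le> (\<integral>v. g (v, \<theta>) \<partial>SN N)"
  shows "(\<integral>x. f x \<partial>PM N) \<le> (\<integral>x. g x \<partial>PM N)"
  unfolding integral_PM_snd(1)[OF assms(1,2), symmetric] integral_PM_snd(1)[OF assms(1,3), symmetric]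
  by (intro integral_mono integral_PM_snd(2) assms) (auto simp: space_TH assms(4))

text \<open>Removing the radial component of W does not change v_j W_i - v_i W_j. For the remainder
  Z, Cauchy-Schwarz in the (i,j)-plane gives the factor v_i^2 + v_j^2, and N |Z|^2 equals the halved
  double sum by Lagrange's identity.\<close>

lemma bivector_bound:
  fixes v W :: "nat \<Rightarrow> real"
  assumes ij: "i < N" "j < N" "i \<noteq> j" and v: "sqnorm N v = N"
  shows "N * (v j * W i - v i * W j)^2 \<le> ((v i)^2 + (v j)^2) * ((\<Sum>k<N. \<Sum>l<N. (v l * W k - v k * W l)^2) / 2)"
proof -
  define A where "A = (\<Sum>k<N. (W k)^2)"
  define B where "B = (\<Sum>k<N. v k * W k)"
  have N0: "real N > 0" using ij by simp
  have v2: "(\<Sum>k<N. (v k)^2) = N" using v by (simp add: sqnorm_def)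
  have "(\<Sum>k<N. \<Sum>l<N. (v l * W k - v k * W l)^2) =
      (\<Sum>k<N. \<Sum>l<N. (W k)^2 * (v l)^2 + (v k)^2 * (W l)^2 - 2 * ((v k * W k) * (v l * W l)))"
    by (intro sum.cong refl) (simp add: power2_eq_square algebra_simps)
  also have "\<dots> = A * N + N * A - 2 * (B * B)"
    unfolding sum.distrib sum_subtractf sum_distrib_left[symmetric] sum_distrib_right[symmetric]
      A_def B_def v2[symmetric] ..
  finally have S: "(\<Sum>k<N. \<Sum>l<N. (v l * W k - v k * W l)^2) / 2 = N * A - B^2"
    by (simp add: power2_eq_square)
  define Z where "Z = (\<lambda>k. W k - B / N * v k)"
  have "(\<Sum>k<N. (Z k)^2) = (\<Sum>k<N. (W k)^2 - 2 * (B / N) * (v k * W k) + (B / N)^2 * (v k)^2)"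
    unfolding Z_def by (intro sum.cong refl) (simp add: power2_eq_square algebra_simps)
  also have "\<dots> = A - 2 * (B / N) * B + (B / N)^2 * N"
    unfolding sum.distrib sum_subtractf sum_distrib_left[symmetric] A_def B_def v2 ..
  finally have Z: "N * (\<Sum>k<N. (Z k)^2) = N * A - B^2"
    using N0 by (simp add: power2_eq_square field_simps)
  have "v j * W i - v i * W j = v j * Z i - v i * Z j"
    by (simp add: Z_def algebra_simps)
  also have "(v j * Z i - v i * Z j)^2 \<le> ((v i)^2 + (v j)^2) * ((Z i)^2 + (Z j)^2)"
  proof -
    have "((v i)^2 + (v j)^2) * ((Z i)^2 + (Z j)^2) = (v j * Z i - v i * Z j)^2 + (v i * Z i + v j * Z j)^2"
      by (simp add: power2_eq_square algebra_simps)
    then show ?thesis by simp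
  qed
  also have "\<dots> \<le> ((v i)^2 + (v j)^2) * (\<Sum>k<N. (Z k)^2)"
  proof (rule mult_left_mono)
    show "(Z i)^2 + (Z j)^2 \<le> (\<Sum>k<N. (Z k)^2)"
      unfolding sum_split_two[OF ij(3,1,2)] by (simp add: sum_nonneg)
  qed simp
  finally have "N * (v j * W i - v i * W j)^2 \<le> N * (((v i)^2 + (v j)^2) * (\<Sum>k<N. (Z k)^2))"
    using N0 by simp
  also have "\<dots> = ((v i)^2 + (v j)^2) * (N * A - B^2)"
    unfolding Z[symmetric] by (simp add: mult_ac)
  finally show ?thesis unfolding S .
qed

lemma psi_pos: "0 < x \<Longrightarrow> 0 < y \<Longrightarrow> psi x y = (x - y) * (ln x - ln y)"
  by (simp add: psi_def ln_div)

lemma psi_nonneg: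
  assumes "0 < x" "0 < y" shows "0 \<le> psi x y"
proof (cases "x \<le> y")
  case True
  then have "ln x \<le> ln y" using assms by simp
  then show ?thesis using True assms by (simp add: psi_pos mult_nonpos_nonpos)
next
  case False
  then have "ln y \<le> ln x" using assms by simp
  then show ?thesis using False assms by (simp add: psi_pos)
qed

text \<open>The partial derivative of \<open>psi\<close> in its first argument; by symmetry
  \<open>dpsi1 y x\<close> is the one in the second.\<close>

definition dpsi1 :: "real \<Rightarrow> real \<Rightarrow> real" where "dpsi1 x y = ln x - ln y + 1 - y / x"

text \<open>\<open>psi\<close> is homogeneous of degree one, so its Hessian degenerates along
  scaling: on (da, db) it is (a + b) (da/a - db/b)^2. Integration by parts leaves this square; the
  terms in which w is differentiated form the derivative of \<open>psi\<close> and are integrated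
  back onto w.\<close>

lemma psi_dissipation:
  assumes N: "0 < N" and a: "\<And>v. v \<in> sph N \<Longrightarrow> 0 < pev a v" and b: "\<And>v. v \<in> sph N \<Longrightarrow> 0 < pev b v"
  shows "(\<integral>v. pev w v * dpsi1 (pev a v) (pev b v) * pev (rlap N a) v \<partial>SN N)
       + (\<integral>v. pev w v * dpsi1 (pev b v) (pev a v) * pev (rlap N b) v \<partial>SN N)
    = - (\<Sum>k<N. \<Sum>l<N. \<integral>v. pev w v * (pev a v + pev b v) * (pev (X k l a) v / pev a v - pev (X k l b) v / pev b v)^2 \<partial>SN N) / 2
      + (\<integral>v. ((pev a v - pev b v) * (ln (pev a v) - ln (pev b v))) * pev (rlap N w) v \<partial>SN N)"
proof -
  interpret compact_measure "SN N" by (rule compact_measure_SN[OF N])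
  have nz: "pev a v \<noteq> 0" "pev b v \<noteq> 0" if "v \<in> sph N" for v
    using a[OF that] b[OF that] by auto
  have pos: "\<And>x. x \<in> sph N \<Longrightarrow> 0 < pev a x \<and> 0 < pev b x" using a b by auto
  let ?a = "pev a" and ?b = "pev b" and ?w = "pev w"
  let ?Xa = "\<lambda>k l. pev (X k l a)" and ?Xb = "\<lambda>k l. pev (X k l b)" and ?Xw = "\<lambda>k l. pev (X k l w)"
  define g1 where "g1 k l v = ?Xw k l v * dpsi1 (?a v) (?b v) +
     ?w v * (?Xa k l v * (1 / ?a v + ?b v / (?a v)^2) - ?Xb k l v * (1 / ?a v + 1 / ?b v))" for k l v
  define g2 where "g2 k l v = ?Xw k l v * dpsi1 (?b v) (?a v) +
     ?w v * (?Xb k l v * (1 / ?b v + ?a v / (?b v)^2) - ?Xa k l v * (1 / ?a v + 1 / ?b v))" for k l v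
  define g3 where "g3 k l v = dpsi1 (?a v) (?b v) * ?Xa k l v + dpsi1 (?b v) (?a v) * ?Xb k l v" for k l v
  have c: "continuous_on (sph N) (\<lambda>v. dpsi1 (?a v) (?b v))" "continuous_on (sph N) (\<lambda>v. dpsi1 (?b v) (?a v))"
    unfolding dpsi1_def using nz pos by (auto intro!: continuous_intros)
  have cg: "continuous_on (sph N) (g1 k l)" "continuous_on (sph N) (g2 k l)" "continuous_on (sph N) (g3 k l)" for k l
    unfolding g1_def g2_def g3_def using nz by (auto intro!: continuous_intros c)
  have ln_d: "((\<lambda>\<theta>. ln (?a (rot k l \<theta> v))) has_real_derivative ?Xa k l v / ?a v) (at 0)"
    "((\<lambda>\<theta>. ln (?b (rot k l \<theta> v))) has_real_derivative ?Xb k l v / ?b v) (at 0)" if "v \<in> sph N" "k \<noteq> l" for k l v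
    using pos[OF that(1)] that(2) by (auto intro!: derivative_eq_intros rot_deriv)
  have d1: "((\<lambda>\<theta>. dpsi1 (?a (rot k l \<theta> v)) (?b (rot k l \<theta> v))) has_real_derivative
      ?Xa k l v * (1 / ?a v + ?b v / (?a v)^2) - ?Xb k l v * (1 / ?a v + 1 / ?b v)) (at 0)"
    "((\<lambda>\<theta>. dpsi1 (?b (rot k l \<theta> v)) (?a (rot k l \<theta> v))) has_real_derivative
      ?Xb k l v * (1 / ?b v + ?a v / (?b v)^2) - ?Xa k l v * (1 / ?a v + 1 / ?b v)) (at 0)"
    if "v \<in> sph N" "k \<noteq> l" for k l v
    unfolding dpsi1_def using pos[OF that(1)] that(2)
    by (auto intro!: derivative_eq_intros ln_d rot_deriv that(1) simp: field_simps power2_eq_square)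
  have 1: "(\<integral>v. ?w v * dpsi1 (?a v) (?b v) * pev (rlap N a) v \<partial>SN N) = - (\<Sum>k<N. \<Sum>l<N. \<integral>v. g1 k l v * ?Xa k l v \<partial>SN N) / 2"
  proof (rule ibp_L[OF _ _ cg(1) N])
    fix k l :: nat and v assume "k \<noteq> l" "v \<in> sph N"
    then show "((\<lambda>\<theta>. ?w (rot k l \<theta> v) * dpsi1 (?a (rot k l \<theta> v)) (?b (rot k l \<theta> v))) has_real_derivative g1 k l v) (at 0)"
      unfolding g1_def by (auto intro!: derivative_eq_intros d1 rot_deriv)
  qed (intro continuous_intros c)
  have 2: "(\<integral>v. ?w v * dpsi1 (?b v) (?a v) * pev (rlap N b) v \<partial>SN N) = - (\<Sum>k<N. \<Sum>l<N. \<integral>v. g2 k l v * ?Xb k l v \<partial>SN N) / 2"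
  proof (rule ibp_L[OF _ _ cg(2) N])
    fix k l :: nat and v assume "k \<noteq> l" "v \<in> sph N"
    then show "((\<lambda>\<theta>. ?w (rot k l \<theta> v) * dpsi1 (?b (rot k l \<theta> v)) (?a (rot k l \<theta> v))) has_real_derivative g2 k l v) (at 0)"
      unfolding g2_def by (auto intro!: derivative_eq_intros d1 rot_deriv)
  qed (intro continuous_intros c)
  have 3: "(\<integral>v. ((?a v - ?b v) * (ln (?a v) - ln (?b v))) * pev (rlap N w) v \<partial>SN N) = - (\<Sum>k<N. \<Sum>l<N. \<integral>v. g3 k l v * ?Xw k l v \<partial>SN N) / 2"
  proof (rule ibp_L[OF _ _ cg(3) N])
    fix k l :: nat and v assume "k \<noteq> l" "v \<in> sph N"
    then show "((\<lambda>\<theta>. (?a (rot k l \<theta> v) - ?b (rot k l \<theta> v)) * (ln (?a (rot k l \<theta> v)) - ln (?b (rot k l \<theta> v)))) has_real_derivative g3 k l v) (at 0)"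
      unfolding g3_def dpsi1_def using nz[of v] pos[of v]
      by (auto intro!: derivative_eq_intros ln_d rot_deriv simp: field_simps)
  qed (use pos nz in \<open>auto intro!: continuous_intros\<close>)
  let ?d = "\<lambda>k l v. ?w v * (?a v + ?b v) * (?Xa k l v / ?a v - ?Xb k l v / ?b v)^2"
  have cd: "continuous_on (sph N) (?d k l)" for k l
    using nz by (auto intro!: continuous_intros)
  have pt: "(\<integral>v. g1 k l v * ?Xa k l v \<partial>SN N) + (\<integral>v. g2 k l v * ?Xb k l v \<partial>SN N)
     = (\<integral>v. ?d k l v \<partial>SN N) + (\<integral>v. g3 k l v * ?Xw k l v \<partial>SN N)" for k l
  proof -
    have ci: "integrable (SN N) f" if "continuous_on (sph N) f" for f :: "(nat \<Rightarrow> real) \<Rightarrow> real"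
      using cont_integrable that by (simp add: space_SN)
    have int: "integrable (SN N) (\<lambda>v. g1 k l v * ?Xa k l v)" "integrable (SN N) (\<lambda>v. g2 k l v * ?Xb k l v)"
       "integrable (SN N) (?d k l)" "integrable (SN N) (\<lambda>v. g3 k l v * ?Xw k l v)"
      using ci[OF continuous_on_mult[OF cg(1) pev_continuous[OF continuous_on_id]]]
        ci[OF continuous_on_mult[OF cg(2) pev_continuous[OF continuous_on_id]]]
        ci[OF cd] ci[OF continuous_on_mult[OF cg(3) pev_continuous[OF continuous_on_id]]] .
    have "(\<integral>v. g1 k l v * ?Xa k l v + g2 k l v * ?Xb k l v \<partial>SN N) = (\<integral>v. ?d k l v + g3 k l v * ?Xw k l v \<partial>SN N)"
    proof (rule Bochner_Integration.integral_cong[OF refl])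
      fix v assume "v \<in> space (SN N)"
      then have "?a v \<noteq> 0" "?b v \<noteq> 0" using nz by (auto simp: space_SN)
      then show "g1 k l v * ?Xa k l v + g2 k l v * ?Xb k l v = ?d k l v + g3 k l v * ?Xw k l v"
        unfolding g1_def g2_def g3_def by (simp add: field_simps power2_eq_square)
    qed
    then show ?thesis using int by simp
  qed
  have "(\<Sum>k<N. \<Sum>l<N. \<integral>v. g1 k l v * ?Xa k l v \<partial>SN N) + (\<Sum>k<N. \<Sum>l<N. \<integral>v. g2 k l v * ?Xb k l v \<partial>SN N)
     = (\<Sum>k<N. \<Sum>l<N. \<integral>v. ?d k l v \<partial>SN N) + (\<Sum>k<N. \<Sum>l<N. \<integral>v. g3 k l v * ?Xw k l v \<partial>SN N)"
    unfolding sum.distrib[symmetric] pt ..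
  then show ?thesis unfolding 1 2 3 by linarith
qed

definition splane :: "nat \<Rightarrow> nat \<Rightarrow> pol" where
  "splane i j = Add (Mul (V i) (V i)) (Mul (V j) (V j))"

lemma pev_splane: "pev (splane i j) v = (v i)^2 + (v j)^2"
  by (simp add: splane_def power2_eq_square)

text \<open>Homogeneity of degree 2 evaluates the Euler field in the polar form. The constant 4 N is
  the harmful part, while the other term has a favourable sign.\<close>

lemma rlap_splane:
  assumes "i \<noteq> j" "i < N" "j < N" "v \<in> sph N"
  shows "pev (rlap N (splane i j)) v = 4 * N - 2 * N * pev (splane i j) v"
proof -
  have E: "pev (Eu N (splane i j)) = pev (Mul (C 2) (splane i j))"
  proof
    fix v
    have "pev (Eu N (splane i j)) v = (\<Sum>k<N. (if k = i then 2 * (v i)^2 else 0) + (if k = j then 2 * (v j)^2 else 0))"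
      unfolding pev_Eu splane_def using assms(1) by (intro sum.cong) (auto simp: power2_eq_square)
    also have "\<dots> = pev (Mul (C 2) (splane i j)) v"
      using assms by (simp add: sum.distrib pev_splane)
    finally show "pev (Eu N (splane i j)) v = pev (Mul (C 2) (splane i j)) v" .
  qed
  have EE: "pev (Eu N (Eu N (splane i j))) v = 4 * pev (splane i j) v"
  proof -
    have "pev (Eu N (Mul (C 2) (splane i j))) v = 2 * pev (Eu N (splane i j)) v"
      by (simp add: pev_Eu sum_distrib_left mult_ac)
    then show ?thesis unfolding Eu_cong[OF E] E by simp
  qed
  have "pev (Lap N (splane i j)) v = (\<Sum>k<N. (if k = i then 2 else 0) + (if k = j then 2 else 0))"
    unfolding pev_Lap splane_def using assms(1) by (intro sum.cong) auto
  also have "\<dots> = 4" using assms by (simp add: sum.distrib)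
  finally show ?thesis
    using assms(4) unfolding rlap_alt EE E by (simp add: sph_def algebra_simps)
qed

lemma splane_le:
  assumes "i \<noteq> j" "i < N" "j < N" "v \<in> sph N"
  shows "pev (splane i j) v \<le> N"
proof -
  have "sqnorm N v = pev (splane i j) v + (\<Sum>k\<in>{..<N} - {i,j}. (v k)^2)"
    unfolding sqnorm_def pev_splane by (rule sum_split_two) (use assms in auto)
  moreover have "0 \<le> (\<Sum>k\<in>{..<N} - {i,j}. (v k)^2)" by (simp add: sum_nonneg)
  moreover have "sqnorm N v = N" using assms(4) by (simp add: sph_def)
  ultimately show ?thesis by linarith
qed

lemma sum_pairs_sym:
  fixes f :: "nat \<Rightarrow> nat \<Rightarrow> real"
  assumes "\<And>i j. f i j = f j i" "\<And>i. f i i = 0"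
  shows "(\<Sum>i<N. \<Sum>j<N. f i j) = 2 * (\<Sum>i<N. \<Sum>j\<in>{i<..<N}. f i j)"
proof -
  have "(\<Sum>j<N. f i j) = (\<Sum>j<N. if i < j then f i j else 0) + (\<Sum>j<N. if j < i then f i j else 0)" for i
    unfolding sum.distrib[symmetric] by (intro sum.cong refl) (use assms(2) in \<open>auto simp: not_less_iff_gr_or_eq\<close>)
  then have "(\<Sum>i<N. \<Sum>j<N. f i j) = (\<Sum>i<N. \<Sum>j<N. if i < j then f i j else 0) + (\<Sum>i<N. \<Sum>j<N. if j < i then f i j else 0)"
    by (simp add: sum.distrib)
  also have "(\<Sum>i<N. \<Sum>j<N. if j < i then f i j else 0) = (\<Sum>i<N. \<Sum>j<N. if i < j then f i j else 0)"
    by (subst sum.swap) (simp add: assms(1) cong: if_cong)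
  finally have "(\<Sum>i<N. \<Sum>j<N. f i j) = 2 * (\<Sum>i<N. \<Sum>j<N. if i < j then f i j else 0)" by simp
  moreover have "(\<Sum>j<N. if i < j then f i j else 0) = (\<Sum>j\<in>{i<..<N}. f i j)" for i
    by (subst sum.inter_filter[symmetric]) (auto intro!: sum.cong)
  ultimately show ?thesis by simp
qed

lemma continuous_integrable_SN:
  fixes f :: "(nat \<Rightarrow> real) \<Rightarrow> real"
  assumes "0 < N" "continuous_on (sph N) f" shows "integrable (SN N) f"
  using compact_measure.cont_integrable[OF compact_measure_SN[OF assms(1)], of f] assms(2)
  by (simp add: space_SN)

lemma continuous_integrable_PM:
  fixes f :: "(nat \<Rightarrow> real) \<times> real \<Rightarrow> real"
  assumes "0 < N" "continuous_on (sph N \<times> {0..2*pi}) f" shows "integrable (PM N) f"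
  using compact_measure.cont_integrable[OF compact_measure_PM[OF assms(1)], of f] assms(2)
  by (simp add: space_PM)

context heat
begin

text \<open>The production of one pair with weight w, averaged over the angle. \<open>psi\<close>
  appears as a product with a difference of logarithms, equal to it on positive arguments by
  \<open>psi_pos\<close> and easier to differentiate.\<close>

definition E :: "pol \<Rightarrow> nat \<Rightarrow> nat \<Rightarrow> real \<Rightarrow> real" where
  "E w i j t = (\<integral>x. pev w (fst x) * ((pev (u t) (fst x) - pev (u t) (rot i j (snd x) (fst x))) *
     (ln (pev (u t) (fst x)) - ln (pev (u t) (rot i j (snd x) (fst x))))) \<partial>PM N)"

definition E' :: "pol \<Rightarrow> nat \<Rightarrow> nat \<Rightarrow> real \<Rightarrow> real" where
  "E' w i j t = (\<integral>x. pev w (fst x) * (dpsi1 (pev (u t) (fst x)) (pev (u t) (rot i j (snd x) (fst x))) * pev (rlap N (u t)) (fst x)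
     + dpsi1 (pev (u t) (rot i j (snd x) (fst x))) (pev (u t) (fst x)) * pev (rlap N (u t)) (rot i j (snd x) (fst x))) \<partial>PM N)"

lemma N0: "0 < N" using N by simp

sublocale PM: compact_measure "PM N"
  by (rule compact_measure_PM[OF N0])

lemma cont_base:
  assumes "i < N" "j < N" "i \<noteq> j" "0 \<le> t"
  shows "continuous_on (sph N \<times> {0..2*pi}) (\<lambda>x. ln (pev (u t) (fst x)))"
    "continuous_on (sph N \<times> {0..2*pi}) (\<lambda>x. ln (pev (u t) (rot i j (snd x) (fst x))))"
proof -
  have p: "pev (u t) v \<noteq> 0" "pev (u t) (rot i j \<theta> v) \<noteq> 0" "pev (u t) v > 0" "pev (u t) (rot i j \<theta> v) > 0" if "v \<in> sph N" for v \<theta>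
    using u_pos[OF assms(4) that] u_pos[OF assms(4) rot_sph[OF assms(1-3) that], of \<theta>] by auto
  show "continuous_on (sph N \<times> {0..2*pi}) (\<lambda>x. ln (pev (u t) (fst x)))"
    by (intro continuous_on_ln pev_continuous continuous_on_fst continuous_on_id) (use p in auto)
  show "continuous_on (sph N \<times> {0..2*pi}) (\<lambda>x. ln (pev (u t) (rot i j (snd x) (fst x))))"
    by (intro continuous_on_ln pev_continuous rot_continuous continuous_on_fst continuous_on_snd continuous_on_id) (use p in auto)
qed

lemma E_deriv:
  assumes ij: "i < N" "j < N" "i \<noteq> j" and t: "t \<in> {0..T}"
  shows "(E w i j has_real_derivative E' w i j t) (at t within {0..T})"
  unfolding E_def E'_def
proof (rule PM.deriv_integral[OF _ _ _ t])
  fix s :: real and x assume s: "s \<in> {0..T}" and x: "x \<in> space (PM N)"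
  obtain v \<theta> where [simp]: "x = (v, \<theta>)" by (cases x)
  have v: "v \<in> sph N" using x by (simp add: space_PM)
  have "0 < pev (u s) v" "0 < pev (u s) (rot i j \<theta> v)"
    using u_pos[of s] s v rot_sph[OF ij v] by auto
  then show "((\<lambda>t. pev w (fst x) * ((pev (u t) (fst x) - pev (u t) (rot i j (snd x) (fst x))) *
     (ln (pev (u t) (fst x)) - ln (pev (u t) (rot i j (snd x) (fst x)))))) has_real_derivative
     pev w (fst x) * (dpsi1 (pev (u s) (fst x)) (pev (u s) (rot i j (snd x) (fst x))) * pev (rlap N (u s)) (fst x)
     + dpsi1 (pev (u s) (rot i j (snd x) (fst x))) (pev (u s) (fst x)) * pev (rlap N (u s)) (rot i j (snd x) (fst x)))) (at s within {0..T})"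
    by (auto intro!: derivative_eq_intros DERIV_subset[OF d_u] simp: dpsi1_def field_simps)
next
  fix s assume "s \<in> {0..T}"
  then have "0 \<le> s" by simp
  note cb = cont_base[OF ij this]
  show "continuous_on (space (PM N)) (\<lambda>x. pev w (fst x) * ((pev (u s) (fst x) - pev (u s) (rot i j (snd x) (fst x))) *
     (ln (pev (u s) (fst x)) - ln (pev (u s) (rot i j (snd x) (fst x))))))"
    unfolding space_PM by (intro continuous_on_mult continuous_on_diff cb pev_continuous rot_continuous continuous_on_fst continuous_on_snd continuous_on_id)
next
  have a: "pev (u s) v > 0" "pev (u s) (rot i j \<theta> v) > 0" if "0 \<le> s" "v \<in> sph N" for s v \<theta>
    using u_pos[OF that] u_pos[OF that(1) rot_sph[OF ij that(2)]] .
  have nz: "pev (u s) v \<noteq> 0" "pev (u s) (rot i j \<theta> v) \<noteq> 0" if "0 \<le> s" "v \<in> sph N" for s v \<theta>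
    using a(1)[OF that] a(2)[OF that, of \<theta>] by auto
  show "continuous_on ({0..T} \<times> space (PM N)) (\<lambda>x. pev w (fst (snd x)) * (dpsi1 (pev (u (fst x)) (fst (snd x))) (pev (u (fst x)) (rot i j (snd (snd x)) (fst (snd x)))) * pev (rlap N (u (fst x))) (fst (snd x))
     + dpsi1 (pev (u (fst x)) (rot i j (snd (snd x)) (fst (snd x)))) (pev (u (fst x)) (fst (snd x))) * pev (rlap N (u (fst x))) (rot i j (snd (snd x)) (fst (snd x)))))"
    unfolding dpsi1_def space_PM
    by (intro continuous_on_mult continuous_on_add continuous_on_diff continuous_on_divide continuous_on_ln
        time_pol_continuous'[OF time_pol_u] time_pol_continuous'[OF time_pol_Lp[OF time_pol_u]] pev_continuous rot_continuous continuous_on_fst continuous_on_snd continuous_on_id continuous_on_const)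
      (use nz a in auto)
qed

text \<open>Let \<beta> = X i j (ln u) and let R be the rotation. Since X i j commutes with R,
  hypothesis \<open>hw\<close> bounds the dissipation below by \<kappa> (u + u o R) (\<beta> -
  \<beta> o R)^2. In the expansion, two terms integrate to J by invariance and two nonnegative ones
  are dropped. The mixed terms vanish on averaging over the angle, because \<beta> o R is the
  angular derivative of ln u on a circle.\<close>

lemma E'_le:
  assumes ij: "i < N" "j < N" "i \<noteq> j" and t: "0 \<le> t" and \<kappa>: "0 \<le> \<kappa>"
    and hw: "\<And>v W. v \<in> sph N \<Longrightarrow> \<kappa> * (v j * W i - v i * W j)^2 \<le> pev w v * ((\<Sum>k<N. \<Sum>l<N. (v l * W k - v k * W l)^2) / 2)"
  shows "E' w i j t \<le> - 2 * \<kappa> * J i j t + (\<integral>x. pev (rlap N w) (fst x) * ((pev (u t) (fst x) - pev (u t) (rot i j (snd x) (fst x))) *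
     (ln (pev (u t) (fst x)) - ln (pev (u t) (rot i j (snd x) (fst x))))) \<partial>PM N)"
proof -
  define U where "U = pev (u t)"
  define LU where "LU = pev (rlap N (u t))"
  define \<beta> where "\<beta> = (\<lambda>v. pev (X i j (u t)) v / pev (u t) v)"
  define R where "R = rot i j"
  have Rs: "R \<theta> v \<in> sph N" if "v \<in> sph N" for \<theta> v using rot_sph[OF ij that] by (simp add: R_def)
  have pU: "0 < U v" "U v \<noteq> 0" if "v \<in> sph N" for v using u_pos[OF t that] by (auto simp: U_def)
  have cU: "continuous_on (sph N) U" and cLU: "continuous_on (sph N) LU"
    unfolding U_def LU_def by (intro pev_continuous continuous_on_id)+
  have c\<beta>: "continuous_on (sph N) \<beta>"
    unfolding \<beta>_def using pU by (intro continuous_on_divide pev_continuous continuous_on_id) (auto simp: U_def)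
  have cl: "continuous_on (sph N) (\<lambda>v. ln (U v))"
    using pU by (intro continuous_on_ln cU) auto
  have cR: "continuous_on (sph N) (\<lambda>v. f (R \<theta> v))" if "continuous_on (sph N) f" for f :: "_ \<Rightarrow> real" and \<theta>
    unfolding R_def by (rule continuous_on_compose2[OF that rot_continuous[OF continuous_on_const continuous_on_id]]) (use rot_sph[OF ij] in auto)
  have cS: "continuous_on (sph N \<times> {0..2*pi}) (\<lambda>x. f (fst x))" if "continuous_on (sph N) f" for f :: "_ \<Rightarrow> real"
    by (rule continuous_on_compose2[OF that continuous_on_fst[OF continuous_on_id]]) auto
  have cRS: "continuous_on (sph N \<times> {0..2*pi}) (\<lambda>x. f (R (snd x) (fst x)))"
    "continuous_on (sph N \<times> {0..2*pi}) (\<lambda>x. f (R (- snd x) (fst x)))" if "continuous_on (sph N) f" for f :: "_ \<Rightarrow> real"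
    unfolding R_def
    by (rule continuous_on_compose2[OF that rot_continuous[OF continuous_on_snd[OF continuous_on_id] continuous_on_fst[OF continuous_on_id]]];
        use rot_sph[OF ij] in force)
      (rule continuous_on_compose2[OF that rot_continuous[OF continuous_on_minus[OF continuous_on_snd[OF continuous_on_id]] continuous_on_fst[OF continuous_on_id]]];
        use rot_sph[OF ij] in force)
  define Ks where "Ks = (\<lambda>x. pev (rlap N w) (fst x) * ((U (fst x) - U (R (snd x) (fst x))) * (ln (U (fst x)) - ln (U (R (snd x) (fst x))))))"
  define F where "F = (\<lambda>x. pev w (fst x) * (dpsi1 (U (fst x)) (U (R (snd x) (fst x))) * LU (fst x)
     + dpsi1 (U (R (snd x) (fst x))) (U (fst x)) * LU (R (snd x) (fst x))))"
  \<comment> \<open>The majorant before averaging. It is compared with F for fixed angle, by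
    integrating over the sphere, while its mixed terms vanish for fixed velocity, by integrating
    over the angle. Hence a function on the product and both orders of Fubini.\<close>
  define \<Psi> where "\<Psi> = (\<lambda>x. - 2 * \<kappa> * (U (fst x) * (\<beta> (fst x))^2) + 2 * \<kappa> * (U (fst x) * \<beta> (fst x) * \<beta> (R (snd x) (fst x)))
     + 2 * \<kappa> * (U (fst x) * \<beta> (fst x) * \<beta> (R (- snd x) (fst x))) + Ks x)"
  have cd: "continuous_on (sph N) (\<lambda>v. dpsi1 (U v) (U (R \<theta> v)))" "continuous_on (sph N) (\<lambda>v. dpsi1 (U (R \<theta> v)) (U v))" for \<theta>
    unfolding dpsi1_def using pU Rs
    by (intro continuous_on_add continuous_on_diff continuous_on_divide continuous_on_const cl cU cR[OF cl] cR[OF cU]; auto)+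
  have cw: "continuous_on (sph N) (pev p)" for p by (intro pev_continuous continuous_on_id)
  have iK: "integrable (PM N) Ks" unfolding Ks_def
    by (intro continuous_integrable_PM N0 continuous_on_mult continuous_on_diff cS[OF cw] cS[OF cU] cS[OF cl] cRS(1)[OF cU] cRS(1)[OF cl])
  have iF: "integrable (PM N) F" unfolding F_def dpsi1_def
    by (intro continuous_integrable_PM N0 continuous_on_mult continuous_on_diff continuous_on_add continuous_on_divide continuous_on_const
       cS[OF cw] cS[OF cU] cS[OF cl] cS[OF cLU] cRS(1)[OF cLU] cRS(1)[OF cU] cRS(1)[OF cl]) (use pU Rs in auto)
  have iC1: "integrable (PM N) (\<lambda>x. U (fst x) * (\<beta> (fst x))^2)"
    and iC2: "integrable (PM N) (\<lambda>x. U (fst x) * \<beta> (fst x) * \<beta> (R (snd x) (fst x)))"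
    and iC3: "integrable (PM N) (\<lambda>x. U (fst x) * \<beta> (fst x) * \<beta> (R (- snd x) (fst x)))"
    by (intro continuous_integrable_PM N0 continuous_on_mult continuous_on_power cS[OF cU] cS[OF c\<beta>] cRS[OF c\<beta>])+
  have i\<Psi>: "integrable (PM N) \<Psi>"
    unfolding \<Psi>_def by (intro Bochner_Integration.integrable_add Bochner_Integration.integrable_mult_right iC1 iC2 iC3 iK)
  have UB: "U v * (\<beta> v)^2 = (pev (X i j (u t)) v)^2 / pev (u t) v" if "v \<in> sph N" for v
    using pU[OF that] by (simp add: \<beta>_def U_def power2_eq_square)
  have Jt: "J i j t = (\<integral>v. U v * (\<beta> v)^2 \<partial>SN N)"
    unfolding J_def by (rule Bochner_Integration.integral_cong) (auto simp: UB space_SN)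
  have zero1: "(\<integral>x. U (fst x) * \<beta> (fst x) * \<beta> (R (snd x) (fst x)) \<partial>PM N) = 0"
  proof -
    have "(\<integral>\<theta>. \<beta> (R \<theta> v) \<partial>TH) = 0" if "v \<in> sph N" for v
    proof (rule integral_TH_deriv)
      show "((\<lambda>\<theta>. ln (U (R \<theta> v))) has_real_derivative \<beta> (R \<theta> v)) (at \<theta>)" for \<theta>
        unfolding R_def U_def \<beta>_def using pU[OF Rs[OF that]] ij(3)
        by (auto intro!: derivative_eq_intros rot_deriv simp: U_def R_def)
      show "continuous_on {0..2*pi} (\<lambda>\<theta>. \<beta> (R \<theta> v))"
        unfolding R_def by (rule continuous_on_compose2[OF c\<beta> rot_continuous[OF continuous_on_id continuous_on_const]]) (use rot_sph[OF ij that] in auto)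
      show "ln (U (R (2*pi) v)) = ln (U (R 0 v))"
        by (simp add: R_def rot_def)
    qed
    then have "(\<integral>v. (\<integral>\<theta>. U v * \<beta> v * \<beta> (R \<theta> v) \<partial>TH) \<partial>SN N) = (\<integral>v. 0 \<partial>SN N)"
      by (intro Bochner_Integration.integral_cong refl) (simp add: space_SN)
    then show ?thesis using integral_PM_fst[OF N0 iC2] by simp
  qed
  have zero2: "(\<integral>x. U (fst x) * \<beta> (fst x) * \<beta> (R (- snd x) (fst x)) \<partial>PM N) = 0"
  proof -
    have "(\<integral>\<theta>. \<beta> (R (- \<theta>) v) \<partial>TH) = 0" if "v \<in> sph N" for v
    proof (rule integral_TH_deriv)
      have d: "((\<lambda>\<theta>. ln (U (R \<theta> v))) has_real_derivative \<beta> (R \<theta> v)) (at \<theta>)" for \<theta>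
        unfolding R_def U_def \<beta>_def using pU[OF Rs[OF that]] ij(3)
        by (auto intro!: derivative_eq_intros rot_deriv simp: U_def R_def)
      show "((\<lambda>\<theta>. - ln (U (R (-\<theta>) v))) has_real_derivative \<beta> (R (-\<theta>) v)) (at \<theta>)" for \<theta>
        using DERIV_minus[OF DERIV_chain2[OF d DERIV_minus[OF DERIV_ident]], of \<theta>] by simp
      show "continuous_on {0..2*pi} (\<lambda>\<theta>. \<beta> (R (-\<theta>) v))"
        unfolding R_def by (rule continuous_on_compose2[OF c\<beta> rot_continuous[OF continuous_on_minus[OF continuous_on_id] continuous_on_const]]) (use rot_sph[OF ij that] in auto)
      show "- ln (U (R (-(2*pi)) v)) = - ln (U (R (-0) v))"
        by (simp add: R_def rot_def)
    qed
    then have "(\<integral>v. (\<integral>\<theta>. U v * \<beta> v * \<beta> (R (-\<theta>) v) \<partial>TH) \<partial>SN N) = (\<integral>v. 0 \<partial>SN N)"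
      by (intro Bochner_Integration.integral_cong refl) (simp add: space_SN)
    then show ?thesis using integral_PM_fst[OF N0 iC3] by simp
  qed
  have "(\<integral>x. U (fst x) * (\<beta> (fst x))^2 \<partial>PM N) = J i j t"
    using integral_PM_fst[OF N0 iC1] prob_space.prob_space[OF prob_space_TH] by (simp add: Jt)
  then have int\<Psi>: "(\<integral>x. \<Psi> x \<partial>PM N) = - 2 * \<kappa> * J i j t + (\<integral>x. Ks x \<partial>PM N)"
    unfolding \<Psi>_def using iC1 iC2 iC3 iK zero1 zero2 by simp
  have "(\<integral>x. F x \<partial>PM N) \<le> (\<integral>x. \<Psi> x \<partial>PM N)"
  proof (rule integral_PM_mono_snd[OF N0 iF i\<Psi>])
    fix \<theta> :: real
    \<comment> \<open>The rotated solution is again a polynomial, and the generator applied to it is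
      the rotated generator.\<close>
    define b where "b = rotp i j \<theta> (u t)"
    have evb: "pev b v = U (R \<theta> v)" for v by (simp add: b_def pev_rotp U_def R_def)
    have Lb: "pev (rlap N b) v = LU (R \<theta> v)" for v
      unfolding b_def LU_def R_def by (rule rlap_rotp[OF ij(3,1,2)])
    let ?Xd = "\<lambda>k l v. pev (X k l (u t)) v / U v - pev (X k l b) v / U (R \<theta> v)"
    have cX: "continuous_on (sph N) (\<lambda>v. pev w v * (U v + U (R \<theta> v)) * (?Xd k l v)^2)" for k l
      by (intro continuous_on_mult continuous_on_add continuous_on_diff continuous_on_divide continuous_on_power
        cw cU cR[OF cU]) (use pU Rs in auto)
    have "(\<integral>v. F (v, \<theta>) \<partial>SN N) = (\<integral>v. pev w v * dpsi1 (U v) (U (R \<theta> v)) * LU v + pev w v * dpsi1 (U (R \<theta> v)) (U v) * LU (R \<theta> v) \<partial>SN N)"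
      by (simp add: F_def algebra_simps)
    also have "\<dots> = (\<integral>v. pev w v * dpsi1 (U v) (U (R \<theta> v)) * LU v \<partial>SN N) + (\<integral>v. pev w v * dpsi1 (U (R \<theta> v)) (U v) * LU (R \<theta> v) \<partial>SN N)"
      by (intro Bochner_Integration.integral_add continuous_integrable_SN N0 continuous_on_mult cw cd cLU cR[OF cLU])
    also have "\<dots> = - (\<Sum>k<N. \<Sum>l<N. \<integral>v. pev w v * (U v + U (R \<theta> v)) * (?Xd k l v)^2 \<partial>SN N) / 2
      + (\<integral>v. ((U v - U (R \<theta> v)) * (ln (U v) - ln (U (R \<theta> v)))) * pev (rlap N w) v \<partial>SN N)"
      using psi_dissipation[OF N0, of "u t" b w] pU Rs
      unfolding evb Lb U_def[symmetric] LU_def[symmetric] by simp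
    also have "(\<integral>v. ((U v - U (R \<theta> v)) * (ln (U v) - ln (U (R \<theta> v)))) * pev (rlap N w) v \<partial>SN N) = (\<integral>v. Ks (v, \<theta>) \<partial>SN N)"
      by (simp add: Ks_def mult_ac)
    finally have A: "(\<integral>v. F (v, \<theta>) \<partial>SN N) = - (\<Sum>k<N. \<Sum>l<N. \<integral>v. pev w v * (U v + U (R \<theta> v)) * (?Xd k l v)^2 \<partial>SN N) / 2
      + (\<integral>v. Ks (v, \<theta>) \<partial>SN N)" .
    have iG: "integrable (SN N) (\<lambda>v. U v * (\<beta> v)^2)" "integrable (SN N) (\<lambda>v. U (R \<theta> v) * (\<beta> (R \<theta> v))^2)"
      "integrable (SN N) (\<lambda>v. U v * \<beta> v * \<beta> (R \<theta> v))" "integrable (SN N) (\<lambda>v. U (R \<theta> v) * \<beta> (R \<theta> v) * \<beta> v)"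
      "integrable (SN N) (\<lambda>v. U v * \<beta> v * \<beta> (R (-\<theta>) v))"
      by (intro continuous_integrable_SN N0 continuous_on_mult continuous_on_power cU c\<beta> cR[OF cU] cR[OF c\<beta>])+
    have inv: "(\<integral>v. f (R \<theta> v) \<partial>SN N) = (\<integral>v. f v \<partial>SN N)" if "continuous_on (sph N) f" for f :: "_ \<Rightarrow> real"
      unfolding R_def using that by (intro integral_SN_rot ij SN.cont_meas) (simp add: space_SN)
    have inv1: "(\<integral>v. U (R \<theta> v) * (\<beta> (R \<theta> v))^2 \<partial>SN N) = J i j t"
      unfolding Jt by (rule inv) (intro continuous_on_mult continuous_on_power cU c\<beta>)
    have RR: "R (-\<theta>) (R \<theta> v) = v" for v by (simp add: R_def rot_add[OF ij(3)])
    have inv2: "(\<integral>v. U (R \<theta> v) * \<beta> (R \<theta> v) * \<beta> v \<partial>SN N) = (\<integral>v. U v * \<beta> v * \<beta> (R (-\<theta>) v) \<partial>SN N)"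
      using inv[of "\<lambda>v. U v * \<beta> v * \<beta> (R (-\<theta>) v)"] by (simp add: RR continuous_on_mult cU c\<beta> cR[OF c\<beta>])
    have "\<kappa> * (2 * J i j t - 2 * (\<integral>v. U v * \<beta> v * \<beta> (R \<theta> v) \<partial>SN N) - 2 * (\<integral>v. U v * \<beta> v * \<beta> (R (-\<theta>) v) \<partial>SN N))
      = (\<integral>v. \<kappa> * (U v * (\<beta> v)^2 + U (R \<theta> v) * (\<beta> (R \<theta> v))^2 - 2 * (U v * \<beta> v * \<beta> (R \<theta> v)) - 2 * (U (R \<theta> v) * \<beta> (R \<theta> v) * \<beta> v)) \<partial>SN N)"
      using iG inv1 inv2 by (simp add: Jt[symmetric])
    also have "\<dots> \<le> (\<integral>v. (\<Sum>k<N. \<Sum>l<N. pev w v * (U v + U (R \<theta> v)) * (?Xd k l v)^2) / 2 \<partial>SN N)"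
    proof (rule integral_mono)
      show "integrable (SN N) (\<lambda>v. \<kappa> * (U v * (\<beta> v)^2 + U (R \<theta> v) * (\<beta> (R \<theta> v))^2 - 2 * (U v * \<beta> v * \<beta> (R \<theta> v)) - 2 * (U (R \<theta> v) * \<beta> (R \<theta> v) * \<beta> v)))"
        by (intro Bochner_Integration.integrable_mult_right Bochner_Integration.integrable_diff Bochner_Integration.integrable_add iG)
      show "integrable (SN N) (\<lambda>v. (\<Sum>k<N. \<Sum>l<N. pev w v * (U v + U (R \<theta> v)) * (?Xd k l v)^2) / 2)"
        by (intro integrable_divide Bochner_Integration.integrable_sum continuous_integrable_SN N0 cX)
    next
      fix v assume "v \<in> space (SN N)"
      then have v: "v \<in> sph N" by (simp add: space_SN)
      define W where "W = (\<lambda>k. pev (D k (u t)) v / U v - pev (D k b) v / U (R \<theta> v))"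
      have XW: "?Xd k l v = v l * W k - v k * W l" for k l
        by (simp add: W_def pev_X diff_divide_distrib algebra_simps)
      have Xij: "v j * W i - v i * W j = \<beta> v - \<beta> (R \<theta> v)"
        unfolding XW[symmetric] \<beta>_def b_def X_rotp[OF ij(3)] U_def R_def ..
      have Up: "0 < U v" "0 < U (R \<theta> v)" using pU[OF v] pU[OF Rs[OF v]] by auto
      have "\<kappa> * (U v * (\<beta> v)^2 + U (R \<theta> v) * (\<beta> (R \<theta> v))^2 - 2 * (U v * \<beta> v * \<beta> (R \<theta> v)) - 2 * (U (R \<theta> v) * \<beta> (R \<theta> v) * \<beta> v))
         \<le> \<kappa> * ((U v + U (R \<theta> v)) * (\<beta> v - \<beta> (R \<theta> v))^2)"
      proof (rule mult_left_mono[OF _ \<kappa>])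
        have "0 \<le> U v * (\<beta> (R \<theta> v))^2 + U (R \<theta> v) * (\<beta> v)^2" using Up by simp
        then show "U v * (\<beta> v)^2 + U (R \<theta> v) * (\<beta> (R \<theta> v))^2 - 2 * (U v * \<beta> v * \<beta> (R \<theta> v)) - 2 * (U (R \<theta> v) * \<beta> (R \<theta> v) * \<beta> v)
          \<le> (U v + U (R \<theta> v)) * (\<beta> v - \<beta> (R \<theta> v))^2"
          by (simp add: power2_eq_square algebra_simps)
      qed
      also have "\<dots> = (U v + U (R \<theta> v)) * (\<kappa> * (v j * W i - v i * W j)^2)"
        by (simp add: Xij)
      also have "\<dots> \<le> (U v + U (R \<theta> v)) * (pev w v * ((\<Sum>k<N. \<Sum>l<N. (v l * W k - v k * W l)^2) / 2))"
        using Up by (intro mult_left_mono hw v) auto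
      also have "\<dots> = (\<Sum>k<N. \<Sum>l<N. pev w v * (U v + U (R \<theta> v)) * (?Xd k l v)^2) / 2"
        unfolding XW by (simp add: sum_distrib_left mult_ac)
      finally show "\<kappa> * (U v * (\<beta> v)^2 + U (R \<theta> v) * (\<beta> (R \<theta> v))^2 - 2 * (U v * \<beta> v * \<beta> (R \<theta> v)) - 2 * (U (R \<theta> v) * \<beta> (R \<theta> v) * \<beta> v))
         \<le> (\<Sum>k<N. \<Sum>l<N. pev w v * (U v + U (R \<theta> v)) * (?Xd k l v)^2) / 2" .
    qed
    also have "\<dots> = (\<Sum>k<N. \<Sum>l<N. \<integral>v. pev w v * (U v + U (R \<theta> v)) * (?Xd k l v)^2 \<partial>SN N) / 2"
      using continuous_integrable_SN[OF N0 cX] by (simp add: Bochner_Integration.integral_sum)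
    finally have B: "- (\<Sum>k<N. \<Sum>l<N. \<integral>v. pev w v * (U v + U (R \<theta> v)) * (?Xd k l v)^2 \<partial>SN N) / 2 \<le>
      - (\<kappa> * (2 * J i j t - 2 * (\<integral>v. U v * \<beta> v * \<beta> (R \<theta> v) \<partial>SN N) - 2 * (\<integral>v. U v * \<beta> v * \<beta> (R (-\<theta>) v) \<partial>SN N)))"
      by linarith
    have "integrable (SN N) (\<lambda>v. Ks (v, \<theta>))"
      unfolding Ks_def fst_conv snd_conv
      by (intro continuous_integrable_SN N0 continuous_on_mult continuous_on_diff cw cU cl cR[OF cU] cR[OF cl])
    then have "(\<integral>v. \<Psi> (v, \<theta>) \<partial>SN N) = - 2 * \<kappa> * J i j t + 2 * \<kappa> * (\<integral>v. U v * \<beta> v * \<beta> (R \<theta> v) \<partial>SN N)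
       + 2 * \<kappa> * (\<integral>v. U v * \<beta> v * \<beta> (R (-\<theta>) v) \<partial>SN N) + (\<integral>v. Ks (v, \<theta>) \<partial>SN N)"
      unfolding \<Psi>_def fst_conv snd_conv Jt using iG by simp
    then have "(\<integral>v. \<Psi> (v, \<theta>) \<partial>SN N) = - (\<kappa> * (2 * J i j t - 2 * (\<integral>v. U v * \<beta> v * \<beta> (R \<theta> v) \<partial>SN N) - 2 * (\<integral>v. U v * \<beta> v * \<beta> (R (-\<theta>) v) \<partial>SN N)))
       + (\<integral>v. Ks (v, \<theta>) \<partial>SN N)"
      by (simp add: right_diff_distrib)
    with A B show "(\<integral>v. F (v, \<theta>) \<partial>SN N) \<le> (\<integral>v. \<Psi> (v, \<theta>) \<partial>SN N)" by linarith
  qed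
  then have "(\<integral>x. F x \<partial>PM N) \<le> - 2 * \<kappa> * J i j t + (\<integral>x. Ks x \<partial>PM N)" unfolding int\<Psi> .
  then show ?thesis unfolding E'_def F_def Ks_def U_def LU_def R_def .
qed

end

section \<open>Entropy production of polynomials\<close>

lemma rlap_const: "pev (rlap N (C c)) v = 0"
  by (simp add: pev_Lp pev_X X_def)

context heat
begin

lemma E_nonneg:
  assumes "i < N" "j < N" "i \<noteq> j" "0 \<le> t" and w: "\<And>v. v \<in> sph N \<Longrightarrow> 0 \<le> pev w v"
  shows "0 \<le> E w i j t"
  unfolding E_def
proof (rule Bochner_Integration.integral_nonneg)
  fix x assume "x \<in> space (PM N)"
  then have v: "fst x \<in> sph N" by (auto simp: space_PM)
  have "0 < pev (u t) (fst x)" "0 < pev (u t) (rot i j (snd x) (fst x))"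
    using u_pos[OF assms(4) v] u_pos[OF assms(4) rot_sph[OF assms(1-3) v]] by auto
  from psi_nonneg[OF this] psi_pos[OF this] show "0 \<le> pev w (fst x) * ((pev (u t) (fst x) - pev (u t) (rot i j (snd x) (fst x))) *
     (ln (pev (u t) (fst x)) - ln (pev (u t) (rot i j (snd x) (fst x)))))"
    using w[OF v] by simp
qed

text \<open>The weight 1 is at least (v_i^2 + v_j^2) / N, so \<kappa> = 1 is admissible, and
  constants are harmonic, so no error term arises.\<close>

lemma E'_one_le:
  assumes ij: "i < N" "j < N" "i \<noteq> j" and t: "0 \<le> t"
  shows "E' (C 1) i j t \<le> - 2 * J i j t"
proof -
  have "E' (C 1) i j t \<le> - 2 * 1 * J i j t + (\<integral>x. pev (rlap N (C 1)) (fst x) * ((pev (u t) (fst x) - pev (u t) (rot i j (snd x) (fst x))) *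
     (ln (pev (u t) (fst x)) - ln (pev (u t) (rot i j (snd x) (fst x))))) \<partial>PM N)"
  proof (rule E'_le[OF ij t])
    fix v :: "nat \<Rightarrow> real" and W assume v: "v \<in> sph N"
    let ?G = "(\<Sum>k<N. \<Sum>l<N. (v l * W k - v k * W l)^2) / 2"
    have "N * (v j * W i - v i * W j)^2 \<le> pev (splane i j) v * ?G"
      unfolding pev_splane by (rule bivector_bound[OF ij]) (use v in \<open>simp add: sph_def\<close>)
    also have "\<dots> \<le> N * ?G"
      by (rule mult_right_mono[OF splane_le[OF ij(3,1,2) v]]) (simp add: sum_nonneg)
    finally show "1 * (v j * W i - v i * W j)^2 \<le> pev (C 1) v * ?G" using N0 by simp
  qed simp
  then show ?thesis by (simp add: rlap_const)
qed

text \<open>Now \<kappa> = N, at the price of an error: the generator applied to the weight is at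
  most 4 N, which multiplies the unweighted production.\<close>

lemma E'_plane_le:
  assumes ij: "i < N" "j < N" "i \<noteq> j" and t: "0 \<le> t"
  shows "E' (splane i j) i j t \<le> - 2 * real N * J i j t + 4 * real N * E (C 1) i j t"
proof -
  let ?\<psi> = "\<lambda>x. (pev (u t) (fst x) - pev (u t) (rot i j (snd x) (fst x))) *
     (ln (pev (u t) (fst x)) - ln (pev (u t) (rot i j (snd x) (fst x))))"
  have c\<psi>: "continuous_on (sph N \<times> {0..2*pi}) ?\<psi>"
    by (intro continuous_on_mult continuous_on_diff cont_base[OF ij t] pev_continuous rot_continuous continuous_on_fst continuous_on_snd continuous_on_id)
  have ce: "continuous_on (sph N \<times> {0..2*pi}) (\<lambda>x. pev p (fst x))" for p
    by (intro pev_continuous continuous_on_fst continuous_on_id)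
  have "E' (splane i j) i j t \<le> - 2 * real N * J i j t + (\<integral>x. pev (rlap N (splane i j)) (fst x) * ?\<psi> x \<partial>PM N)"
  proof (rule E'_le[OF ij t])
    fix v :: "nat \<Rightarrow> real" and W assume v: "v \<in> sph N"
    show "N * (v j * W i - v i * W j)^2 \<le> pev (splane i j) v * ((\<Sum>k<N. \<Sum>l<N. (v l * W k - v k * W l)^2) / 2)"
      unfolding pev_splane by (rule bivector_bound[OF ij]) (use v in \<open>simp add: sph_def\<close>)
  qed simp
  also have "(\<integral>x. pev (rlap N (splane i j)) (fst x) * ?\<psi> x \<partial>PM N) \<le> (\<integral>x. 4 * N * (pev (C 1) (fst x) * ?\<psi> x) \<partial>PM N)"
  proof (rule integral_mono)
    show "integrable (PM N) (\<lambda>x. pev (rlap N (splane i j)) (fst x) * ?\<psi> x)"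
      "integrable (PM N) (\<lambda>x. 4 * N * (pev (C 1) (fst x) * ?\<psi> x))"
      by (intro continuous_integrable_PM N0 continuous_on_mult continuous_on_const ce c\<psi>)+
    fix x assume "x \<in> space (PM N)"
    then have v: "fst x \<in> sph N" by (auto simp: space_PM)
    have "0 < pev (u t) (fst x)" "0 < pev (u t) (rot i j (snd x) (fst x))"
      using u_pos[OF t v] u_pos[OF t rot_sph[OF ij v]] by auto
    from psi_nonneg[OF this] psi_pos[OF this] have \<psi>: "0 \<le> ?\<psi> x" by simp
    have "pev (rlap N (splane i j)) (fst x) \<le> 4 * N"
      unfolding rlap_splane[OF ij(3,1,2) v] by (simp add: pev_splane)
    from mult_right_mono[OF this \<psi>] show "pev (rlap N (splane i j)) (fst x) * ?\<psi> x \<le> 4 * N * (pev (C 1) (fst x) * ?\<psi> x)"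
      by simp
  qed
  also have "\<dots> = 4 * N * E (C 1) i j t" by (simp add: E_def)
  finally show ?thesis by simp
qed

text \<open>The sum P + S carries the weight 1 + v_i^2 + v_j^2 of the case \<gamma> = 1. The
  summands are kept apart because S supplies the factor N while P measures the error that S
  incurs.\<close>

definition P :: "real \<Rightarrow> real" where "P t = (\<Sum>i<N. \<Sum>j\<in>{i<..<N}. E (C 1) i j t)"
definition P' :: "real \<Rightarrow> real" where "P' t = (\<Sum>i<N. \<Sum>j\<in>{i<..<N}. E' (C 1) i j t)"
definition S :: "real \<Rightarrow> real" where "S t = (\<Sum>i<N. \<Sum>j\<in>{i<..<N}. E (splane i j) i j t)"
definition S' :: "real \<Rightarrow> real" where "S' t = (\<Sum>i<N. \<Sum>j\<in>{i<..<N}. E' (splane i j) i j t)"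

lemma P_deriv: "t \<in> {0..T} \<Longrightarrow> (P has_real_derivative P' t) (at t within {0..T})"
  unfolding P_def[abs_def] P'_def by (intro DERIV_sum E_deriv) auto

lemma S_deriv: "t \<in> {0..T} \<Longrightarrow> (S has_real_derivative S' t) (at t within {0..T})"
  unfolding S_def[abs_def] S'_def by (intro DERIV_sum E_deriv) auto

lemma P_nonneg: "0 \<le> t \<Longrightarrow> 0 \<le> P t"
  unfolding P_def by (intro sum_nonneg E_nonneg) auto

lemma S_nonneg: "0 \<le> t \<Longrightarrow> 0 \<le> S t"
  unfolding S_def by (intro sum_nonneg E_nonneg) (auto simp: pev_splane)

lemma I_eq: "I t = (\<Sum>i<N. \<Sum>j\<in>{i<..<N}. J i j t)"
proof -
  have "J i j t = J j i t" "J i i t = 0" for i j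
    unfolding J_def X_antisym[of i j] by simp_all
  from sum_pairs_sym[of "\<lambda>i j. J i j t", OF this] show ?thesis by (simp add: I_def)
qed

lemma P'_le: "0 \<le> t \<Longrightarrow> P' t \<le> - 2 * I t"
  unfolding P'_def I_eq sum_distrib_left by (intro sum_mono E'_one_le) auto

lemma S'_le: "0 \<le> t \<Longrightarrow> S' t \<le> - 2 * real N * I t + 4 * real N * P t"
  unfolding S'_def I_eq P_def sum_distrib_left sum.distrib[symmetric] by (intro sum_mono E'_plane_le) auto

text \<open>The unweighted dissipation alone suffices for small \<open>N\<close>. For large \<open>N\<close> the functional
  \<open>(1 - 4 N t) P + S - 2 c (1 - 4 N t) Hrel\<close> with \<open>c = (N - 1) / 6\<close> decreases along the flow
  up to time \<open>1 / (4 N)\<close>, where it equals \<open>S\<close>.\<close>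

lemma P_ge_Hrel:
  assumes N3: "3 \<le> N"
  shows "2 * Hrel 0 \<le> P 0"
proof (rule field_le_epsilon)
  fix e :: real assume "0 < e"
  then obtain T where T: "0 \<le> T" "Hrel T \<le> e / 2" using Hrel_tendsto[OF N3, of "e / 2"] by auto
  have "P T - 2 * Hrel T \<le> P 0 - 2 * Hrel 0"
  proof (rule nonincreasing_within[OF _ _ T(1)])
    fix t assume t: "t \<in> {0..T}"
    show "((\<lambda>t. P t - 2 * Hrel t) has_real_derivative P' t - 2 * (- I t)) (at t within {0..T})"
      by (intro DERIV_diff DERIV_cmult P_deriv Hrel_deriv t)
    show "P' t - 2 * (- I t) \<le> 0" using P'_le[of t] t by simp
  qed
  then show "2 * Hrel 0 \<le> P 0 + e" using P_nonneg[OF T(1)] T(2) by linarith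
qed

lemma PS_ge_Hrel:
  assumes N6: "6 \<le> N"
  shows "(real N - 1) / 3 * Hrel 0 \<le> P 0 + S 0"
proof -
  define c where "c = (real N - 1) / 6"
  define T where "T = 1 / (4 * real N)"
  have T: "0 \<le> T" by (simp add: T_def)
  let ?g = "\<lambda>t. 1 - 4 * real N * t"
  let ?Y = "\<lambda>t. ?g t * P t + S t - 2 * c * (?g t * Hrel t)"
  have "?Y T \<le> ?Y 0"
  proof (rule nonincreasing_within[OF _ _ T])
    fix t assume t: "t \<in> {0..T}"
    show "(?Y has_real_derivative - (4 * real N) * P t + ?g t * P' t + S' t
       - 2 * c * (- (4 * real N) * Hrel t + ?g t * (- I t))) (at t within {0..T})"
      by (auto intro!: derivative_eq_intros P_deriv S_deriv Hrel_deriv t)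
    have t0: "0 \<le> t" using t by simp
    have g: "0 \<le> ?g t" "?g t \<le> 1"
      using t N6 by (auto simp: T_def field_simps)
    have I0: "0 \<le> I t" by (rule I_nonneg[OF t0])
    have "?g t * P' t \<le> 0"
      using g P'_le[OF t0] I0 by (intro mult_nonneg_nonpos) auto
    moreover have "2 * c * (?g t * I t) \<le> 2 * c * I t"
      using g I0 N6 mult_right_mono[OF g(2) I0] by (intro mult_left_mono) (auto simp: c_def)
    \<comment> \<open>The terms 4 N P from the time derivative of \<open>1 - 4 N t\<close> and from
      \<open>S'_le\<close> cancel. What remains is 8 c N Hrel - (2 N - 2 c) I, and
      \<open>log_sobolev\<close> makes it nonpositive once 8 c N \<le> (2 N - 2 c) (N - 2). With c =
      (N - 1) / 6 this reads N^2 - 5 N - 2 \<ge> 0, which holds from N = 6 on.\<close>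
    moreover have "8 * c * N * Hrel t \<le> (2 * N - 2 * c) * I t"
    proof -
      have "(real N - 2) * Hrel t \<le> I t" using N6 by (intro log_sobolev t0) auto
      then have "8 * c * N * ((real N - 2) * Hrel t) \<le> 8 * c * N * I t"
        using N6 by (intro mult_left_mono) (auto simp: c_def)
      also have "\<dots> \<le> ((2 * N - 2 * c) * (real N - 2)) * I t"
      proof (rule mult_right_mono[OF _ I0])
        have NN: "6 * (real N) \<le> real N * real N" using N6 by (intro mult_right_mono) auto
        have "(2 * N - 2 * c) * (real N - 2) - 8 * c * N = (real N * real N - 5 * real N - 2) / 3"
          by (simp add: c_def field_simps)
        moreover have "0 \<le> (real N * real N - 5 * real N - 2) / 3"
        proof -
          have "6 \<le> real N" using N6 by simp
          with NN have "0 \<le> real N * real N - 5 * real N - 2" by linarith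
          then show ?thesis by simp
        qed
        ultimately have "0 \<le> (2 * N - 2 * c) * (real N - 2) - 8 * c * N" by (simp only:)
        then show "8 * c * N \<le> (2 * N - 2 * c) * (real N - 2)" by (simp only: diff_ge_0_iff_ge)
      qed
      finally have "(real N - 2) * (8 * c * N * Hrel t) \<le> (real N - 2) * ((2 * N - 2 * c) * I t)"
        by (simp add: mult_ac)
      then show ?thesis using N6 by simp
    qed
    ultimately show "- (4 * real N) * P t + ?g t * P' t + S' t
       - 2 * c * (- (4 * real N) * Hrel t + ?g t * (- I t)) \<le> 0"
      using S'_le[OF t0] by (simp add: algebra_simps)
  qed
  moreover have "?g T = 0" using N6 by (simp add: T_def)
  ultimately have "0 \<le> ?Y 0" using S_nonneg[OF T] by simp
  then have "2 * c * Hrel 0 \<le> P 0 + S 0" by simp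
  moreover have "2 * c = (real N - 1) / 3" by (simp add: c_def)
  ultimately show ?thesis by (simp only:)
qed

lemma entropy_production_flow:
  assumes N3: "3 \<le> N"
  shows "Hrel 0 / 3 \<le> (P 0 + S 0) / (real N - 1)"
proof (cases "0 \<le> Hrel 0")
  case False
  have "0 \<le> (P 0 + S 0) / (real N - 1)" using P_nonneg[of 0] S_nonneg[of 0] N3 by simp
  then show ?thesis using False by linarith
next
  case True
  have "(real N - 1) / 3 * Hrel 0 \<le> P 0 + S 0"
  proof (cases "6 \<le> N")
    case False
    \<comment> \<open>For N \<le> 5 the target constant (N - 1) / 3 is below the 2 of
      \<open>P_ge_Hrel\<close>.\<close>
    then have "(real N - 1) / 3 * Hrel 0 \<le> 2 * Hrel 0" using True by (intro mult_right_mono) auto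
    then show ?thesis using P_ge_Hrel[OF N3] S_nonneg[of 0] by simp
  qed (rule PS_ge_Hrel)
  then show ?thesis using N3 by (simp add: field_simps)
qed

end

text \<open>The production for \<gamma> = 1. Its prefactor, 1 / (4 pi) times N over the number of
  pairs, combines with the length 2 pi of the angle interval to 1 / (N - 1).\<close>

definition dissip :: "nat \<Rightarrow> ((nat \<Rightarrow> real) \<Rightarrow> real) \<Rightarrow> real" where
  "dissip N f = (\<Sum>i<N. \<Sum>j\<in>{i<..<N}. \<integral>x. (1 + (fst x i)^2 + (fst x j)^2) *
     psi (f (fst x)) (f (rot i j (snd x) (fst x))) \<partial>PM N) / (real N - 1)"

text \<open>The second term makes this an entropy relative to the mean, meaningful for approximants
  of any mass; it vanishes for densities.\<close>

definition Ent :: "nat \<Rightarrow> ((nat \<Rightarrow> real) \<Rightarrow> real) \<Rightarrow> real" where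
  "Ent N f = (\<integral>v. f v * ln (f v) \<partial>SN N) - (\<integral>v. f v \<partial>SN N) * ln (\<integral>v. f v \<partial>SN N)"

lemma dissip_pol_ge3:
  assumes N3: "3 \<le> N" and p: "\<And>v. v \<in> sph N \<Longrightarrow> m \<le> pev p v" and m: "0 < m"
  shows "Ent N (pev p) / 3 \<le> dissip N (pev p)"
proof -
  obtain u where u: "time_pol u" "pev (u 0) = pev p"
    "\<And>t v. ((\<lambda>t. pev (u t) v) has_real_derivative pev (rlap N (u t)) v) (at t)"
    "\<And>i j t v. i < N \<Longrightarrow> j < N \<Longrightarrow>
       ((\<lambda>t. pev (X i j (u t)) v) has_real_derivative pev (rlap N (X i j (u t))) v) (at t)"
    using heat_flow[of p N] by blast
  interpret heat N u m
    by unfold_locales (use u p N3 m in auto)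
  have E: "E w i j 0 = (\<integral>x. pev w (fst x) * psi (pev p (fst x)) (pev p (rot i j (snd x) (fst x))) \<partial>PM N)"
    if "i < N" "j < N" "i \<noteq> j" for w i j
    unfolding E_def u(2)
  proof (rule Bochner_Integration.integral_cong[OF refl])
    fix x assume "x \<in> space (PM N)"
    then have v: "fst x \<in> sph N" by (auto simp: space_PM)
    show "pev w (fst x) * ((pev p (fst x) - pev p (rot i j (snd x) (fst x))) *
     (ln (pev p (fst x)) - ln (pev p (rot i j (snd x) (fst x))))) = pev w (fst x) * psi (pev p (fst x)) (pev p (rot i j (snd x) (fst x)))"
      using p[OF v] p[OF rot_sph[OF that v], of "snd x"] m by (subst psi_pos) auto
  qed
  have int: "integrable (PM N) (\<lambda>x. pev w (fst x) * psi (pev p (fst x)) (pev p (rot i j (snd x) (fst x))))"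
    if "i < N" "j < N" "i \<noteq> j" for w i j
  proof -
    have "integrable (PM N) (\<lambda>x. pev w (fst x) * ((pev (u 0) (fst x) - pev (u 0) (rot i j (snd x) (fst x))) *
     (ln (pev (u 0) (fst x)) - ln (pev (u 0) (rot i j (snd x) (fst x))))))"
      by (intro continuous_integrable_PM N0 continuous_on_mult continuous_on_diff cont_base[OF that order_refl] pev_continuous rot_continuous continuous_on_fst continuous_on_snd continuous_on_id)
    then show ?thesis
    proof (rule Bochner_Integration.integrable_cong[THEN iffD1, rotated 2])
      fix x assume "x \<in> space (PM N)"
      then have v: "fst x \<in> sph N" by (auto simp: space_PM)
      show "pev w (fst x) * ((pev (u 0) (fst x) - pev (u 0) (rot i j (snd x) (fst x))) *
       (ln (pev (u 0) (fst x)) - ln (pev (u 0) (rot i j (snd x) (fst x))))) = pev w (fst x) * psi (pev p (fst x)) (pev p (rot i j (snd x) (fst x)))"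
        unfolding u(2) using p[OF v] p[OF rot_sph[OF that v], of "snd x"] m by (subst psi_pos) auto
    qed simp
  qed
  have "P 0 + S 0 = (\<Sum>i<N. \<Sum>j\<in>{i<..<N}. \<integral>x. (1 + (fst x i)^2 + (fst x j)^2) *
     psi (pev p (fst x)) (pev p (rot i j (snd x) (fst x))) \<partial>PM N)"
    unfolding P_def S_def sum.distrib[symmetric]
  proof (intro sum.cong refl)
    fix i j assume "i \<in> {..<N}" "j \<in> {i<..<N}"
    then have ij: "i < N" "j < N" "i \<noteq> j" by auto
    show "E (C 1) i j 0 + E (splane i j) i j 0 = (\<integral>x. (1 + (fst x i)^2 + (fst x j)^2) *
     psi (pev p (fst x)) (pev p (rot i j (snd x) (fst x))) \<partial>PM N)"
      unfolding E[OF ij] using int[OF ij, of "C 1"] int[OF ij, of "splane i j"]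
      by (subst Bochner_Integration.integral_add[symmetric]) (auto simp: pev_splane algebra_simps)
  qed
  then have "(P 0 + S 0) / (real N - 1) = dissip N (pev p)" by (simp add: dissip_def)
  moreover have "Hrel 0 = Ent N (pev p)" by (simp add: Hrel_def H_def ub_def Ent_def u(2))
  ultimately show ?thesis using entropy_production_flow[OF N3] by simp
qed

section \<open>Approximation by polynomials\<close>

lemma coord_measurable_PM [measurable]: "(\<lambda>x. fst x k) \<in> borel_measurable (PM N)"
  unfolding PM_def by (rule measurable_compose[OF measurable_fst measurable_SN1[OF coord_measurable]])

lemma measurable_rot_PM:
  assumes "i < N" "j < N" "i \<noteq> j"
  shows "(\<lambda>x. rot i j (snd x) (fst x)) \<in> measurable (PM N) (SN N)"
proof -
  note measurable_snd_PM [measurable]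
  have s: "rot i j (snd x) (fst x) \<in> sph N" if "x \<in> space (PM N)" for x
    using that rot_sph[OF assms] by (auto simp: space_PM)
  have "(\<lambda>x. rot i j (snd x) (fst x)) \<in> measurable (PM N) (bor N)"
  proof (rule measurable_borI)
    fix k
    consider "k = j" | "k = i" "k \<noteq> j" | "k \<noteq> i" "k \<noteq> j" by blast
    then show "(\<lambda>x. rot i j (snd x) (fst x) k) \<in> borel_measurable (PM N)"
      by cases (auto simp: rot_def)
    show "rot i j (snd x) (fst x) \<in> extensional {..<N}" if "x \<in> space (PM N)" for x
      using s[OF that] by (auto simp: sph_def PiE_def)
  qed
  then have "(\<lambda>x. rot i j (snd x) (fst x)) \<in> measurable (PM N) (sigmaN N)"
    using measurable_cong_sets[OF refl sets_sigmaN] by blast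
  then show ?thesis
    unfolding SN_def by (intro measurable_restrict_space2) (use s in auto)
qed

text \<open>Each fixed rotation preserves the measure, hence so does one by an independent random
  angle. Null sets therefore pull back, and almost sure convergence carries over to the rotated
  argument.\<close>

lemma distr_rot_PM:
  assumes "i < N" "j < N" "i \<noteq> j"
  shows "distr (PM N) (SN N) (\<lambda>x. rot i j (snd x) (fst x)) = SN N"
proof (rule measure_eqI)
  have N0: "0 < N" using assms by simp
  interpret pair_prob_space "SN N" TH by (rule pair_prob_space_PM[OF N0])
  note T [measurable] = measurable_rot_PM[OF assms]
  fix A assume "A \<in> sets (distr (PM N) (SN N) (\<lambda>x. rot i j (snd x) (fst x)))"
  then have A [measurable]: "A \<in> sets (SN N)" by simp
  have "emeasure (distr (PM N) (SN N) (\<lambda>x. rot i j (snd x) (fst x))) A = (\<integral>\<^sup>+y. indicator A y \<partial>distr (PM N) (SN N) (\<lambda>x. rot i j (snd x) (fst x)))"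
    by simp
  also have "\<dots> = (\<integral>\<^sup>+x. indicator A (rot i j (snd x) (fst x)) \<partial>PM N)"
    by (rule nn_integral_distr) measurable
  also have "\<dots> = (\<integral>\<^sup>+\<theta>. (\<integral>\<^sup>+v. indicator A (rot i j \<theta> v) \<partial>SN N) \<partial>TH)"
    using nn_integral_snd[of "\<lambda>x. indicator A (rot i j (snd x) (fst x))"] T unfolding PM_def by simp
  also have "\<dots> = (\<integral>\<^sup>+\<theta>. emeasure (SN N) A \<partial>TH)"
  proof (rule nn_integral_cong)
    fix \<theta>
    have "(\<integral>\<^sup>+v. indicator A (rot i j \<theta> v) \<partial>SN N) = (\<integral>\<^sup>+v. indicator A v \<partial>distr (SN N) (SN N) (rot i j \<theta>))"
      by (rule nn_integral_distr[symmetric]) (use rot_measurable_SN[OF assms] in measurable)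
    then show "(\<integral>\<^sup>+v. indicator A (rot i j \<theta> v) \<partial>SN N) = emeasure (SN N) A"
      by (simp add: SN_rot[OF assms])
  qed
  also have "\<dots> = emeasure (SN N) A"
    using prob_space.emeasure_space_1[OF prob_space_TH] by simp
  finally show "emeasure (distr (PM N) (SN N) (\<lambda>x. rot i j (snd x) (fst x))) A = emeasure (SN N) A" .
qed simp

lemma AE_PM_rot:
  assumes "i < N" "j < N" "i \<noteq> j" "AE v in SN N. Q v"
  shows "AE x in PM N. Q (rot i j (snd x) (fst x))"
  by (rule AE_distrD[OF measurable_rot_PM[OF assms(1-3)]]) (subst distr_rot_PM[OF assms(1-3)], rule assms(4))

lemma AE_PM_fst:
  assumes "0 < N" "AE v in SN N. Q v"
  shows "AE x in PM N. Q (fst x)"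
proof -
  have d: "distr (PM N) (SN N) fst = SN N"
    unfolding PM_def by (rule prob_space.distr_pair_fst[OF prob_space_TH])
  have "fst \<in> measurable (PM N) (SN N)" by (simp add: PM_def)
  then show ?thesis by (rule AE_distrD) (subst d, rule assms(2))
qed

section \<open>Density of polynomials in L1, with prescribed bounds\<close>

definition L1_approx :: "nat \<Rightarrow> ((nat \<Rightarrow> real) \<Rightarrow> real) \<Rightarrow> bool" where
  "L1_approx N f \<longleftrightarrow> integrable (SN N) f \<and> (\<forall>e>0. \<exists>p. (\<integral>v. \<bar>f v - pev p v\<bar> \<partial>SN N) < e)"

lemma pev_integrable: "0 < N \<Longrightarrow> integrable (SN N) (pev p)"
  by (intro continuous_integrable_SN pev_continuous continuous_on_id)

lemma L1_approx_pev: "0 < N \<Longrightarrow> L1_approx N (pev p)"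
  unfolding L1_approx_def by (auto intro!: pev_integrable exI[of _ p])

lemma L1_approx_cong:
  assumes "\<And>v. v \<in> sph N \<Longrightarrow> f v = g v" and "L1_approx N f"
  shows "L1_approx N g"
proof -
  have "integrable (SN N) f \<longleftrightarrow> integrable (SN N) g"
    by (rule Bochner_Integration.integrable_cong) (auto simp: space_SN assms(1))
  moreover have "(\<integral>v. \<bar>f v - pev p v\<bar> \<partial>SN N) = (\<integral>v. \<bar>g v - pev p v\<bar> \<partial>SN N)" for p
    by (rule Bochner_Integration.integral_cong) (auto simp: space_SN assms(1))
  ultimately show ?thesis using assms(2) by (simp add: L1_approx_def)
qed

lemma L1_approx_approx:
  assumes N: "0 < N" and f: "integrable (SN N) f"
    and a: "\<And>e. 0 < e \<Longrightarrow> \<exists>g. L1_approx N g \<and> (\<integral>v. \<bar>f v - g v\<bar> \<partial>SN N) < e"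
  shows "L1_approx N f"
  unfolding L1_approx_def
proof (intro conjI f allI impI)
  fix e :: real assume "0 < e"
  then obtain g where g: "L1_approx N g" "(\<integral>v. \<bar>f v - g v\<bar> \<partial>SN N) < e / 2" using a[of "e/2"] by auto
  then obtain p where p: "(\<integral>v. \<bar>g v - pev p v\<bar> \<partial>SN N) < e / 2"
    using \<open>0 < e\<close> unfolding L1_approx_def by (meson half_gt_zero)
  have i: "integrable (SN N) g" "integrable (SN N) (pev p)"
    using g pev_integrable[OF N] by (auto simp: L1_approx_def)
  have "(\<integral>v. \<bar>f v - pev p v\<bar> \<partial>SN N) \<le> (\<integral>v. \<bar>f v - g v\<bar> + \<bar>g v - pev p v\<bar> \<partial>SN N)"
    using f i by (intro integral_mono) auto
  also have "\<dots> < e" using g p f i by simp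
  finally show "\<exists>p. (\<integral>v. \<bar>f v - pev p v\<bar> \<partial>SN N) < e" by blast
qed

lemma L1_approx_add:
  assumes N: "0 < N" and "L1_approx N f" "L1_approx N g"
  shows "L1_approx N (\<lambda>v. f v + g v)"
  unfolding L1_approx_def
proof (intro conjI allI impI)
  have i: "integrable (SN N) f" "integrable (SN N) g" using assms by (auto simp: L1_approx_def)
  then show "integrable (SN N) (\<lambda>v. f v + g v)" by simp
  fix e :: real assume "0 < e"
  then obtain p q where p: "(\<integral>v. \<bar>f v - pev p v\<bar> \<partial>SN N) < e / 2" "(\<integral>v. \<bar>g v - pev q v\<bar> \<partial>SN N) < e / 2"
    using assms unfolding L1_approx_def by (meson half_gt_zero)
  have "(\<integral>v. \<bar>f v + g v - pev (Add p q) v\<bar> \<partial>SN N) \<le> (\<integral>v. \<bar>f v - pev p v\<bar> + \<bar>g v - pev q v\<bar> \<partial>SN N)"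
    using i pev_integrable[OF N] by (intro integral_mono) auto
  also have "\<dots> < e" using p i pev_integrable[OF N] by simp
  finally show "\<exists>p. (\<integral>v. \<bar>f v + g v - pev p v\<bar> \<partial>SN N) < e" by blast
qed

lemma L1_approx_cmult:
  assumes N: "0 < N" and "L1_approx N f"
  shows "L1_approx N (\<lambda>v. c * f v)"
  unfolding L1_approx_def
proof (intro conjI allI impI)
  have i: "integrable (SN N) f" using assms by (auto simp: L1_approx_def)
  then show "integrable (SN N) (\<lambda>v. c * f v)" by simp
  fix e :: real assume "0 < e"
  then obtain p where p: "(\<integral>v. \<bar>f v - pev p v\<bar> \<partial>SN N) < e / (\<bar>c\<bar> + 1)"
    using assms unfolding L1_approx_def by (meson divide_pos_pos abs_ge_zero add_nonneg_pos zero_less_one)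
  have "\<bar>c * f v - pev (Mul (C c) p) v\<bar> = \<bar>c\<bar> * \<bar>f v - pev p v\<bar>" for v
    by (simp add: abs_mult[symmetric] algebra_simps)
  then have "(\<integral>v. \<bar>c * f v - pev (Mul (C c) p) v\<bar> \<partial>SN N) = \<bar>c\<bar> * (\<integral>v. \<bar>f v - pev p v\<bar> \<partial>SN N)"
    by simp
  also have "\<dots> \<le> (\<bar>c\<bar> + 1) * (\<integral>v. \<bar>f v - pev p v\<bar> \<partial>SN N)"
    by (intro mult_right_mono) auto
  also have "\<dots> < e" using p by (simp add: field_simps)
  finally show "\<exists>p. (\<integral>v. \<bar>c * f v - pev p v\<bar> \<partial>SN N) < e" by blast
qed

lemma L1_approx_dominated:
  assumes N: "0 < N" and s: "\<And>n. L1_approx N (s n)" and f: "f \<in> borel_measurable (SN N)"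
    and w: "integrable (SN N) w" and lim: "\<And>v. v \<in> space (SN N) \<Longrightarrow> (\<lambda>n. s n v) \<longlonglongrightarrow> f v"
    and bound: "\<And>n v. v \<in> space (SN N) \<Longrightarrow> \<bar>s n v\<bar> \<le> w v" "\<And>v. v \<in> space (SN N) \<Longrightarrow> \<bar>f v\<bar> \<le> w v"
  shows "L1_approx N f"
proof (rule L1_approx_approx[OF N])
  have si [measurable]: "integrable (SN N) (s n)" for n using s by (auto simp: L1_approx_def)
  note f [measurable]
  show fi: "integrable (SN N) f"
    by (rule Bochner_Integration.integrable_bound[OF w f]) (use bound(2) in \<open>force intro!: AE_I2\<close>)
  have "(\<lambda>n. \<integral>v. \<bar>f v - s n v\<bar> \<partial>SN N) \<longlonglongrightarrow> (\<integral>v. 0 \<partial>SN N)"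
  proof (rule integral_dominated_convergence[where w = "\<lambda>v. 2 * w v"])
    show "AE v in SN N. (\<lambda>n. \<bar>f v - s n v\<bar>) \<longlonglongrightarrow> 0"
    proof (rule AE_I2)
      fix v assume "v \<in> space (SN N)"
      then have "(\<lambda>n. \<bar>f v - s n v\<bar>) \<longlonglongrightarrow> \<bar>f v - f v\<bar>" by (intro tendsto_intros lim)
      then show "(\<lambda>n. \<bar>f v - s n v\<bar>) \<longlonglongrightarrow> 0" by simp
    qed
    show "AE v in SN N. norm \<bar>f v - s n v\<bar> \<le> 2 * w v" for n
    proof (rule AE_I2)
      fix v assume v: "v \<in> space (SN N)"
      show "norm \<bar>f v - s n v\<bar> \<le> 2 * w v" using bound(1)[OF v, of n] bound(2)[OF v] by simp
    qed
  qed (use w in auto)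
  then have l: "(\<lambda>n. \<integral>v. \<bar>f v - s n v\<bar> \<partial>SN N) \<longlonglongrightarrow> 0" by simp
  fix e :: real assume "0 < e"
  from order_tendstoD(2)[OF l this] show "\<exists>g. L1_approx N g \<and> (\<integral>v. \<bar>f v - g v\<bar> \<partial>SN N) < e"
    using s by (auto simp: eventually_sequentially)
qed

lemma polynomial_function_pev:
  "real_polynomial_function (q :: real \<Rightarrow> real) \<Longrightarrow> \<exists>r. pev r = (\<lambda>v. q (pev p v))"
proof (induction rule: real_polynomial_function.induct)
  case (linear f)
  have "pev p v * f 1 = f (pev p v)" for v
    using linear_scale[OF bounded_linear.linear[OF linear.hyps], of "pev p v" 1] by simp
  then have "pev (Mul p (C (f 1))) = (\<lambda>v. f (pev p v))" by auto
  then show ?case by blast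
next
  case (const c)
  have "pev (C c) = (\<lambda>v. c)" by (simp add: fun_eq_iff)
  then show ?case by blast
next
  case (add f g)
  then obtain r s where "pev r = (\<lambda>v. f (pev p v))" "pev s = (\<lambda>v. g (pev p v))" by auto
  then have "pev (Add r s) = (\<lambda>v. f (pev p v) + g (pev p v))" by (simp add: fun_eq_iff)
  then show ?case by blast
next
  case (mult f g)
  then obtain r s where "pev r = (\<lambda>v. f (pev p v))" "pev s = (\<lambda>v. g (pev p v))" by auto
  then have "pev (Mul r s) = (\<lambda>v. f (pev p v) * g (pev p v))" by (simp add: fun_eq_iff)
  then show ?case by blast
qed

text \<open>Weierstrass approximation in one variable, on the compact range of p, is enough: a
  polynomial in a polynomial stays within the syntax.\<close>

lemma compose_uniform:
  fixes g :: "real \<Rightarrow> real"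
  assumes g: "continuous_on UNIV g" and e: "0 < e"
  shows "\<exists>r. \<forall>v\<in>sph N. \<bar>g (pev p v) - pev r v\<bar> < e"
proof -
  have c: "continuous_on (sph N) (pev p)" by (intro pev_continuous continuous_on_id)
  have "compact (pev p ` sph N)" by (rule compact_continuous_image[OF c compact_sph])
  then obtain q where q: "real_polynomial_function q" "\<And>x. x \<in> pev p ` sph N \<Longrightarrow> \<bar>g x - q x\<bar> < e"
    using Stone_Weierstrass_real_polynomial_function[of "pev p ` sph N" g e] continuous_on_subset[OF g] e by auto
  obtain r where "pev r = (\<lambda>v. q (pev p v))" using polynomial_function_pev[OF q(1)] by blast
  then show ?thesis using q(2) by (intro exI[of _ r]) auto
qed

text \<open>The bounds matter: the flow and the logarithms need a positive lower bound, and
  dominated convergence a uniform upper one. Clipping an L1 approximant at m and M does not increase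
  the error but leaves the polynomials. A uniform approximation of the clipped function overshoots
  by at most d, and contraction about the midpoint by the factor h / (h + d) brings it back.\<close>

lemma L1_approx_clamp:
  assumes N: "0 < N" and f: "L1_approx N f" and mM: "m < M" and e: "0 < e"
    and fb: "\<And>v. v \<in> sph N \<Longrightarrow> m \<le> f v \<and> f v \<le> M"
  shows "\<exists>p. (\<forall>v\<in>sph N. m \<le> pev p v \<and> pev p v \<le> M) \<and> (\<integral>v. \<bar>f v - pev p v\<bar> \<partial>SN N) < e"
proof -
  interpret prob_space "SN N" by (rule prob_space_SN[OF N])
  have fi: "integrable (SN N) f" using f by (simp add: L1_approx_def)
  obtain p where p: "(\<integral>v. \<bar>f v - pev p v\<bar> \<partial>SN N) < e / 2"
    using f e unfolding L1_approx_def by (meson half_gt_zero)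
  define cl where "cl = (\<lambda>x. max m (min M x))"
  have "continuous_on UNIV cl" unfolding cl_def by (intro continuous_intros)
  define d where "d = e / 4"
  have d: "d > 0" using e by (simp add: d_def)
  obtain r where r: "\<And>v. v \<in> sph N \<Longrightarrow> \<bar>cl (pev p v) - pev r v\<bar> < d"
    using compose_uniform[OF \<open>continuous_on UNIV cl\<close> d] by blast
  define c h where "c = (m + M) / 2" and "h = (M - m) / 2"
  have h: "h > 0" using mM by (simp add: h_def)
  define s where "s = h / (h + d)"
  have s: "0 < s" "s < 1" "(1 - s) * (h + d) = d" "s * (h + d) = h" using h d by (auto simp: s_def field_simps)
  define r' where "r' = Add (C (c - s * c)) (Mul (C s) r)"
  have r': "pev r' v = c + s * (pev r v - c)" for v by (simp add: r'_def algebra_simps)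
  have rc: "\<bar>pev r v - c\<bar> \<le> h + d" if "v \<in> sph N" for v
  proof -
    have "\<bar>cl (pev p v) - c\<bar> \<le> h" using mM by (auto simp: cl_def c_def h_def max_def min_def abs_if field_simps)
    then show ?thesis using r[OF that] by linarith
  qed
  have 1: "m \<le> pev r' v \<and> pev r' v \<le> M" if "v \<in> sph N" for v
  proof -
    have "\<bar>s * (pev r v - c)\<bar> \<le> s * (h + d)"
      using rc[OF that] s(1) by (simp add: abs_mult)
    then have "\<bar>pev r' v - c\<bar> \<le> h" using s(4) by (simp add: r')
    moreover have "c - h = m" "c + h = M" by (simp_all add: c_def h_def field_simps)
    ultimately show ?thesis by linarith
  qed
  have 2: "\<bar>f v - pev r' v\<bar> \<le> \<bar>f v - pev p v\<bar> + 2 * d" if v: "v \<in> sph N" for v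
  proof -
    have "\<bar>pev r v - pev r' v\<bar> = (1 - s) * \<bar>pev r v - c\<bar>"
    proof -
      have "pev r v - pev r' v = (1 - s) * (pev r v - c)" by (simp add: r' algebra_simps)
      then show ?thesis using s by (simp add: abs_mult)
    qed
    also have "\<dots> \<le> (1 - s) * (h + d)" using rc[OF v] s by (intro mult_left_mono) auto
    finally have "\<bar>pev r v - pev r' v\<bar> \<le> d" using s by simp
    moreover have "\<bar>f v - cl (pev p v)\<bar> \<le> \<bar>f v - pev p v\<bar>"
      using fb[OF v] by (auto simp: cl_def max_def min_def)
    ultimately show ?thesis using r[OF v] by linarith
  qed
  have "(\<integral>v. \<bar>f v - pev r' v\<bar> \<partial>SN N) \<le> (\<integral>v. \<bar>f v - pev p v\<bar> + 2 * d \<partial>SN N)"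
    using fi pev_integrable[OF N] 2 by (intro integral_mono) (auto simp: space_SN)
  also have "\<dots> = (\<integral>v. \<bar>f v - pev p v\<bar> \<partial>SN N) + 2 * d"
    using fi pev_integrable[OF N] by (simp add: prob_space)
  also have "\<dots> < e" using p by (simp add: d_def)
  finally show ?thesis using 1 by blast
qed

text \<open>These sets are closed under complements and countable unions and contain the half
  spaces, hence all measurable subsets of the sphere.\<close>

definition L1_approx_set :: "nat \<Rightarrow> (nat \<Rightarrow> real) set \<Rightarrow> bool" where
  "L1_approx_set N A \<longleftrightarrow> A \<in> sets (SN N) \<and> L1_approx N (indicator A)"

lemma L1_approx_set_compl:
  assumes N: "0 < N" and A: "L1_approx_set N A"
  shows "L1_approx_set N (sph N - A)"
proof -
  have s: "sph N - A \<in> sets (SN N)"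
    using A sets.compl_sets[of A "SN N"] by (simp add: L1_approx_set_def space_SN)
  have "L1_approx N (\<lambda>v. pev (C 1) v + (-1) * indicator A v)"
    using A by (intro L1_approx_add L1_approx_cmult L1_approx_pev N) (simp add: L1_approx_set_def)
  then have "L1_approx N (indicator (sph N - A))"
    by (rule L1_approx_cong[rotated]) (auto simp: indicator_def)
  then show ?thesis using s by (simp add: L1_approx_set_def)
qed

text \<open>The indicator of an intersection is a product. Approximants with values in [0,1] keep
  its error below the sum of the two errors.\<close>

lemma L1_approx_set_Int:
  assumes N: "0 < N" and A: "L1_approx_set N A" and B: "L1_approx_set N B"
  shows "L1_approx_set N (A \<inter> B)"
  unfolding L1_approx_set_def
proof (intro conjI L1_approx_approx[OF N])
  have [measurable]: "A \<in> sets (SN N)" "B \<in> sets (SN N)" using A B by (auto simp: L1_approx_set_def)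
  interpret prob_space "SN N" by (rule prob_space_SN[OF N])
  show "A \<inter> B \<in> sets (SN N)" by measurable
  have iA: "integrable (SN N) (indicator A :: _ \<Rightarrow> real)" "integrable (SN N) (indicator B :: _ \<Rightarrow> real)"
    using A B by (auto simp: L1_approx_set_def L1_approx_def)
  show iAB: "integrable (SN N) (indicator (A \<inter> B) :: _ \<Rightarrow> real)"
    by (intro integrable_const_bound[of _ 1]) (auto simp: indicator_def)
  fix e :: real assume e: "0 < e"
  have b: "0 \<le> (indicator A v :: real) \<and> (indicator A v :: real) \<le> 1" for A and v :: "nat \<Rightarrow> real" by (auto simp: indicator_def)
  obtain p where p: "\<forall>v\<in>sph N. 0 \<le> pev p v \<and> pev p v \<le> 1" "(\<integral>v. \<bar>indicator A v - pev p v\<bar> \<partial>SN N) < e / 2"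
    using L1_approx_clamp[OF N _ zero_less_one, of "indicator A" "e/2"] A e b by (auto simp: L1_approx_set_def)
  obtain q where q: "\<forall>v\<in>sph N. 0 \<le> pev q v \<and> pev q v \<le> 1" "(\<integral>v. \<bar>indicator B v - pev q v\<bar> \<partial>SN N) < e / 2"
    using L1_approx_clamp[OF N _ zero_less_one, of "indicator B" "e/2"] B e b by (auto simp: L1_approx_set_def)
  have "\<bar>indicator (A \<inter> B) v - pev (Mul p q) v\<bar> \<le> \<bar>indicator A v - pev p v\<bar> + \<bar>indicator B v - pev q v\<bar>" if "v \<in> sph N" for v
  proof -
    have "indicator (A \<inter> B) v - pev (Mul p q) v = (indicator A v - pev p v) * indicator B v + pev p v * (indicator B v - pev q v)"
      by (simp add: indicator_inter_arith algebra_simps)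
    also have "\<bar>\<dots>\<bar> \<le> \<bar>indicator A v - pev p v\<bar> * \<bar>indicator B v\<bar> + \<bar>pev p v\<bar> * \<bar>indicator B v - pev q v\<bar>"
      by (metis abs_triangle_ineq abs_mult)
    also have "\<dots> \<le> \<bar>indicator A v - pev p v\<bar> * 1 + 1 * \<bar>indicator B v - pev q v\<bar>"
      using p(1) that by (intro add_mono mult_mono) (auto simp: indicator_def)
    finally show ?thesis by simp
  qed
  then have "(\<integral>v. \<bar>indicator (A \<inter> B) v - pev (Mul p q) v\<bar> \<partial>SN N) \<le> (\<integral>v. \<bar>indicator A v - pev p v\<bar> + \<bar>indicator B v - pev q v\<bar> \<partial>SN N)"
  proof (intro integral_mono)
    show "integrable (SN N) (\<lambda>v. \<bar>indicator (A \<inter> B) v - pev (Mul p q) v\<bar>)"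
      by (intro integrable_abs Bochner_Integration.integrable_diff iAB pev_integrable[OF N])
    show "integrable (SN N) (\<lambda>v. \<bar>indicator A v - pev p v\<bar> + \<bar>indicator B v - pev q v\<bar>)"
      by (intro Bochner_Integration.integrable_add integrable_abs Bochner_Integration.integrable_diff iA pev_integrable[OF N])
  qed (simp only: space_SN)
  also have "\<dots> < e" using p q iA pev_integrable[OF N] by simp
  finally show "\<exists>g. L1_approx N g \<and> (\<integral>v. \<bar>indicator (A \<inter> B) v - g v\<bar> \<partial>SN N) < e"
    using L1_approx_pev[OF N] by blast
qed

lemma L1_approx_set_limit:
  assumes N: "0 < N" and A: "A \<in> sets (SN N)" and s: "\<And>n. L1_approx N (s n)"
    and lim: "\<And>v. v \<in> sph N \<Longrightarrow> (\<lambda>n. s n v) \<longlonglongrightarrow> indicator A v" and b: "\<And>n v. v \<in> sph N \<Longrightarrow> \<bar>s n v\<bar> \<le> 1"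
  shows "L1_approx_set N A"
  unfolding L1_approx_set_def
proof (intro conjI A)
  interpret prob_space "SN N" by (rule prob_space_SN[OF N])
  show "L1_approx N (indicator A)"
  proof (rule L1_approx_dominated[where s = s and w = "\<lambda>_. 1"])
    show "indicator A \<in> borel_measurable (SN N)" using A by simp
    show "(\<lambda>n. s n v) \<longlonglongrightarrow> indicator A v" if "v \<in> space (SN N)" for v
      using lim that by (simp add: space_SN)
  qed (use N s b in \<open>auto simp: space_SN indicator_def\<close>)
qed

lemma L1_approx_set_UN:
  assumes N: "0 < N" and A: "\<And>n. L1_approx_set N (A n)"
  shows "L1_approx_set N (\<Union>n::nat. A n)"
proof -
  have U: "L1_approx_set N (\<Union>k\<in>{..<n}. A k)" for n
  proof (induction n)
    case 0
    have "L1_approx N (pev (C 0))" by (rule L1_approx_pev[OF N])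
    moreover have "pev (C 0) = indicator {}" by (simp add: fun_eq_iff)
    ultimately show ?case by (simp add: L1_approx_set_def)
  next
    case (Suc n)
    have sub: "A k \<subseteq> sph N" for k
      using A[of k] sets.sets_into_space[of "A k" "SN N"] by (simp add: L1_approx_set_def space_SN)
    have "L1_approx_set N (sph N - ((sph N - (\<Union>k\<in>{..<n}. A k)) \<inter> (sph N - A n)))"
      by (intro L1_approx_set_compl L1_approx_set_Int N Suc A)
    moreover have "sph N - ((sph N - (\<Union>k\<in>{..<n}. A k)) \<inter> (sph N - A n)) = (\<Union>k\<in>{..<Suc n}. A k)"
      using sub by (auto simp: lessThan_Suc)
    ultimately show ?case by simp
  qed
  show ?thesis
  proof (rule L1_approx_set_limit[OF N, where s = "\<lambda>n. indicator (\<Union>k\<in>{..<n}. A k)"])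
    show "(\<Union>n. A n) \<in> sets (SN N)" using A by (intro sets.countable_UN) (auto simp: L1_approx_set_def)
    show "L1_approx N (indicator (\<Union>k\<in>{..<n}. A k))" for n using U by (simp add: L1_approx_set_def)
    show "(\<lambda>n. indicator (\<Union>k\<in>{..<n}. A k) v :: real) \<longlonglongrightarrow> indicator (\<Union>n. A n) v" for v
      by (rule LIMSEQ_indicator_UN)
  qed (auto simp: indicator_def)
qed

lemma coord_set_sets: "A \<in> sets borel \<Longrightarrow> {v \<in> sph N. v i \<in> A} \<in> sets (SN N)"
proof -
  assume [measurable]: "A \<in> sets borel"
  have [measurable]: "(\<lambda>v. v i) \<in> borel_measurable (SN N)" by (rule measurable_SN1[OF coord_measurable])
  have "{v \<in> space (SN N). v i \<in> A} \<in> sets (SN N)" by measurable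
  then show ?thesis by (simp add: space_SN)
qed

text \<open>Ramps of slope n converge pointwise to the indicator; they equal 1 on the whole closed
  half space, so the boundary is included.\<close>

lemma L1_approx_halfspace:
  assumes N: "0 < N"
  shows "L1_approx_set N {v \<in> sph N. v i \<in> {..c}}"
proof (rule L1_approx_set_limit[OF N, where s = "\<lambda>n v. max 0 (min 1 (1 - real n * (v i - c)))"])
  show "{v \<in> sph N. v i \<in> {..c}} \<in> sets (SN N)" by (rule coord_set_sets) simp
  interpret prob_space "SN N" by (rule prob_space_SN[OF N])
  show "L1_approx N (\<lambda>v. max 0 (min 1 (1 - real n * (v i - c))))" for n
  proof (rule L1_approx_approx[OF N])
    let ?g = "\<lambda>x. max 0 (min 1 (1 - real n * (x - c)))"
    have g: "continuous_on UNIV ?g" by (intro continuous_intros)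
    have cv: "continuous_on (sph N) (\<lambda>v. ?g (v i))"
      by (intro continuous_intros continuous_on_product_coordinates continuous_on_subset[OF continuous_on_product_coordinates]) auto
    show gi: "integrable (SN N) (\<lambda>v. ?g (v i))" by (rule continuous_integrable_SN[OF N cv])
    fix e :: real assume e: "0 < e"
    then obtain r where r: "\<And>v. v \<in> sph N \<Longrightarrow> \<bar>?g (pev (V i) v) - pev r v\<bar> < e / 2"
      using compose_uniform[OF g, of "e/2" N "V i"] by auto
    have "(\<integral>v. \<bar>?g (v i) - pev r v\<bar> \<partial>SN N) \<le> (\<integral>v. e / 2 \<partial>SN N)"
      using gi pev_integrable[OF N] less_imp_le[OF r] by (intro integral_mono) (auto simp: space_SN)
    also have "\<dots> < e" using e by (simp add: prob_space)
    finally show "\<exists>g. L1_approx N g \<and> (\<integral>v. \<bar>?g (v i) - g v\<bar> \<partial>SN N) < e" using L1_approx_pev[OF N] by blast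
  qed
  fix v assume v: "v \<in> sph N"
  show "(\<lambda>n. max 0 (min 1 (1 - real n * (v i - c)))) \<longlonglongrightarrow> indicator {v \<in> sph N. v i \<in> {..c}} v"
  proof (cases "v i \<le> c")
    case True
    then have "1 \<le> 1 - real n * (v i - c)" for n
      by (simp add: mult_nonneg_nonpos)
    then have "max 0 (min 1 (1 - real n * (v i - c))) = 1" for n by (simp add: min_absorb1)
    then show ?thesis using True v by simp
  next
    case False
    obtain n0 :: nat where n0: "1 / (v i - c) < real n0" using reals_Archimedean2 by blast
    have "max 0 (min 1 (1 - real n * (v i - c))) = 0" if "n \<ge> n0" for n
    proof -
      have "1 / (v i - c) \<le> real n" using n0 that by linarith
      then have "1 \<le> real n * (v i - c)" using False by (simp add: field_simps)
      then show ?thesis by simp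
    qed
    then have "\<forall>\<^sub>F n in sequentially. max 0 (min 1 (1 - real n * (v i - c))) = 0"
      unfolding eventually_sequentially by blast
    then show ?thesis using False by (simp add: tendsto_eventually)
  qed
qed auto

lemma L1_approx_coord_set:
  assumes N: "0 < N" and A: "A \<in> sets borel"
  shows "L1_approx_set N {v \<in> sph N. v i \<in> A}"
proof -
  have "A \<in> sigma_sets UNIV (range (\<lambda>a. {..a::real}))"
    using A by (simp add: borel_eq_atMost)
  then show ?thesis
  proof (induction rule: sigma_sets.induct)
    case (Basic a)
    then show ?case using L1_approx_halfspace[OF N] by auto
  next
    case Empty
    have "L1_approx N (pev (C 0))" by (rule L1_approx_pev[OF N])
    moreover have "pev (C 0) = indicator {}" by (simp add: fun_eq_iff)
    ultimately show ?case by (simp add: L1_approx_set_def)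
  next
    case (Compl a)
    have "{v \<in> sph N. v i \<in> UNIV - a} = sph N - {v \<in> sph N. v i \<in> a}" by auto
    then show ?case using L1_approx_set_compl[OF N Compl.IH] by simp
  next
    case (Union a)
    have "{v \<in> sph N. v i \<in> (\<Union>n. a n)} = (\<Union>n. {v \<in> sph N. v i \<in> a n})" by auto
    then show ?case using L1_approx_set_UN[OF N Union.IH] by simp
  qed
qed

lemma L1_approx_set_all:
  assumes N: "0 < N" and A: "A \<in> sets (bor N)"
  shows "L1_approx_set N (A \<inter> sph N)"
proof -
  have "A \<in> sigma_sets (\<Pi>\<^sub>E i\<in>{..<N}. UNIV) {{f\<in>\<Pi>\<^sub>E i\<in>{..<N}. UNIV. f i \<in> A} | i A. i \<in> {..<N} \<and> A \<in> sets (borel :: real measure)}"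
    using A unfolding bor_def sets_PiM_single by simp
  then show ?thesis
  proof (induction rule: sigma_sets.induct)
    case (Basic a)
    then obtain i B where a: "a = {f\<in>\<Pi>\<^sub>E i\<in>{..<N}. UNIV. f i \<in> B}" "B \<in> sets borel" by auto
    have "a \<inter> sph N = {v \<in> sph N. v i \<in> B}" using a by (auto simp: sph_def)
    then show ?case using L1_approx_coord_set[OF N a(2)] by simp
  next
    case Empty
    have "L1_approx N (pev (C 0))" by (rule L1_approx_pev[OF N])
    moreover have "pev (C 0) = indicator {}" by (simp add: fun_eq_iff)
    ultimately show ?case by (simp add: L1_approx_set_def)
  next
    case (Compl a)
    have "(((\<Pi>\<^sub>E i\<in>{..<N}. UNIV) - a) \<inter> sph N) = sph N - (a \<inter> sph N)" by (auto simp: sph_def)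
    then show ?case using L1_approx_set_compl[OF N Compl.IH] by simp
  next
    case (Union a)
    have "(\<Union>n. a n) \<inter> sph N = (\<Union>n. a n \<inter> sph N)" by auto
    then show ?case using L1_approx_set_UN[OF N Union.IH] by simp
  qed
qed

lemma L1_approx_integrable:
  assumes N: "0 < N" and f: "integrable (SN N) f"
  shows "L1_approx N f"
  using f
proof (induction rule: integrable_induct)
  case (base A c)
  then have A: "A \<in> sets (bor N)" "A \<subseteq> sph N"
    by (auto simp: SN_def sets_restrict_space_iff sets_sigmaN)
  then have "L1_approx N (indicator (A \<inter> sph N))" using L1_approx_set_all[OF N A(1)] by (simp add: L1_approx_set_def)
  moreover have "A \<inter> sph N = A" using A by blast
  ultimately show ?case using L1_approx_cmult[OF N, of "indicator A" c] by (simp add: mult.commute)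
next
  case (add f g)
  then show ?case by (intro L1_approx_add N)
next
  case (lim f s)
  show ?case
    by (rule L1_approx_dominated[where s = s and w = "\<lambda>v. 2 * norm (f v)"]) (use lim N in auto)
qed

text \<open>A subsequence of an L1 approximation converges almost everywhere, which is what limits
  of nonlinear functionals of f require.\<close>

lemma polynomial_approximation:
  assumes N: "0 < N" and f: "f \<in> borel_measurable (SN N)" and mM: "m < M"
    and fb: "\<And>v. v \<in> sph N \<Longrightarrow> m \<le> f v \<and> f v \<le> M"
  obtains p :: "nat \<Rightarrow> pol" where "\<And>n v. v \<in> sph N \<Longrightarrow> m \<le> pev (p n) v \<and> pev (p n) v \<le> M"
    "AE v in SN N. (\<lambda>n. pev (p n) v) \<longlonglongrightarrow> f v"
proof -
  interpret prob_space "SN N" by (rule prob_space_SN[OF N])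
  have fi: "integrable (SN N) f"
  proof (rule integrable_const_bound[OF _ f])
    show "AE v in SN N. norm (f v) \<le> \<bar>m\<bar> + \<bar>M\<bar>"
      using fb by (intro AE_I2) (force simp: space_SN)
  qed
  have "\<exists>p. (\<forall>v\<in>sph N. m \<le> pev p v \<and> pev p v \<le> M) \<and> (\<integral>v. \<bar>f v - pev p v\<bar> \<partial>SN N) < 1 / real (Suc n)" for n
    by (rule L1_approx_clamp[OF N L1_approx_integrable[OF N fi] mM _ fb]) auto
  then obtain p where p: "\<And>n v. v \<in> sph N \<Longrightarrow> m \<le> pev (p n) v \<and> pev (p n) v \<le> M"
    "\<And>n. (\<integral>v. \<bar>f v - pev (p n) v\<bar> \<partial>SN N) < 1 / real (Suc n)" by metis
  have i: "integrable (SN N) (\<lambda>v. f v - pev (p n) v)" for n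
    using fi pev_integrable[OF N] by simp
  have "(\<lambda>n. \<integral>v. norm (f v - pev (p n) v) \<partial>SN N) \<longlonglongrightarrow> 0"
  proof (rule tendsto_sandwich[OF _ _ tendsto_const LIMSEQ_inverse_real_of_nat])
    show "\<forall>\<^sub>F n in sequentially. (\<integral>v. norm (f v - pev (p n) v) \<partial>SN N) \<le> inverse (real (Suc n))"
      using p(2) by (intro always_eventually allI less_imp_le) (simp add: inverse_eq_divide)
  qed (auto intro!: always_eventually)
  then obtain r where r: "strict_mono r" "AE v in SN N. (\<lambda>n. f v - pev (p (r n)) v) \<longlonglongrightarrow> 0"
    using tendsto_L1_AE_subseq[of "SN N" "\<lambda>n v. f v - pev (p n) v", OF i] by blast
  have "AE v in SN N. (\<lambda>n. pev (p (r n)) v) \<longlonglongrightarrow> f v"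
    using r(2)
  proof (eventually_elim)
    case (elim v)
    then have "(\<lambda>n. f v - (f v - pev (p (r n)) v)) \<longlonglongrightarrow> f v - 0" by (intro tendsto_intros)
    then show ?case by simp
  qed
  with that[of "\<lambda>n. p (r n)"] p(1) show thesis by blast
qed

section \<open>Entropy production of bounded densities\<close>

lemma compact_measure_TH: "compact_measure TH"
proof -
  interpret prob_space TH by (rule prob_space_TH)
  show ?thesis
  proof
    show "compact (space TH)" by (simp add: space_TH)
    fix f :: "real \<Rightarrow> real" assume "continuous_on (space TH) f"
    then have "f \<in> borel_measurable (restrict_space borel {0..2*pi})"
      unfolding space_TH by (rule borel_measurable_continuous_on_restrict)
    then show "f \<in> borel_measurable TH"
      using measurable_cong_sets[OF sets_TH refl] by blast
  qed
qed

lemma rot_circle_transitive: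
  assumes v: "v \<in> sph 2"
  shows "\<exists>\<theta>. rot 0 1 \<theta> v = (\<lambda>k\<in>{..<2}. if k = 0 then sqrt 2 else 0)"
proof -
  let ?e = "\<lambda>k\<in>{..<2}. if k = 0 then sqrt 2 else 0"
  obtain \<theta> where \<theta>: "rot 0 1 \<theta> v 1 = 0" using kill_coordinate[of 0 1 v] by auto
  define w where "w = rot 0 1 \<theta> v"
  have w: "w \<in> sph 2" unfolding w_def using v by (intro rot_sph) auto
  have "(w 0)^2 = 2" using w \<theta> by (simp add: sph_def sqnorm_def w_def numeral_2_eq_2)
  then have w0: "w 0 = sqrt 2 \<or> w 0 = - sqrt 2"
    by (metis power2_eq_iff real_sqrt_pow2 zero_le_numeral)
  have eqI: "x = ?e" if "x \<in> sph 2" "x 0 = sqrt 2" "x 1 = 0" for x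
  proof
    fix k
    consider "k = 0" | "k = 1" | "k \<notin> {..<2::nat}" by fastforce
    then show "x k = ?e k"
    proof cases
      case 3
      have "x \<in> PiE {..<2} (\<lambda>_. UNIV)" using that(1) by (simp add: sph_def)
      then have "x k = undefined" using 3 by (rule PiE_arb)
      then show ?thesis using 3 by simp
    qed (use that in simp_all)
  qed
  from w0 show ?thesis
  proof
    assume "w 0 = sqrt 2"
    then have "w = ?e" using w \<theta> by (intro eqI) (auto simp: w_def)
    then show ?thesis unfolding w_def by blast
  next
    assume a: "w 0 = - sqrt 2"
    have "rot 0 1 pi w = ?e"
    proof (rule eqI)
      show "rot 0 1 pi w \<in> sph 2" using w by (intro rot_sph) auto
      show "rot 0 1 pi w 0 = sqrt 2" "rot 0 1 pi w 1 = 0"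
        using a \<theta> by (auto simp: rot_def w_def)
    qed
    then have "rot 0 1 (pi + \<theta>) v = ?e" by (simp add: w_def rot_add)
    then show ?thesis by blast
  qed
qed

text \<open>The average over an orbit is rotation invariant, since its derivative in a shift of the
  angle is the integral of a periodic derivative. As the circle is one orbit the average is
  constant, and integrating it in the other order identifies the constant.\<close>

lemma circle_average:
  fixes f f' :: "(nat \<Rightarrow> real) \<Rightarrow> real"
  assumes d: "\<And>v. v \<in> sph 2 \<Longrightarrow> ((\<lambda>\<theta>. f (rot 0 1 \<theta> v)) has_real_derivative f' v) (at 0)"
    and c: "continuous_on (sph 2) f" and c': "continuous_on (sph 2) f'" and v: "v \<in> sph 2"
  shows "(\<integral>\<theta>. f (rot 0 1 \<theta> v) \<partial>TH) = (\<integral>v. f v \<partial>SN 2)"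
proof -
  interpret TH: compact_measure TH by (rule compact_measure_TH)
  let ?R = "rot 0 1"
  have ij: "(0::nat) < 2" "(1::nat) < 2" "(0::nat) \<noteq> 1" by auto
  note d' = rot_deriv_shift[where h = f and h' = f', OF ij d]
  have cr: "continuous_on A (\<lambda>x. g (?R (a x) (b x)))" if "continuous_on (sph 2) g" "continuous_on A a" "continuous_on A b" "b ` A \<subseteq> sph 2"
    for g :: "(nat \<Rightarrow> real) \<Rightarrow> real" and A :: "'b::t2_space set" and a b
    by (rule continuous_on_compose2[OF that(1) rot_continuous[OF that(2,3)]]) (use that(4) rot_sph[OF ij] in auto)
  define A where "A = (\<lambda>v. \<integral>\<theta>. f (?R \<theta> v) \<partial>TH)"
  have inv: "A (?R \<phi> v) = A v" if v: "v \<in> sph 2" for \<phi> v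
  proof -
    let ?g = "\<lambda>\<phi>. \<integral>\<theta>. f (?R (\<theta> + \<phi>) v) \<partial>TH"
    have zero: "(?g has_real_derivative 0) (at x within {-\<bar>\<phi>\<bar>..\<bar>\<phi>\<bar>})" if x: "x \<in> {-\<bar>\<phi>\<bar>..\<bar>\<phi>\<bar>}" for x
    proof -
      have "(?g has_real_derivative (\<integral>\<theta>. f' (?R (\<theta> + x) v) \<partial>TH)) (at x within {-\<bar>\<phi>\<bar>..\<bar>\<phi>\<bar>})"
      proof (rule TH.deriv_integral[OF _ _ _ x])
        fix t \<theta> :: real
        have "((\<lambda>t. \<theta> + t) has_real_derivative 1) (at t)" by (auto intro!: derivative_eq_intros)
        from DERIV_chain2[OF d'[OF _ v] this] show "((\<lambda>t. f (?R (\<theta> + t) v)) has_real_derivative f' (?R (\<theta> + t) v)) (at t within {-\<bar>\<phi>\<bar>..\<bar>\<phi>\<bar>})"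
          by (auto intro: DERIV_subset)
      next
        show "continuous_on (space TH) (\<lambda>\<theta>. f (?R (\<theta> + t) v))" for t
          using v by (intro cr[OF c] continuous_intros) auto
        show "continuous_on ({-\<bar>\<phi>\<bar>..\<bar>\<phi>\<bar>} \<times> space TH) (\<lambda>x. f' (?R (snd x + fst x) v))"
          using v by (intro cr[OF c'] continuous_intros) auto
      qed
      moreover have "(\<integral>\<theta>. f' (?R (\<theta> + x) v) \<partial>TH) = 0"
      proof (rule integral_TH_deriv)
        fix \<theta> :: real
        have "((\<lambda>\<theta>. \<theta> + x) has_real_derivative 1) (at \<theta>)" by (auto intro!: derivative_eq_intros)
        from DERIV_chain2[OF d'[OF _ v] this] show "((\<lambda>\<theta>. f (?R (\<theta> + x) v)) has_real_derivative f' (?R (\<theta> + x) v)) (at \<theta>)"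
          by auto
      next
        show "continuous_on {0..2*pi} (\<lambda>\<theta>. f' (?R (\<theta> + x) v))"
          using v by (intro cr[OF c'] continuous_intros) auto
        show "f (?R (2*pi + x) v) = f (?R (0 + x) v)"
          by (simp add: rot_def sin_add cos_add)
      qed
      ultimately show ?thesis by simp
    qed
    have "\<exists>k. \<forall>x\<in>{-\<bar>\<phi>\<bar>..\<bar>\<phi>\<bar>}. ?g x = k"
      by (rule has_field_derivative_zero_constant[OF _ zero]) auto
    then have "?g \<phi> = ?g 0" by (metis abs_ge_minus_self abs_ge_self abs_ge_zero atLeastAtMost_iff minus_le_iff neg_le_0_iff_le)
    then show ?thesis by (simp add: A_def rot_add)
  qed
  let ?e = "\<lambda>k\<in>{..<2}. if k = 0 then sqrt 2 else 0"
  have A: "A w = A ?e" if "w \<in> sph 2" for w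
    using rot_circle_transitive[OF that] inv[OF that] by metis
  have i: "integrable (PM 2) (\<lambda>x. f (?R (snd x) (fst x)))"
    by (intro continuous_integrable_PM cr[OF c] continuous_intros) auto
  have "(\<integral>v. f v \<partial>SN 2) = (\<integral>\<theta>. (\<integral>v. f (?R \<theta> v) \<partial>SN 2) \<partial>TH)"
  proof -
    have "f \<in> borel_measurable (SN 2)"
      by (rule borel_measurable_integrable[OF continuous_integrable_SN[OF _ c]]) simp
    then have "(\<integral>v. f (?R \<theta> v) \<partial>SN 2) = (\<integral>v. f v \<partial>SN 2)" for \<theta>
      by (intro integral_SN_rot) auto
    then show ?thesis using prob_space.prob_space[OF prob_space_TH] by simp
  qed
  also have "\<dots> = (\<integral>v. A v \<partial>SN 2)"
    using integral_PM_fst[OF _ i] integral_PM_snd(1)[OF _ i] by (simp add: A_def)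
  also have "\<dots> = (\<integral>v. A ?e \<partial>SN 2)"
    by (rule Bochner_Integration.integral_cong) (use A in \<open>auto simp: space_SN\<close>)
  also have "\<dots> = A v"
    using A[OF v] prob_space.prob_space[OF prob_space_SN[of 2]] by simp
  finally show ?thesis by (simp add: A_def)
qed

text \<open>On the circle the weight is the constant 3, and averaging decouples a point from its
  rotated image, so the production is 6 (h - a l) with h, a, l the means of f ln f, f and ln f.
  Jensen's inequality l \<le> ln a bounds the entropy by h - a l.\<close>

lemma dissip_pol_2:
  assumes p: "\<And>v. v \<in> sph 2 \<Longrightarrow> m \<le> pev p v" and m: "0 < m"
  shows "Ent 2 (pev p) / 3 \<le> dissip 2 (pev p)"
proof -
  interpret SN: prob_space "SN 2" by (rule prob_space_SN) simp
  let ?R = "rot 0 1" and ?f = "pev p" and ?l = "\<lambda>v. ln (pev p v)"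
  have ij: "(0::nat) < 2" "(1::nat) < 2" "(0::nat) \<noteq> 1" by auto
  have pp: "0 < ?f v" "?f v \<noteq> 0" if "v \<in> sph 2" for v using p[OF that] m by auto
  have cf: "continuous_on (sph 2) ?f" by (intro pev_continuous continuous_on_id)
  have cX: "continuous_on (sph 2) (pev (X 0 1 p))" by (intro pev_continuous continuous_on_id)
  have cl: "continuous_on (sph 2) ?l" using pp by (intro continuous_on_ln cf) auto
  have df: "((\<lambda>\<theta>. ?f (?R \<theta> v)) has_real_derivative pev (X 0 1 p) v) (at 0)" for v
    using rot_deriv[of 0 1 p v 0] by simp
  have dl: "((\<lambda>\<theta>. ?l (?R \<theta> v)) has_real_derivative pev (X 0 1 p) v / ?f v) (at 0)" if "v \<in> sph 2" for v
    using pp[OF that] by (auto intro!: derivative_eq_intros df simp del: One_nat_def)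
  have dfl: "((\<lambda>\<theta>. ?f (?R \<theta> v) * ?l (?R \<theta> v)) has_real_derivative pev (X 0 1 p) v * ?l v + pev (X 0 1 p) v) (at 0)" if "v \<in> sph 2" for v
    using pp[OF that] by (auto intro!: derivative_eq_intros df dl[OF that] simp del: One_nat_def)
  have avf: "(\<integral>\<theta>. ?f (?R \<theta> v) \<partial>TH) = (\<integral>v. ?f v \<partial>SN 2)" if "v \<in> sph 2" for v
    by (rule circle_average[OF df cf cX that])
  have avl: "(\<integral>\<theta>. ?l (?R \<theta> v) \<partial>TH) = (\<integral>v. ?l v \<partial>SN 2)" if "v \<in> sph 2" for v
    by (rule circle_average[OF dl cl _ that]) (use pp in \<open>auto intro!: continuous_on_divide cX cf simp del: One_nat_def\<close>)
  have avfl: "(\<integral>\<theta>. ?f (?R \<theta> v) * ?l (?R \<theta> v) \<partial>TH) = (\<integral>v. ?f v * ?l v \<partial>SN 2)" if "v \<in> sph 2" for v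
    by (rule circle_average[OF dfl _ _ that]) (auto intro!: continuous_on_mult continuous_on_add cX cf cl simp del: One_nat_def)
  define a where "a = (\<integral>v. ?f v \<partial>SN 2)"
  define l where "l = (\<integral>v. ?l v \<partial>SN 2)"
  define h where "h = (\<integral>v. ?f v * ?l v \<partial>SN 2)"
  have if': "integrable (SN 2) ?f" "integrable (SN 2) ?l"
    by (intro continuous_integrable_SN cf cl; simp)+
  have c1: "continuous_on (sph 2 \<times> {0..2*pi}) (\<lambda>x. g (fst x))" if "continuous_on (sph 2) g" for g :: "_ \<Rightarrow> real"
    by (rule continuous_on_compose2[OF that continuous_on_fst[OF continuous_on_id]]) auto
  have c2: "continuous_on (sph 2 \<times> {0..2*pi}) (\<lambda>x. g (?R (snd x) (fst x)))" if "continuous_on (sph 2) g" for g :: "_ \<Rightarrow> real"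
    by (rule continuous_on_compose2[OF that rot_continuous[OF continuous_on_snd[OF continuous_on_id] continuous_on_fst[OF continuous_on_id]]])
      (use rot_sph[OF ij] in auto)
  have i: "integrable (PM 2) (\<lambda>x. ?f (fst x) * ?l (fst x))"
    "integrable (PM 2) (\<lambda>x. ?f (fst x) * ?l (?R (snd x) (fst x)))"
    "integrable (PM 2) (\<lambda>x. ?l (fst x) * ?f (?R (snd x) (fst x)))"
    "integrable (PM 2) (\<lambda>x. ?f (?R (snd x) (fst x)) * ?l (?R (snd x) (fst x)))"
    by (intro continuous_integrable_PM continuous_on_mult c1[OF cf] c1[OF cl] c2[OF cf] c2[OF cl]; simp)+
  have e1: "(\<integral>x. ?f (fst x) * ?l (fst x) \<partial>PM 2) = h"
    using integral_PM_fst[OF _ i(1)] prob_space.prob_space[OF prob_space_TH] by (simp add: h_def)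
  have e2: "(\<integral>x. ?f (fst x) * ?l (?R (snd x) (fst x)) \<partial>PM 2) = a * l"
  proof -
    have "(\<integral>x. ?f (fst x) * ?l (?R (snd x) (fst x)) \<partial>PM 2) = (\<integral>v. (\<integral>\<theta>. ?f v * ?l (?R \<theta> v) \<partial>TH) \<partial>SN 2)"
      using integral_PM_fst[OF _ i(2)] by simp
    also have "\<dots> = (\<integral>v. ?f v * l \<partial>SN 2)"
      by (rule Bochner_Integration.integral_cong) (auto simp: avl space_SN l_def simp del: One_nat_def)
    finally show ?thesis by (simp add: a_def)
  qed
  have e3: "(\<integral>x. ?l (fst x) * ?f (?R (snd x) (fst x)) \<partial>PM 2) = a * l"
  proof -
    have "(\<integral>x. ?l (fst x) * ?f (?R (snd x) (fst x)) \<partial>PM 2) = (\<integral>v. (\<integral>\<theta>. ?l v * ?f (?R \<theta> v) \<partial>TH) \<partial>SN 2)"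
      using integral_PM_fst[OF _ i(3)] by simp
    also have "\<dots> = (\<integral>v. ?l v * a \<partial>SN 2)"
      by (rule Bochner_Integration.integral_cong) (auto simp: avf space_SN a_def simp del: One_nat_def)
    finally show ?thesis by (simp add: l_def)
  qed
  have e4: "(\<integral>x. ?f (?R (snd x) (fst x)) * ?l (?R (snd x) (fst x)) \<partial>PM 2) = h"
  proof -
    have "(\<integral>x. ?f (?R (snd x) (fst x)) * ?l (?R (snd x) (fst x)) \<partial>PM 2) = (\<integral>v. (\<integral>\<theta>. ?f (?R \<theta> v) * ?l (?R \<theta> v) \<partial>TH) \<partial>SN 2)"
      using integral_PM_fst[OF _ i(4)] by simp
    also have "\<dots> = (\<integral>v. h \<partial>SN 2)"
      by (rule Bochner_Integration.integral_cong) (auto simp: avfl space_SN h_def simp del: One_nat_def)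
    finally show ?thesis by (simp add: SN.prob_space)
  qed
  have pairs: "(\<Sum>i<2. \<Sum>j\<in>{i<..<2}. g i j) = g 0 (1::nat)" for g :: "nat \<Rightarrow> nat \<Rightarrow> real"
  proof -
    have "{0<..<2::nat} = {1}" "{1<..<2::nat} = {}" by auto
    then show ?thesis by (simp add: numeral_2_eq_2 lessThan_Suc)
  qed
  have "dissip 2 ?f = (\<integral>x. 3 * (?f (fst x) * ?l (fst x) - ?f (fst x) * ?l (?R (snd x) (fst x)) - ?l (fst x) * ?f (?R (snd x) (fst x))
     + ?f (?R (snd x) (fst x)) * ?l (?R (snd x) (fst x))) \<partial>PM 2)"
    unfolding dissip_def pairs
  proof (simp, rule Bochner_Integration.integral_cong[OF refl])
    fix x assume "x \<in> space (PM 2)"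
    then have v: "fst x \<in> sph 2" by (auto simp: space_PM)
    have "(fst x 0)^2 + (fst x 1)^2 = 2"
      using v by (simp add: sph_def sqnorm_def numeral_2_eq_2)
    then have w: "1 + (fst x 0)^2 + (fst x 1)^2 = 3" by simp
    show "(1 + (fst x 0)^2 + (fst x (Suc 0))^2) * psi (?f (fst x)) (?f (rot 0 (Suc 0) (snd x) (fst x))) =
      3 * (?f (fst x) * ?l (fst x)) - 3 * (?f (fst x) * ?l (rot 0 (Suc 0) (snd x) (fst x))) - 3 * (?l (fst x) * ?f (rot 0 (Suc 0) (snd x) (fst x)))
      + 3 * (?f (rot 0 (Suc 0) (snd x) (fst x)) * ?l (rot 0 (Suc 0) (snd x) (fst x)))"
      using w psi_pos[OF pp(1)[OF v] pp(1)[OF rot_sph[OF ij v, of "snd x"]]] by (simp add: algebra_simps)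
  qed
  also have "\<dots> = 3 * (h - a * l - a * l + h)"
    using i e1 e2 e3 e4 by simp
  finally have D: "dissip 2 ?f = 6 * (h - a * l)" by simp
  have a: "0 < a"
  proof -
    have "m = (\<integral>v. m \<partial>SN 2)" by (simp add: SN.prob_space)
    also have "\<dots> \<le> a" unfolding a_def using p if' by (intro integral_mono) (auto simp: space_SN)
    finally show ?thesis using m by simp
  qed
  have "l \<le> (\<integral>v. ln a + (?f v / a - 1) \<partial>SN 2)"
    unfolding l_def
  proof (rule integral_mono)
    fix v assume "v \<in> space (SN 2)"
    then have "0 < ?f v" using pp by (simp add: space_SN)
    then show "?l v \<le> ln a + (?f v / a - 1)"
      using ln_le_minus_one[of "?f v / a"] a by (simp add: ln_div)
  qed (use if' in auto)
  also have "\<dots> = ln a" using if' a by (simp add: SN.prob_space a_def[symmetric])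
  finally have "l \<le> ln a" .
  then have "a * l \<le> a * ln a" using a by simp
  then have E: "Ent 2 ?f \<le> h - a * l" by (simp add: Ent_def a_def h_def)
  have "0 \<le> dissip 2 ?f"
    unfolding dissip_def pairs
  proof (simp, rule Bochner_Integration.integral_nonneg)
    fix x assume "x \<in> space (PM 2)"
    then have v: "fst x \<in> sph 2" by (auto simp: space_PM)
    show "0 \<le> (1 + (fst x 0)^2 + (fst x (Suc 0))^2) * psi (?f (fst x)) (?f (rot 0 (Suc 0) (snd x) (fst x)))"
      using psi_nonneg[OF pp(1)[OF v] pp(1)[OF rot_sph[OF ij v, of "snd x"]]] by simp
  qed
  then have "0 \<le> h - a * l" using D by simp
  then have "(h - a * l) / 3 \<le> 6 * (h - a * l)" by simp
  moreover have "Ent 2 ?f / 3 \<le> (h - a * l) / 3" using E by (rule divide_right_mono) simp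
  ultimately show ?thesis unfolding D by (rule order_trans[rotated])
qed

lemma psi_bound:
  assumes "0 < m" "m \<le> x" "x \<le> M" "m \<le> y" "y \<le> M"
  shows "\<bar>psi x y\<bar> \<le> M * (ln M - ln m)"
proof -
  have "\<bar>ln x - ln y\<bar> \<le> ln M - ln m"
  proof -
    have "ln m \<le> ln x" "ln x \<le> ln M" "ln m \<le> ln y" "ln y \<le> ln M" using assms by auto
    then show ?thesis by linarith
  qed
  moreover have "\<bar>x - y\<bar> \<le> M" using assms by linarith
  ultimately show ?thesis using assms by (simp add: psi_pos abs_mult mult_mono)
qed

lemma tendsto_psi:
  assumes "f \<longlonglongrightarrow> x" "g \<longlonglongrightarrow> y" "0 < x" "0 < y"
  shows "(\<lambda>n. psi (f n) (g n)) \<longlonglongrightarrow> psi x y"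
  unfolding psi_def using assms by (intro tendsto_intros) auto

lemma measurable_psi [measurable]:
  assumes "f \<in> borel_measurable M" "g \<in> borel_measurable M"
  shows "(\<lambda>x. psi (f x) (g x)) \<in> borel_measurable M"
  unfolding psi_def using assms by measurable

lemma plane_le: "i < N \<Longrightarrow> j < N \<Longrightarrow> i \<noteq> j \<Longrightarrow> v \<in> sph N \<Longrightarrow> (v i)^2 + (v j)^2 \<le> N"
  using splane_le[of i j N v] by (simp add: pev_splane)

text \<open>Both sides are continuous along polynomials sharing two positive bounds:
  \<open>psi\<close> and the logarithm stay bounded, so dominated convergence applies.\<close>

theorem entropy_production_one:
  assumes N: "2 \<le> N" and f: "f \<in> borel_measurable (SN N)" and m: "0 < m"
    and fb: "\<And>v. v \<in> sph N \<Longrightarrow> m \<le> f v \<and> f v \<le> M"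
  shows "Ent N f / 3 \<le> dissip N f"
proof -
  have N0: "0 < N" using N by simp
  interpret SN: prob_space "SN N" by (rule prob_space_SN[OF N0])
  interpret PM: compact_measure "PM N" by (rule compact_measure_PM[OF N0])
  \<comment> \<open>Strictly above m, since clamping needs a nondegenerate interval.\<close>
  define M' where "M' = max M m + 1"
  have mM: "m < M'" by (simp add: M'_def)
  have fb': "m \<le> f v \<and> f v \<le> M'" if "v \<in> sph N" for v using fb[OF that] by (auto simp: M'_def)
  obtain p where p: "\<And>n v. v \<in> sph N \<Longrightarrow> m \<le> pev (p n) v \<and> pev (p n) v \<le> M'"
    "AE v in SN N. (\<lambda>n. pev (p n) v) \<longlonglongrightarrow> f v"
    using polynomial_approximation[OF N0 f mM fb'] by blast
  note [measurable] = f
  have pm [measurable]: "pev (p n) \<in> borel_measurable (SN N)" for n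
    using pev_integrable[OF N0] by blast
  have "Ent N (pev (p n)) / 3 \<le> dissip N (pev (p n))" for n
  proof (cases "N = 2")
    case True
    then show ?thesis using dissip_pol_2[of m "p n"] p(1) m by blast
  next
    case False
    then show ?thesis using N p(1) m by (intro dissip_pol_ge3[of N m]) auto
  qed
  moreover have "(\<lambda>n. Ent N (pev (p n)) / 3) \<longlonglongrightarrow> Ent N f / 3"
  proof -
    have 1: "(\<lambda>n. \<integral>v. pev (p n) v \<partial>SN N) \<longlonglongrightarrow> (\<integral>v. f v \<partial>SN N)"
    proof (rule integral_dominated_convergence[where w = "\<lambda>_. M'"])
      show "AE v in SN N. norm (pev (p n) v) \<le> M'" for n
      proof (rule AE_I2)
        fix v assume "v \<in> space (SN N)"
        then show "norm (pev (p n) v) \<le> M'" using p(1)[of v n] m by (simp add: space_SN)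
      qed
    qed (use p(2) in auto)
    have 2: "(\<lambda>n. \<integral>v. pev (p n) v * ln (pev (p n) v) \<partial>SN N) \<longlonglongrightarrow> (\<integral>v. f v * ln (f v) \<partial>SN N)"
    proof (rule integral_dominated_convergence[where w = "\<lambda>_. M' * (\<bar>ln m\<bar> + \<bar>ln M'\<bar>)"])
      show "AE v in SN N. norm (pev (p n) v * ln (pev (p n) v)) \<le> M' * (\<bar>ln m\<bar> + \<bar>ln M'\<bar>)" for n
      proof (rule AE_I2)
        fix v assume "v \<in> space (SN N)"
        then have b: "m \<le> pev (p n) v" "pev (p n) v \<le> M'" using p(1) by (auto simp: space_SN)
        then have "ln m \<le> ln (pev (p n) v)" "ln (pev (p n) v) \<le> ln M'" using m by auto
        then have "\<bar>ln (pev (p n) v)\<bar> \<le> \<bar>ln m\<bar> + \<bar>ln M'\<bar>" by linarith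
        then show "norm (pev (p n) v * ln (pev (p n) v)) \<le> M' * (\<bar>ln m\<bar> + \<bar>ln M'\<bar>)"
          using b m unfolding real_norm_def abs_mult by (intro mult_mono) auto
      qed
      show "AE v in SN N. (\<lambda>n. pev (p n) v * ln (pev (p n) v)) \<longlonglongrightarrow> f v * ln (f v)"
        using p(2) AE_space
      proof eventually_elim
        case (elim v)
        then have "f v \<noteq> 0" using fb[of v] m by (auto simp: space_SN)
        with elim show ?case by (intro tendsto_intros) auto
      qed
    qed auto
    have fi: "integrable (SN N) f"
    proof (rule SN.integrable_const_bound[OF AE_I2 f])
      fix v assume "v \<in> space (SN N)"
      then show "norm (f v) \<le> M'" using fb'[of v] m by (simp add: space_SN)
    qed
    have "m = (\<integral>v. m \<partial>SN N)" by (simp add: SN.prob_space)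
    also have "\<dots> \<le> (\<integral>v. f v \<partial>SN N)" using fb fi by (intro integral_mono) (auto simp: space_SN)
    finally have "(\<integral>v. f v \<partial>SN N) \<noteq> 0" using m by simp
    then show ?thesis unfolding Ent_def by (intro tendsto_intros 1 2) auto
  qed
  moreover have "(\<lambda>n. dissip N (pev (p n))) \<longlonglongrightarrow> dissip N f"
    unfolding dissip_def
  proof (intro tendsto_divide tendsto_sum tendsto_const)
    show "real N - 1 \<noteq> 0" using N by simp
    fix i j assume "i \<in> {..<N}" "j \<in> {i<..<N}"
    then have ij: "i < N" "j < N" "i \<noteq> j" by auto
    note [measurable] = measurable_rot_PM[OF ij]
    have [measurable]: "fst \<in> measurable (PM N) (SN N)" by (simp add: PM_def)
    show "(\<lambda>n. \<integral>x. (1 + (fst x i)^2 + (fst x j)^2) * psi (pev (p n) (fst x)) (pev (p n) (rot i j (snd x) (fst x))) \<partial>PM N)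
      \<longlonglongrightarrow> (\<integral>x. (1 + (fst x i)^2 + (fst x j)^2) * psi (f (fst x)) (f (rot i j (snd x) (fst x))) \<partial>PM N)"
    proof (rule integral_dominated_convergence[where w = "\<lambda>_. (1 + N) * (M' * (ln M' - ln m))"])
      show "AE x in PM N. (\<lambda>n. (1 + (fst x i)^2 + (fst x j)^2) * psi (pev (p n) (fst x)) (pev (p n) (rot i j (snd x) (fst x)))) \<longlonglongrightarrow>
         (1 + (fst x i)^2 + (fst x j)^2) * psi (f (fst x)) (f (rot i j (snd x) (fst x)))"
        using AE_PM_fst[OF N0 p(2)] AE_PM_rot[OF ij p(2)] AE_space
      proof eventually_elim
        case (elim x)
        then have v: "fst x \<in> sph N" by (auto simp: space_PM)
        have "0 < f (fst x)" "0 < f (rot i j (snd x) (fst x))"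
          using fb[OF v] fb[OF rot_sph[OF ij v, of "snd x"]] m by auto
        with elim show ?case by (intro tendsto_mult tendsto_const tendsto_psi)
      qed
      show "AE x in PM N. norm ((1 + (fst x i)^2 + (fst x j)^2) * psi (pev (p n) (fst x)) (pev (p n) (rot i j (snd x) (fst x))))
         \<le> (1 + N) * (M' * (ln M' - ln m))" for n
      proof (rule AE_I2)
        fix x assume "x \<in> space (PM N)"
        then have v: "fst x \<in> sph N" by (auto simp: space_PM)
        have "\<bar>psi (pev (p n) (fst x)) (pev (p n) (rot i j (snd x) (fst x)))\<bar> \<le> M' * (ln M' - ln m)"
          using p(1)[OF v, of n] p(1)[OF rot_sph[OF ij v, of "snd x"], of n] m by (intro psi_bound) auto
        moreover have "\<bar>1 + (fst x i)^2 + (fst x j)^2\<bar> \<le> 1 + N" using plane_le[OF ij v] by simp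
        ultimately show "norm ((1 + (fst x i)^2 + (fst x j)^2) * psi (pev (p n) (fst x)) (pev (p n) (rot i j (snd x) (fst x))))
         \<le> (1 + N) * (M' * (ln M' - ln m))"
          unfolding real_norm_def abs_mult by (intro mult_mono) auto
      qed
    qed measurable
  qed
  ultimately show ?thesis by (intro LIMSEQ_le[of "\<lambda>n. Ent N (pev (p n)) / 3" _ "\<lambda>n. dissip N (pev (p n))"]) auto
qed

section \<open>Interpolation in the collision weight\<close>

definition gdissip :: "nat \<Rightarrow> real \<Rightarrow> ((nat \<Rightarrow> real) \<Rightarrow> real) \<Rightarrow> real" where
  "gdissip N \<gamma> f = (\<Sum>i<N. \<Sum>j\<in>{i<..<N}. \<integral>x. (1 + (fst x i)^2 + (fst x j)^2) powr \<gamma> *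
     psi (f (fst x)) (f (rot i j (snd x) (fst x))) \<partial>PM N) / (real N - 1)"

lemma measurable_rot_pair:
  assumes "i < N" "j < N"
  shows "(\<lambda>x. rot i j (snd x) (fst x)) \<in> measurable (bor N \<Otimes>\<^sub>M borel) (bor N)"
proof (rule measurable_borI)
  have c [measurable]: "(\<lambda>x. fst x k) \<in> borel_measurable (bor N \<Otimes>\<^sub>M (borel :: real measure))" for k
    by (rule measurable_compose[OF measurable_fst coord_measurable])
  fix k
  consider "k = j" | "k = i" "k \<noteq> j" | "k \<noteq> i" "k \<noteq> j" by blast
  then show "(\<lambda>x. rot i j (snd x) (fst x) k) \<in> borel_measurable (bor N \<Otimes>\<^sub>M borel)"
    by cases (auto simp: rot_def)
qed (use assms in \<open>auto simp: space_pair_measure space_bor rot_def extensional_def PiE_def\<close>)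

lemma entropy_production_eq:
  assumes N: "2 \<le> N" and f [measurable]: "f \<in> borel_measurable (bor N)"
    and int: "\<And>i j. i < N \<Longrightarrow> j < N \<Longrightarrow> i \<noteq> j \<Longrightarrow> integrable (PM N) (\<lambda>x. (1 + (fst x i)^2 + (fst x j)^2) powr \<gamma> *
      psi (f (fst x)) (f (rot i j (snd x) (fst x))))"
  shows "entropy_production N \<gamma> f = gdissip N \<gamma> f"
proof -
  have N0: "0 < N" using N by simp
  have ij_eq: "(\<integral>v. (LBINT \<theta>=0..2*pi. (1 + (v i)^2 + (v j)^2) powr \<gamma> * psi (f v) (f (rot i j \<theta> v))) \<partial>sigmaN N)
    = 2 * pi * (\<integral>x. (1 + (fst x i)^2 + (fst x j)^2) powr \<gamma> * psi (f (fst x)) (f (rot i j (snd x) (fst x))) \<partial>PM N)"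
    if ij: "i < N" "j < N" "i \<noteq> j" for i j
  proof -
    let ?g = "\<lambda>v \<theta>. (1 + (v i)^2 + (v j)^2) powr \<gamma> * psi (f v) (f (rot i j \<theta> v))"
    note [measurable] = measurable_rot_pair[OF ij(1,2)]
    have c [measurable]: "(\<lambda>x. fst x k) \<in> borel_measurable (bor N \<Otimes>\<^sub>M (borel :: real measure))" for k
      by (rule measurable_compose[OF measurable_fst coord_measurable])
    have gm: "(\<lambda>x. ?g (fst x) (snd x)) \<in> borel_measurable (bor N \<Otimes>\<^sub>M borel)"
    proof -
      have [measurable]: "(\<lambda>x. f (fst x)) \<in> borel_measurable (bor N \<Otimes>\<^sub>M (borel :: real measure))"
        "(\<lambda>x. f (rot i j (snd x) (fst x))) \<in> borel_measurable (bor N \<Otimes>\<^sub>M (borel :: real measure))"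
        by (rule measurable_compose[OF measurable_fst f], rule measurable_compose[OF measurable_rot_pair[OF ij(1,2)] f])
      show ?thesis by measurable
    qed
    have gv: "?g v \<in> borel_measurable borel" if "v \<in> space (bor N)" for v
      using measurable_compose[OF measurable_Pair1'[OF that] gm] by (simp only: fst_conv snd_conv)
    have L: "(LBINT \<theta>=0..2*pi. ?g v \<theta>) = (LINT \<theta>:{0..2*pi}|lborel. ?g v \<theta>)" for v
      using interval_integral_Icc[of 0 "2*pi" "?g v"] by (simp add: zero_ereal_def)
    have hm: "(\<lambda>v. LBINT \<theta>=0..2*pi. ?g v \<theta>) \<in> borel_measurable (bor N)"
    proof -
      have "(\<lambda>x. indicator {0..2*pi} (snd x) *\<^sub>R ?g (fst x) (snd x)) \<in> borel_measurable (bor N \<Otimes>\<^sub>M lborel)"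
        using gm by measurable
      then have "(\<lambda>v. \<integral>\<theta>. indicator {0..2*pi} \<theta> *\<^sub>R ?g v \<theta> \<partial>lborel) \<in> borel_measurable (bor N)"
        by (intro lborel.borel_measurable_lebesgue_integral) (simp add: case_prod_beta')
      then show ?thesis unfolding L set_lebesgue_integral_def .
    qed
    have "(\<integral>v. (LBINT \<theta>=0..2*pi. ?g v \<theta>) \<partial>sigmaN N) = (\<integral>v. (LBINT \<theta>=0..2*pi. ?g v \<theta>) \<partial>SN N)"
      using integral_SN[OF N0 hm] by simp
    also have "\<dots> = (\<integral>v. 2 * pi * (\<integral>\<theta>. ?g v \<theta> \<partial>TH) \<partial>SN N)"
    proof (rule Bochner_Integration.integral_cong[OF refl])
      fix v assume "v \<in> space (SN N)"
      then have "v \<in> space (bor N)" using sph_subset by (auto simp: space_SN)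
      then have "?g v \<in> borel_measurable (restrict_space borel {0..2*pi})"
        by (intro measurable_restrict_space1 gv)
      then have "(\<integral>\<theta>. ?g v \<theta> \<partial>TH) = (LINT \<theta>:{0..2*pi}|lborel. ?g v \<theta>) / (2*pi)" by (rule integral_TH)
      then show "(LBINT \<theta>=0..2*pi. ?g v \<theta>) = 2 * pi * (\<integral>\<theta>. ?g v \<theta> \<partial>TH)"
        unfolding L by simp
    qed
    also have "\<dots> = 2 * pi * (\<integral>x. ?g (fst x) (snd x) \<partial>PM N)"
      using integral_PM_fst[OF N0 int[OF ij]] by simp
    finally show ?thesis .
  qed
  have ch: "real (N choose 2) = real N * (real N - 1) / 2"
  proof -
    have "even (N * (N - 1))" by (cases N) auto
    then have "2 * (N choose 2) = N * (N - 1)" unfolding choose_two by (rule dvd_mult_div_cancel)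
    then have "2 * real (N choose 2) = real N * real (N - 1)" by (metis of_nat_mult of_nat_numeral)
    then show ?thesis using N by (simp add: of_nat_diff)
  qed
  have c: "1 / (4 * pi) * (real N / real (N choose 2)) = 1 / (2 * pi * (real N - 1))"
    unfolding ch using N by simp
  have "(\<Sum>i<N. \<Sum>j\<in>{i<..<N}. \<integral>v. (LBINT \<theta>=0..2*pi. (1 + (v i)^2 + (v j)^2) powr \<gamma> * psi (f v) (f (rot i j \<theta> v))) \<partial>sigmaN N)
    = 2 * pi * (\<Sum>i<N. \<Sum>j\<in>{i<..<N}. \<integral>x. (1 + (fst x i)^2 + (fst x j)^2) powr \<gamma> * psi (f (fst x)) (f (rot i j (snd x) (fst x))) \<partial>PM N)"
    unfolding sum_distrib_left by (intro sum.cong refl ij_eq) auto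
  then show ?thesis
    unfolding entropy_production_def gdissip_def c using N by simp
qed

lemma integral_PM_fst_only:
  fixes g :: "(nat \<Rightarrow> real) \<Rightarrow> real"
  assumes N: "0 < N" and g: "g \<in> borel_measurable (SN N)"
  shows "(\<integral>x. g (fst x) \<partial>PM N) = (\<integral>v. g v \<partial>SN N)"
proof -
  have d: "distr (PM N) (SN N) fst = SN N"
    unfolding PM_def by (rule prob_space.distr_pair_fst[OF prob_space_TH])
  have "fst \<in> measurable (PM N) (SN N)" by (simp add: PM_def)
  from integral_distr[OF this g] show ?thesis unfolding d by simp
qed

lemma integral_PM_rot:
  fixes g :: "(nat \<Rightarrow> real) \<Rightarrow> real"
  assumes "i < N" "j < N" "i \<noteq> j" and g: "g \<in> borel_measurable (SN N)"
  shows "(\<integral>x. g (rot i j (snd x) (fst x)) \<partial>PM N) = (\<integral>v. g v \<partial>SN N)"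
  using integral_distr[OF measurable_rot_PM[OF assms(1-3)] g] unfolding distr_rot_PM[OF assms(1-3)] by simp

lemma nn_integral_SN:
  assumes "0 < N" "f \<in> borel_measurable (bor N)"
  shows "(\<integral>\<^sup>+v. f v \<partial>SN N) = (\<integral>\<^sup>+v. f v \<partial>sigmaN N)"
proof -
  have [measurable]: "f \<in> borel_measurable (sigmaN N)" using assms(2) by measurable
  have "(\<integral>\<^sup>+v. f v \<partial>SN N) = (\<integral>\<^sup>+v. f v * indicator (sph N) v \<partial>sigmaN N)"
    unfolding SN_def by (rule nn_integral_restrict_space) simp
  also have "\<dots> = (\<integral>\<^sup>+v. f v \<partial>sigmaN N)"
    using AE_sph[OF assms(1)] by (intro nn_integral_cong_AE) auto
  finally show ?thesis .
qed

text \<open>The transposition of 0 and i preserves the measure and, on the sphere, the values of f.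
  A moment bound for the first coordinate thus serves every coordinate.\<close>

lemma nn_integral_coord_sym:
  assumes N: "0 < N" and i: "i < N" and f [measurable]: "f \<in> borel_measurable (bor N)"
    and sym: "symmetric_density N f" and \<phi> [measurable]: "\<phi> \<in> borel_measurable borel"
  shows "(\<integral>\<^sup>+v. ennreal (\<phi> (v i) * f v) \<partial>sigmaN N) = (\<integral>\<^sup>+v. ennreal (\<phi> (v 0) * f v) \<partial>sigmaN N)"
proof -
  define p where "p = Transposition.transpose 0 i"
  have p: "p permutes {..<N}" unfolding p_def using N i by (intro permutes_swap_id) auto
  have pm: "(\<lambda>x. x \<circ> p) \<in> measurable (bor N) (bor N)" using perm_preserves_lebN[OF p] by (simp add: preserves_lebN_def)
  have pm': "(\<lambda>x. x \<circ> p) \<in> measurable (sigmaN N) (bor N)"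
    using pm measurable_cong_sets[OF sets_sigmaN refl] by blast
  have hm: "(\<lambda>v. ennreal (\<phi> (v 0) * f v)) \<in> borel_measurable (bor N)" by measurable
  have "(\<integral>\<^sup>+v. ennreal (\<phi> (v 0) * f v) \<partial>sigmaN N) = (\<integral>\<^sup>+v. ennreal (\<phi> (v 0) * f v) \<partial>distr (sigmaN N) (bor N) (\<lambda>x. x \<circ> p))"
    by (simp only: sigmaN_perm[OF p])
  also have "\<dots> = (\<integral>\<^sup>+v. ennreal (\<phi> ((v \<circ> p) 0) * f (v \<circ> p)) \<partial>sigmaN N)"
    by (rule nn_integral_distr[OF pm']) (use hm in simp)
  also have "\<dots> = (\<integral>\<^sup>+v. ennreal (\<phi> (v i) * f v) \<partial>sigmaN N)"
  proof (rule nn_integral_cong_AE)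
    show "AE v in sigmaN N. ennreal (\<phi> ((v \<circ> p) 0) * f (v \<circ> p)) = ennreal (\<phi> (v i) * f v)"
      using AE_sph[OF N]
    proof eventually_elim
      case (elim v)
      then have "f (v \<circ> p) = f v" using sym p by (auto simp: symmetric_density_def)
      then show ?case by (simp add: p_def)
    qed
  qed
  finally show ?thesis by simp
qed

text \<open>One member of the family, with K in the role of C_F N.\<close>

locale log_density =
  fixes N :: nat and f :: "(nat \<Rightarrow> real) \<Rightarrow> real" and K :: real
  assumes N: "2 \<le> N" and dens: "prob_density N f" and sym: "symmetric_density N f"
    and pos: "\<And>v. v \<in> sph N \<Longrightarrow> 0 < f v" and K: "\<And>v. v \<in> sph N \<Longrightarrow> \<bar>ln (f v)\<bar> \<le> K"
begin

lemma N0: "0 < N" using N by simp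

sublocale SN: prob_space "SN N" by (rule prob_space_SN[OF N0])
sublocale PM: compact_measure "PM N" by (rule compact_measure_PM[OF N0])

lemma f_bor [measurable]: "f \<in> borel_measurable (bor N)"
  using dens measurable_cong_sets[OF sets_sigmaN refl] by (auto simp: prob_density_def)

lemma f_SN [measurable]: "f \<in> borel_measurable (SN N)"
  by (rule measurable_SN1[OF f_bor])

lemma f_bounds: "v \<in> sph N \<Longrightarrow> exp (-K) \<le> f v \<and> f v \<le> exp K"
proof -
  assume v: "v \<in> sph N"
  have "- K \<le> ln (f v)" "ln (f v) \<le> K" using K[OF v] by auto
  then have "exp (-K) \<le> exp (ln (f v))" "exp (ln (f v)) \<le> exp K" by auto
  then show ?thesis using pos[OF v] by simp
qed

lemma f_integrable: "integrable (SN N) f"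
proof (rule SN.integrable_const_bound[OF AE_I2 f_SN])
  fix v assume "v \<in> space (SN N)"
  then show "norm (f v) \<le> exp K" using f_bounds[of v] pos[of v] by (simp add: space_SN)
qed

lemma f_mass: "(\<integral>v. f v \<partial>SN N) = 1"
  using integral_SN[OF N0 f_bor] dens by (simp add: prob_density_def)

lemma rel_entropy_SN: "rel_entropy N f = (\<integral>v. f v * ln (f v) \<partial>SN N)"
  unfolding rel_entropy_def by (rule integral_SN[OF N0, symmetric]) measurable

lemma Ent_eq: "Ent N f = rel_entropy N f"
  by (simp add: Ent_def f_mass rel_entropy_SN)

lemma flnf_integrable: "integrable (SN N) (\<lambda>v. f v * ln (f v))"
proof (rule SN.integrable_const_bound[OF AE_I2])
  fix v assume "v \<in> space (SN N)"
  then have v: "v \<in> sph N" by (simp add: space_SN)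
  show "norm (f v * ln (f v)) \<le> exp K * K"
    using f_bounds[OF v] pos[OF v] K[OF v] unfolding real_norm_def abs_mult by (intro mult_mono) auto
qed measurable

lemma rel_entropy_nonneg: "0 \<le> rel_entropy N f"
proof -
  have "(\<integral>v. f v - 1 \<partial>SN N) \<le> rel_entropy N f"
    unfolding rel_entropy_SN
  proof (rule integral_mono[OF _ flnf_integrable])
    fix v assume "v \<in> space (SN N)"
    then have p: "0 < f v" using pos by (simp add: space_SN)
    have "- ln (f v) \<le> 1 / f v - 1" using ln_le_minus_one[of "1 / f v"] p by (simp add: ln_div)
    from mult_left_mono[OF this, of "f v"] p show "f v - 1 \<le> f v * ln (f v)" by (simp add: algebra_simps)
  qed (use f_integrable in simp)
  then show ?thesis using f_integrable f_mass by (simp add: SN.prob_space)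
qed

lemma rel_entropy_le: "rel_entropy N f \<le> K"
proof -
  have "rel_entropy N f \<le> (\<integral>v. K * f v \<partial>SN N)"
    unfolding rel_entropy_SN
  proof (rule integral_mono[OF flnf_integrable])
    fix v assume "v \<in> space (SN N)"
    then have v: "v \<in> sph N" by (simp add: space_SN)
    show "f v * ln (f v) \<le> K * f v"
      using mult_left_mono[of "ln (f v)" K "f v"] K[OF v] pos[OF v] by (simp add: mult.commute)
  qed (use f_integrable in simp)
  then show ?thesis using f_mass by simp
qed

text \<open>A general g serves the weights 1 + s and (1 + s)^\<gamma> and the truncated weight
  alike.\<close>

lemma psi_integrable:
  assumes ij: "i < N" "j < N" "i \<noteq> j" and g [measurable]: "g \<in> borel_measurable borel"
    and gb: "\<And>x :: real. 0 \<le> x \<Longrightarrow> x \<le> real N \<Longrightarrow> \<bar>g x\<bar> \<le> B"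
  shows "integrable (PM N) (\<lambda>x. g ((fst x i)^2 + (fst x j)^2) * psi (f (fst x)) (f (rot i j (snd x) (fst x))))"
proof (rule PM.integrable_const_bound[OF AE_I2])
  note [measurable] = measurable_rot_PM[OF ij]
  have [measurable]: "fst \<in> measurable (PM N) (SN N)" by (simp add: PM_def)
  show "(\<lambda>x. g ((fst x i)^2 + (fst x j)^2) * psi (f (fst x)) (f (rot i j (snd x) (fst x)))) \<in> borel_measurable (PM N)"
    by measurable
  fix x assume "x \<in> space (PM N)"
  then have v: "fst x \<in> sph N" by (auto simp: space_PM)
  have "\<bar>psi (f (fst x)) (f (rot i j (snd x) (fst x)))\<bar> \<le> exp K * (ln (exp K) - ln (exp (-K)))"
    using f_bounds[OF v] f_bounds[OF rot_sph[OF ij v, of "snd x"]] by (intro psi_bound) auto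
  moreover have "\<bar>g ((fst x i)^2 + (fst x j)^2)\<bar> \<le> B"
    using plane_le[OF ij v] by (intro gb) auto
  ultimately show "norm (g ((fst x i)^2 + (fst x j)^2) * psi (f (fst x)) (f (rot i j (snd x) (fst x)))) \<le> B * (exp K * (ln (exp K) - ln (exp (-K))))"
    unfolding real_norm_def abs_mult by (intro mult_mono order_trans[OF abs_ge_zero]) auto
qed

lemma psi_powr_integrable:
  assumes ij: "i < N" "j < N" "i \<noteq> j" and \<gamma>: "0 \<le> \<gamma>"
  shows "integrable (PM N) (\<lambda>x. (1 + (fst x i)^2 + (fst x j)^2) powr \<gamma> * psi (f (fst x)) (f (rot i j (snd x) (fst x))))"
proof -
  have "integrable (PM N) (\<lambda>x. (\<lambda>s. (1 + s) powr \<gamma>) ((fst x i)^2 + (fst x j)^2) * psi (f (fst x)) (f (rot i j (snd x) (fst x))))"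
    by (rule psi_integrable[OF ij, of _ "(1 + N) powr \<gamma>"]) (use \<gamma> in \<open>auto intro!: powr_mono2\<close>)
  then show ?thesis by (simp add: add.assoc)
qed

lemma entropy_production_gdissip: "0 \<le> \<gamma> \<Longrightarrow> entropy_production N \<gamma> f = gdissip N \<gamma> f"
  by (intro entropy_production_eq N f_bor psi_powr_integrable)

lemma psi_le:
  assumes "v \<in> sph N" "w \<in> sph N"
  shows "psi (f v) (f w) \<le> 2 * K * (f v + f w)"
proof -
  have p: "0 < f v" "0 < f w" using pos assms by auto
  have "\<bar>ln (f v) - ln (f w)\<bar> \<le> 2 * K" using K[OF assms(1)] K[OF assms(2)] by linarith
  moreover have "\<bar>f v - f w\<bar> \<le> f v + f w" using p by linarith
  ultimately have "\<bar>f v - f w\<bar> * \<bar>ln (f v) - ln (f w)\<bar> \<le> (f v + f w) * (2 * K)"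
    by (intro mult_mono) auto
  then show ?thesis using p by (simp add: psi_pos abs_mult[symmetric] mult_ac)
qed

text \<open>\<open>\<phi>\<close> splits the tail of the weight into functions of single
  coordinates, where the marginal bound B applies; c0 is paid with the total mass 1. The computation
  uses nonnegative integrals, so integrability of \<phi> is not an issue.\<close>

lemma tail_coordinate_bound:
  assumes ij: "i < N" "j < N"
    and \<phi> [measurable]: "\<phi> \<in> borel_measurable borel" and \<phi>0: "\<And>x. 0 \<le> \<phi> x" and c0: "0 \<le> c0" and B0: "0 \<le> B"
    and tail: "\<And>x y. 1 + x^2 + y^2 > R \<Longrightarrow> 1 + x^2 + y^2 \<le> c0 + \<phi> x + \<phi> y"
    and B: "(\<integral>\<^sup>+v. ennreal (\<phi> (v 0) * f v) \<partial>sigmaN N) \<le> ennreal B"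
  shows "(\<integral>v. (if 1 + (v i)^2 + (v j)^2 > R then 1 + (v i)^2 + (v j)^2 else 0) * f v \<partial>SN N) \<le> c0 + 2 * B"
proof -
  let ?h = "\<lambda>v :: nat \<Rightarrow> real. (if 1 + (v i)^2 + (v j)^2 > R then 1 + (v i)^2 + (v j)^2 else 0)"
  have cm [measurable]: "(\<lambda>v. v k) \<in> borel_measurable (SN N)" for k
    by (rule measurable_SN1[OF coord_measurable])
  have \<phi>B: "(\<integral>\<^sup>+v. ennreal (\<phi> (v k) * f v) \<partial>SN N) \<le> ennreal B" if "k < N" for k
    using nn_integral_coord_sym[OF N0 that f_bor sym \<phi>] B
    by (subst nn_integral_SN[OF N0]) auto
  have f1: "(\<integral>\<^sup>+v. ennreal (c0 * f v) \<partial>SN N) = ennreal c0"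
  proof -
    have "(\<integral>\<^sup>+v. ennreal (c0 * f v) \<partial>SN N) = ennreal (\<integral>v. c0 * f v \<partial>SN N)"
    proof (rule nn_integral_eq_integral)
      show "AE v in SN N. 0 \<le> c0 * f v"
      proof (rule AE_I2)
        fix v assume "v \<in> space (SN N)"
        then have "0 \<le> f v" using pos[of v] by (simp add: space_SN)
        then show "0 \<le> c0 * f v" using c0 by simp
      qed
    qed (use f_integrable in simp)
    then show ?thesis by (simp add: f_mass)
  qed
  have "(\<integral>\<^sup>+v. ennreal (?h v * f v) \<partial>SN N) \<le> (\<integral>\<^sup>+v. (ennreal (c0 * f v) + ennreal (\<phi> (v i) * f v)) + ennreal (\<phi> (v j) * f v) \<partial>SN N)"
  proof (rule nn_integral_mono)
    fix v assume "v \<in> space (SN N)"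
    then have p: "0 \<le> f v" using pos[of v] by (simp add: space_SN)
    have "?h v \<le> c0 + \<phi> (v i) + \<phi> (v j)"
      using tail[of "v i" "v j"] c0 \<phi>0[of "v i"] \<phi>0[of "v j"] by auto
    from mult_right_mono[OF this p] have "?h v * f v \<le> c0 * f v + \<phi> (v i) * f v + \<phi> (v j) * f v"
      by (simp only: distrib_right)
    then have "ennreal (?h v * f v) \<le> ennreal (c0 * f v + \<phi> (v i) * f v + \<phi> (v j) * f v)" by (rule ennreal_leI)
    also have "\<dots> = (ennreal (c0 * f v) + ennreal (\<phi> (v i) * f v)) + ennreal (\<phi> (v j) * f v)"
      using p c0 \<phi>0 by (simp add: ennreal_plus)
    finally show "ennreal (?h v * f v) \<le> (ennreal (c0 * f v) + ennreal (\<phi> (v i) * f v)) + ennreal (\<phi> (v j) * f v)" .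
  qed
  also have "\<dots> = (\<integral>\<^sup>+v. ennreal (c0 * f v) \<partial>SN N) + (\<integral>\<^sup>+v. ennreal (\<phi> (v i) * f v) \<partial>SN N) + (\<integral>\<^sup>+v. ennreal (\<phi> (v j) * f v) \<partial>SN N)"
  proof -
    have m: "(\<lambda>v. ennreal (c0 * f v)) \<in> borel_measurable (SN N)" "(\<lambda>v. ennreal (\<phi> (v k) * f v)) \<in> borel_measurable (SN N)" for k
      by measurable
    show ?thesis
      unfolding nn_integral_add[OF borel_measurable_add[OF m(1) m(2)] m(2)] nn_integral_add[OF m(1) m(2)] ..
  qed
  also have "\<dots> \<le> ennreal c0 + ennreal B + ennreal B"
    unfolding f1 by (intro add_mono order_refl \<phi>B ij)
  also have "\<dots> = ennreal (c0 + 2 * B)" using c0 B0 by (simp add: ennreal_plus[symmetric] del: ennreal_plus)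
  finally have "(\<integral>\<^sup>+v. ennreal (?h v * f v) \<partial>SN N) \<le> ennreal (c0 + 2 * B)" .
  then have "enn2real (\<integral>\<^sup>+v. ennreal (?h v * f v) \<partial>SN N) \<le> c0 + 2 * B"
    using c0 B0 by (intro enn2real_leI) auto
  moreover have "(\<integral>v. ?h v * f v \<partial>SN N) = enn2real (\<integral>\<^sup>+v. ennreal (?h v * f v) \<partial>SN N)"
  proof (rule integral_eq_nn_integral)
    show "AE v in SN N. 0 \<le> ?h v * f v"
    proof (rule AE_I2)
      fix v assume "v \<in> space (SN N)"
      then have "0 \<le> f v" using pos[of v] by (simp add: space_SN)
      moreover have "0 \<le> ?h v" by (simp add: add_nonneg_nonneg)
      ultimately show "0 \<le> ?h v * f v" by (rule mult_nonneg_nonneg[rotated])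
    qed
  qed measurable
  ultimately show ?thesis by simp
qed

text \<open>The common source of both moment results. Each pair loses at most 4 K (c0 + 2 B) to the
  tail; there are N (N - 1) / 2 pairs and a division by N - 1, which gives the loss 2 K N (c0 + 2
  B).\<close>

lemma interpolation:
  assumes \<gamma>: "0 \<le> \<gamma>" "\<gamma> < 1" and R: "0 < R"
    and \<phi>: "\<phi> \<in> borel_measurable borel" "\<And>x. 0 \<le> \<phi> x" and c0: "0 \<le> c0" and B0: "0 \<le> B"
    and tail: "\<And>x y. 1 + x^2 + y^2 > R \<Longrightarrow> 1 + x^2 + y^2 \<le> c0 + \<phi> x + \<phi> y"
    and B: "(\<integral>\<^sup>+v. ennreal (\<phi> (v 0) * f v) \<partial>sigmaN N) \<le> ennreal B"
  shows "R powr (\<gamma> - 1) * (rel_entropy N f / 3 - 2 * K * N * (c0 + 2 * B)) \<le> entropy_production N \<gamma> f"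
proof -
  let ?T = "c0 + 2 * B"
  have K0: "0 \<le> K" using rel_entropy_nonneg rel_entropy_le by linarith
  let ?w = "\<lambda>i j x. 1 + (fst x i)^2 + (fst x j)^2 :: real"
  let ?psi = "\<lambda>i j x. psi (f (fst x)) (f (rot i j (snd x) (fst x)))"
  let ?h = "\<lambda>i j v. (if 1 + (v i)^2 + (v j)^2 > R then 1 + (v i)^2 + (v j)^2 else 0) :: real"
  have main: "R powr (\<gamma> - 1) * ((\<integral>x. ?w i j x * ?psi i j x \<partial>PM N) - 4 * K * ?T) \<le> (\<integral>x. ?w i j x powr \<gamma> * ?psi i j x \<partial>PM N)"
    if ij: "i < N" "j < N" "i \<noteq> j" for i j
  proof -
    have i1: "integrable (PM N) (\<lambda>x. ?w i j x powr \<gamma> * ?psi i j x)" by (rule psi_powr_integrable[OF ij \<gamma>(1)])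
    have i2: "integrable (PM N) (\<lambda>x. ?w i j x * ?psi i j x)"
    proof -
      have "integrable (PM N) (\<lambda>x. (\<lambda>s. 1 + s) ((fst x i)^2 + (fst x j)^2) * ?psi i j x)"
        by (rule psi_integrable[OF ij, of _ "1 + N"]) auto
      then show ?thesis unfolding add.assoc .
    qed
    have i3: "integrable (PM N) (\<lambda>x. ?h i j (fst x) * ?psi i j x)"
    proof -
      have "integrable (PM N) (\<lambda>x. (\<lambda>s. if 1 + s > R then 1 + s else 0) ((fst x i)^2 + (fst x j)^2) * ?psi i j x)"
        by (rule psi_integrable[OF ij, of _ "1 + N"]) auto
      then show ?thesis unfolding add.assoc .
    qed
    note rotm [measurable] = measurable_rot_PM[OF ij]
    have fstm [measurable]: "fst \<in> measurable (PM N) (SN N)" by (simp add: PM_def)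
    have cm [measurable]: "(\<lambda>v. v k) \<in> borel_measurable (SN N)" for k
      by (rule measurable_SN1[OF coord_measurable])
    have hb: "\<bar>?h i j v * f v\<bar> \<le> (1 + N) * exp K" if v: "v \<in> sph N" for v
      using plane_le[OF ij v] f_bounds[OF v] pos[OF v] unfolding abs_mult by (intro mult_mono) auto
    have hfm: "(\<lambda>v. ?h i j v * f v) \<in> borel_measurable (SN N)" by measurable
    have i4: "integrable (PM N) (\<lambda>x. ?h i j (fst x) * f (fst x))"
      "integrable (PM N) (\<lambda>x. ?h i j (rot i j (snd x) (fst x)) * f (rot i j (snd x) (fst x)))"
    proof -
      show "integrable (PM N) (\<lambda>x. ?h i j (fst x) * f (fst x))"
        by (rule PM.integrable_const_bound[OF AE_I2 measurable_compose[OF fstm hfm]])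
          (unfold real_norm_def, rule hb, auto simp: space_PM)
      show "integrable (PM N) (\<lambda>x. ?h i j (rot i j (snd x) (fst x)) * f (rot i j (snd x) (fst x)))"
        by (rule PM.integrable_const_bound[OF AE_I2 measurable_compose[OF rotm hfm]])
          (unfold real_norm_def, rule hb, auto simp: space_PM intro: rot_sph[OF ij])
    qed
    \<comment> \<open>The cut-off depends only on v_i^2 + v_j^2, which the rotation preserves, so
      the terms with f at v and at the rotated point have equal tail integrals.\<close>
    have hrot: "?h i j (rot i j \<theta> v) = ?h i j v" for \<theta> v
    proof -
      have "(rot i j \<theta> v i)^2 + (rot i j \<theta> v j)^2 = ((v i)^2 + (v j)^2) * ((sin \<theta>)^2 + (cos \<theta>)^2)"
        unfolding rot_i[OF ij(3)] rot_j by algebra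
      then have "1 + (rot i j \<theta> v i)^2 + (rot i j \<theta> v j)^2 = 1 + (v i)^2 + (v j)^2" by simp
      then show ?thesis by simp
    qed
    have "(\<integral>x. ?h i j (fst x) * ?psi i j x \<partial>PM N) \<le> (\<integral>x. 2 * K * (?h i j (fst x) * f (fst x) + ?h i j (rot i j (snd x) (fst x)) * f (rot i j (snd x) (fst x))) \<partial>PM N)"
    proof (rule integral_mono[OF i3])
      fix x assume "x \<in> space (PM N)"
      then have v: "fst x \<in> sph N" by (auto simp: space_PM)
      have "0 \<le> ?h i j (fst x)" by (simp add: add_nonneg_nonneg)
      from mult_left_mono[OF psi_le[OF v rot_sph[OF ij v, of "snd x"]] this]
      have "?h i j (fst x) * ?psi i j x \<le> ?h i j (fst x) * (2 * K * (f (fst x) + f (rot i j (snd x) (fst x))))" .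
      moreover have "h * (2 * K * (a + b)) = 2 * K * (h * a + h * b)" for h a b :: real
        by (simp add: algebra_simps)
      ultimately show "?h i j (fst x) * ?psi i j x \<le> 2 * K * (?h i j (fst x) * f (fst x) + ?h i j (rot i j (snd x) (fst x)) * f (rot i j (snd x) (fst x)))"
        unfolding hrot by (simp only:)
    qed (use i4 in simp)
    also have "\<dots> = 2 * K * ((\<integral>v. ?h i j v * f v \<partial>SN N) + (\<integral>v. ?h i j v * f v \<partial>SN N))"
      using i4 integral_PM_fst_only[OF N0 hfm] integral_PM_rot[OF ij hfm] by simp
    also have "\<dots> \<le> 2 * K * (?T + ?T)"
      using K0 tail_coordinate_bound[OF ij(1,2) \<phi> c0 B0 tail B] by (intro mult_left_mono add_mono) auto
    also have "\<dots> = 4 * K * ?T" by (simp add: algebra_simps)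
    finally have t: "(\<integral>x. ?h i j (fst x) * ?psi i j x \<partial>PM N) \<le> 4 * K * ?T" .
    have "R powr (\<gamma> - 1) * ((\<integral>x. ?w i j x * ?psi i j x \<partial>PM N) - 4 * K * ?T) \<le>
       R powr (\<gamma> - 1) * ((\<integral>x. ?w i j x * ?psi i j x \<partial>PM N) - (\<integral>x. ?h i j (fst x) * ?psi i j x \<partial>PM N))"
      using t by (intro mult_left_mono) auto
    also have "\<dots> = (\<integral>x. R powr (\<gamma> - 1) * (?w i j x * ?psi i j x - ?h i j (fst x) * ?psi i j x) \<partial>PM N)"
      using i2 i3 by simp
    also have "\<dots> \<le> (\<integral>x. ?w i j x powr \<gamma> * ?psi i j x \<partial>PM N)"
    proof (rule integral_mono[OF _ i1])
      show "integrable (PM N) (\<lambda>x. R powr (\<gamma> - 1) * (?w i j x * ?psi i j x - ?h i j (fst x) * ?psi i j x))"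
        using i2 i3 by simp
      fix x assume "x \<in> space (PM N)"
      then have v: "fst x \<in> sph N" by (auto simp: space_PM)
      have psi0: "0 \<le> ?psi i j x"
        by (rule psi_nonneg[OF pos[OF v] pos[OF rot_sph[OF ij v]]])
      have w1: "1 \<le> ?w i j x" by simp
      \<comment> \<open>Above the level R the difference on the left is 0. Below it w^\<gamma> =
        w^(\<gamma> - 1) w, and the power with negative exponent is at least R^(\<gamma> -
        1).\<close>
      have "R powr (\<gamma> - 1) * (?w i j x - ?h i j (fst x)) \<le> ?w i j x powr \<gamma>"
      proof (cases "?w i j x > R")
        case False
        have "?w i j x powr \<gamma> = ?w i j x powr (\<gamma> - 1) * ?w i j x powr 1"
          unfolding powr_add[symmetric] by simp
        also have "\<dots> = ?w i j x powr (\<gamma> - 1) * ?w i j x" using w1 by simp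
        also have "\<dots> \<ge> R powr (\<gamma> - 1) * ?w i j x"
        proof (rule mult_right_mono)
          show "R powr (\<gamma> - 1) \<le> ?w i j x powr (\<gamma> - 1)"
            by (rule powr_mono2') (use False w1 \<gamma> in linarith)+
        qed (use w1 in linarith)
        finally show ?thesis using False by simp
      qed simp
      from mult_right_mono[OF this psi0]
      show "R powr (\<gamma> - 1) * (?w i j x * ?psi i j x - ?h i j (fst x) * ?psi i j x) \<le> ?w i j x powr \<gamma> * ?psi i j x"
        by (simp only: left_diff_distrib mult.assoc)
    qed
    finally show ?thesis .
  qed
  let ?c = "R powr (\<gamma> - 1)"
  have card: "(\<Sum>i<N. \<Sum>j\<in>{i<..<N}. (1::real)) = N * (real N - 1) / 2"
  proof -
    have "(\<Sum>i<N. \<Sum>j<N. if i = j then 0 else 1 :: real) = 2 * (\<Sum>i<N. \<Sum>j\<in>{i<..<N}. if i = j then 0 else 1)"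
      by (rule sum_pairs_sym) auto
    also have "(\<Sum>i<N. \<Sum>j\<in>{i<..<N}. if i = j then 0 else 1 :: real) = (\<Sum>i<N. \<Sum>j\<in>{i<..<N}. 1)"
      by (intro sum.cong) auto
    also have "(\<Sum>i<N. \<Sum>j<N. if i = j then 0 else 1 :: real) = (\<Sum>i<N. \<Sum>j<N. 1 - (if i = j then 1 else 0))"
      by (intro sum.cong refl) auto
    also have "\<dots> = N * (real N - 1)" by (simp add: sum_subtractf algebra_simps)
    finally show ?thesis by simp
  qed
  have "?c * (rel_entropy N f / 3 - 2 * K * N * ?T) \<le> ?c * (dissip N f - 2 * K * N * ?T)"
    using entropy_production_one[OF N f_SN, of "exp (-K)" "exp K"] f_bounds
    by (intro mult_left_mono) (auto simp: Ent_eq)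
  also have "\<dots> = ?c * ((\<Sum>i<N. \<Sum>j\<in>{i<..<N}. \<integral>x. ?w i j x * ?psi i j x \<partial>PM N) - 4 * K * ?T * (\<Sum>i<N. \<Sum>j\<in>{i<..<N}. 1)) / (real N - 1)"
    unfolding card dissip_def using N by (simp add: field_simps)
  also have "\<dots> = (\<Sum>i<N. \<Sum>j\<in>{i<..<N}. ?c * ((\<integral>x. ?w i j x * ?psi i j x \<partial>PM N) - 4 * K * ?T)) / (real N - 1)"
    by (simp only: sum_distrib_left sum_subtractf mult_1_right right_diff_distrib)
  also have "\<dots> \<le> (\<Sum>i<N. \<Sum>j\<in>{i<..<N}. \<integral>x. ?w i j x powr \<gamma> * ?psi i j x \<partial>PM N) / (real N - 1)"
    using N by (intro divide_right_mono sum_mono main) auto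
  also have "\<dots> = entropy_production N \<gamma> f"
    by (simp add: entropy_production_gdissip[OF \<gamma>(1)] gdissip_def)
  finally show ?thesis .
qed

lemma entropy_production_nonneg:
  assumes \<gamma>: "0 \<le> \<gamma>"
  shows "0 \<le> entropy_production N \<gamma> f"
  unfolding entropy_production_gdissip[OF \<gamma>] gdissip_def
proof (intro divide_nonneg_nonneg sum_nonneg Bochner_Integration.integral_nonneg)
  fix i j x assume "i \<in> {..<N}" "j \<in> {i<..<N}" "x \<in> space (PM N)"
  then have ij: "i < N" "j < N" "i \<noteq> j" and v: "fst x \<in> sph N" by (auto simp: space_PM)
  show "0 \<le> (1 + (fst x i)^2 + (fst x j)^2) powr \<gamma> * psi (f (fst x)) (f (rot i j (snd x) (fst x)))"
    using psi_nonneg[OF pos[OF v] pos[OF rot_sph[OF ij v, of "snd x"]]] by simp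
qed (use N in simp)

end

section \<open>Moment bounds and the main theorem\<close>

lemma moment_marginal1:
  assumes f: "f \<in> borel_measurable (bor N)" and N: "0 < N" and pos: "\<And>v. v \<in> sph N \<Longrightarrow> 0 \<le> f v"
  shows "moment r (marginal1 N f) = (\<integral>\<^sup>+v. ennreal (\<bar>v 0\<bar> powr r * f v) \<partial>sigmaN N)"
proof -
  have fm [measurable]: "f \<in> borel_measurable (sigmaN N)" using f by measurable
  have cm [measurable]: "(\<lambda>v. v 0) \<in> borel_measurable (sigmaN N)"
    using coord_measurable[of 0 N] by measurable
  have "moment r (marginal1 N f) = (\<integral>\<^sup>+v. ennreal (\<bar>v 0\<bar> powr r) \<partial>density (sigmaN N) (\<lambda>v. ennreal (f v)))"
    unfolding moment_def marginal1_def by (subst nn_integral_distr) auto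
  also have "\<dots> = (\<integral>\<^sup>+v. ennreal (f v) * ennreal (\<bar>v 0\<bar> powr r) \<partial>sigmaN N)"
    by (rule nn_integral_density) measurable
  also have "\<dots> = (\<integral>\<^sup>+v. ennreal (\<bar>v 0\<bar> powr r * f v) \<partial>sigmaN N)"
    using AE_sph[OF N] by (intro nn_integral_cong_AE) (auto simp: ennreal_mult pos mult.commute)
  finally show ?thesis .
qed

text \<open>Jensen with weights 1/3. Convexity is applied to positive arguments, and zero values are
  reached by shifting all three by 1 / (n + 1).\<close>

lemma powr_sum3_le:
  fixes x y z :: real
  assumes k: "1 \<le> k" and "0 \<le> x" "0 \<le> y" "0 \<le> z"
  shows "(x + y + z) powr k \<le> 3 powr (k - 1) * (x powr k + y powr k + z powr k)"
proof -
  have pos: "(x + y + z) powr k \<le> 3 powr (k - 1) * (x powr k + y powr k + z powr k)"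
    if "0 < x" "0 < y" "0 < z" for x y z :: real
  proof -
    have "((1/3) * x + (1/3) * y + (1/3) * z) powr k \<le> (1/3) * x powr k + (1/3) * y powr k + (1/3) * z powr k"
      using convex_on_sum[OF _ _ powr_convex[OF k], of "{0,1,2::nat}" "\<lambda>_. 1/3" "\<lambda>i. if i = 0 then x else if i = 1 then y else z"] that
      by (simp add: add.assoc split: if_splits)
    then have "((x + y + z) / 3) powr k \<le> (x powr k + y powr k + z powr k) / 3" by (simp add: add_divide_distrib)
    moreover have "((x + y + z) / 3) powr k = (x + y + z) powr k / 3 powr k"
      using that by (simp add: powr_divide)
    moreover have "(3::real) powr k = 3 powr (k - 1) * 3" by (simp add: powr_diff)
    ultimately have "(x + y + z) powr k = 3 powr (k - 1) * (3 * ((x + y + z) / 3) powr k)" by simp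
    also have "\<dots> \<le> 3 powr (k - 1) * (x powr k + y powr k + z powr k)"
      using \<open>((x + y + z) / 3) powr k \<le> _\<close> by (intro mult_left_mono) auto
    finally show ?thesis .
  qed
  let ?d = "\<lambda>n. inverse (real (Suc n))"
  have l: "(\<lambda>n. (t + c * ?d n) powr k) \<longlonglongrightarrow> t powr k" if "0 \<le> t" "0 \<le> c" for t c :: real
  proof (rule tendsto_powr')
    have "(\<lambda>n. t + c * ?d n) \<longlonglongrightarrow> t + c * 0"
      by (intro tendsto_intros LIMSEQ_inverse_real_of_nat)
    then show "(\<lambda>n. t + c * ?d n) \<longlonglongrightarrow> t" by simp
  qed (use that k in \<open>auto intro!: always_eventually\<close>)
  show ?thesis
  proof (rule LIMSEQ_le)
    show "(\<lambda>n. ((x + y + z) + 3 * ?d n) powr k) \<longlonglongrightarrow> (x + y + z) powr k"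
      by (rule l) (use assms in auto)
    show "(\<lambda>n. 3 powr (k - 1) * ((x + 1 * ?d n) powr k + (y + 1 * ?d n) powr k + (z + 1 * ?d n) powr k))
      \<longlonglongrightarrow> 3 powr (k - 1) * (x powr k + y powr k + z powr k)"
      by (intro tendsto_mult tendsto_add tendsto_const l assms) auto
    have "((x + y + z) + 3 * ?d n) powr k \<le> 3 powr (k - 1) * ((x + 1 * ?d n) powr k + (y + 1 * ?d n) powr k + (z + 1 * ?d n) powr k)" for n
      using pos[of "x + ?d n" "y + ?d n" "z + ?d n"] assms by (simp add: add_nonneg_pos algebra_simps)
    then show "\<exists>N. \<forall>n\<ge>N. ((x + y + z) + 3 * ?d n) powr k \<le> 3 powr (k - 1) * ((x + 1 * ?d n) powr k + (y + 1 * ?d n) powr k + (z + 1 * ?d n) powr k)"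
      by blast
  qed
qed

lemma square_powr: "(t\<^sup>2) powr k = \<bar>t\<bar> powr (2 * k)" for t k :: real
proof (cases "t = 0")
  case False
  then have "t\<^sup>2 = \<bar>t\<bar> powr 2" by (simp add: powr_numeral)
  then show ?thesis by (simp only: powr_powr)
qed simp

text \<open>The constant is the maximum of z exp(- c z^p), attained where c p z^p = 1; the
  inequality ln x \<le> x - 1 replaces the calculus.\<close>

lemma exp_powr_sup:
  fixes z p c :: real
  assumes z: "0 < z" and p: "0 < p" and c: "0 < c"
  shows "z \<le> (1 / (c * p * exp 1)) powr (1 / p) * exp (c * z powr p)"
proof -
  define y where "y = z powr p"
  have y: "0 < y" using z by (simp add: y_def)
  have "ln (c * p * y) \<le> c * p * y - 1" using ln_le_minus_one[of "c * p * y"] y p c by simp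
  then have "ln y \<le> ln (1 / (c * p * exp 1)) + c * p * y"
    using y p c by (simp add: ln_mult ln_div)
  then have "ln y / p \<le> (ln (1 / (c * p * exp 1)) + c * p * y) / p"
    using p by (intro divide_right_mono) auto
  moreover have "ln y / p = ln z" using z p by (simp add: y_def ln_powr)
  ultimately have "ln z \<le> 1 / p * ln (1 / (c * p * exp 1)) + c * y" using p by (simp add: add_divide_distrib)
  then have "exp (ln z) \<le> exp (1 / p * ln (1 / (c * p * exp 1)) + c * y)" by simp
  then show ?thesis
    using z p c by (simp add: exp_add powr_def y_def)
qed

text \<open>The algebra behind the optimal choice of the truncation level \<open>R\<close> in the polynomial case.\<close>

lemma optimal_truncation:
  fixes k \<gamma> h C M n :: real
  assumes k: "1 < k" and \<gamma>: "0 \<le> \<gamma>" "\<gamma> < 1" and h: "0 < h" and C: "0 < C" and M: "0 \<le> M" and n: "0 < n"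
    and d: "\<And>R. 0 < R \<Longrightarrow> R powr (\<gamma> - 1) * (h / 3 - 2 * C * n * (R powr (1 - k) * 3 powr (k - 1) * (1 + 2 * M))) \<le> d"
  shows "((k - 1) / (3 powr ((2*k - \<gamma>*k - \<gamma>) / (k - 1)) * (1 - \<gamma>))
             * ((1 - \<gamma>) / (k - \<gamma>)) powr ((k - \<gamma>) / (k - 1))
             * (1 / ((2 * C) powr ((1 - \<gamma>) / (k - 1)) * (1 + 2 * M) powr ((1 - \<gamma>) / (k - 1))))
             * n powr ((\<gamma> - 1) / (k - 1)))
           * h powr (1 + (1 - \<gamma>) / (k - 1)) \<le> d"
proof -
  define e where "e = (1 - \<gamma>) / (k - 1)"
  define a where "a = (1 - \<gamma>) / (k - \<gamma>)"
  define Q where "Q = 2 * C * n * (1 + 2 * M)"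
  define B where "B = Q * 3 powr (k - 1)"
  have kg: "0 < k - \<gamma>" "0 < 1 - \<gamma>" "0 < k - 1" using k \<gamma> by auto
  have e: "0 < e" and a: "0 < a" and Q: "0 < Q" and B: "0 < B"
    using kg C M n by (simp_all add: e_def a_def Q_def B_def)
  \<comment> \<open>The value of R^(1 - k) that maximises R^(\<gamma> - 1) (h / 3 - B R^(1 - k)):
    setting the derivative to zero gives (k - \<gamma>) B R^(1 - k) = (1 - \<gamma>) h / 3.\<close>
  define r where "r = a * (h / 3) / B"
  have r: "0 < r" using a h B by (simp add: r_def)
  define R where "R = r powr (- 1 / (k - 1))"
  have R: "0 < R" using r by (simp add: R_def)
  have R1: "R powr (1 - k) = r"
  proof -
    have "- 1 / (k - 1) * (1 - k) = 1" using kg by (simp add: field_simps)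
    then show ?thesis unfolding R_def powr_powr using r by simp
  qed
  have R2: "R powr (\<gamma> - 1) = r powr e"
  proof -
    have "- 1 / (k - 1) * (\<gamma> - 1) = e" using kg by (simp add: e_def field_simps)
    then show ?thesis unfolding R_def powr_powr by simp
  qed
  have "2 * C * n * (R powr (1 - k) * 3 powr (k - 1) * (1 + 2 * M)) = B * r"
    by (simp add: R1 B_def Q_def mult_ac)
  also have "\<dots> = a * (h / 3)" using B by (simp add: r_def)
  finally have "h / 3 - 2 * C * n * (R powr (1 - k) * 3 powr (k - 1) * (1 + 2 * M)) = (1 - a) * (h / 3)"
    by (simp add: algebra_simps)
  moreover have "1 - a = (k - 1) / (k - \<gamma>)" using kg by (simp add: a_def field_simps)
  ultimately have d1: "r powr e * ((k - 1) / (k - \<gamma>) * (h / 3)) \<le> d"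
    using d[OF R] by (simp add: R2)
  have re: "r powr e = a powr e * h powr e / Q powr e * 3 powr (- e - (1 - \<gamma>))"
  proof -
    have "B powr e = Q powr e * 3 powr (1 - \<gamma>)"
      unfolding B_def using Q kg by (simp add: powr_mult powr_powr e_def)
    then have "r powr e = a powr e * h powr e / (3 powr e * (Q powr e * 3 powr (1 - \<gamma>)))"
      unfolding r_def using a h B by (simp add: powr_mult powr_divide)
    also have "\<dots> = a powr e * h powr e / Q powr e * (1 / (3 powr e * 3 powr (1 - \<gamma>)))" by simp
    also have "1 / (3 powr e * 3 powr (1 - \<gamma>)) = 3 powr (- (e + (1 - \<gamma>)))"
      unfolding powr_minus_divide powr_add ..
    also have "- (e + (1 - \<gamma>)) = - e - (1 - \<gamma>)" by simp
    finally show ?thesis .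
  qed
  define Z where "Z = (k - 1) / (k - \<gamma>) * (a powr e * h powr e * h / Q powr e)"
  have Z: "0 \<le> Z" using kg a h Q by (simp add: Z_def)
  define p where "p = (2*k - \<gamma>*k - \<gamma>) / (k - 1)"
  have pe: "p = (e + (1 - \<gamma>) + 1) + e"
  proof -
    have "p * (k - 1) = 2*k - \<gamma>*k - \<gamma>" "e * (k - 1) = 1 - \<gamma>" using kg by (simp_all add: p_def e_def)
    then have "(p - ((e + (1 - \<gamma>) + 1) + e)) * (k - 1) = 0" by algebra
    then show ?thesis using kg by simp
  qed
  \<comment> \<open>The stated power of 3 exceeds the one obtained from the optimal R by the
    exponent e > 0, so the optimum is stronger by a factor 3^e.\<close>
  have "Z * 3 powr (- p) \<le> Z * 3 powr (- e - (1 - \<gamma>) - 1)"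
    using Z e by (intro mult_left_mono) (auto simp: pe)
  also have "\<dots> = r powr e * ((k - 1) / (k - \<gamma>) * (h / 3))"
  proof -
    have "3 powr (- e - (1 - \<gamma>) - 1) = 3 powr (- e - (1 - \<gamma>)) / (3::real)" by (subst powr_diff) simp
    moreover have "x * (s * t * y / q) * (w / 3) = s * t / q * w * (x * (y / 3))" for x s t y q w :: real
      by simp
    ultimately show ?thesis unfolding re Z_def by (simp only:)
  qed
  finally have Zd: "Z * 3 powr (- p) \<le> d" using d1 by simp
  have ke: "(k - \<gamma>) / (k - 1) = 1 + e" "(\<gamma> - 1) / (k - 1) = - e"
    using kg by (simp_all add: e_def field_simps)
  have Qe: "Q powr e = (2 * C) powr e * (1 + 2 * M) powr e * n powr e"
  proof -
    have "Q = ((2 * C) * (1 + 2 * M)) * n" by (simp add: Q_def mult_ac)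
    then have "Q powr e = ((2 * C) * (1 + 2 * M)) powr e * n powr e"
      using C M n by (simp only:, subst powr_mult) auto
    also have "((2 * C) * (1 + 2 * M)) powr e = (2 * C) powr e * (1 + 2 * M) powr e"
      using C M by (subst powr_mult) auto
    finally show ?thesis .
  qed
  have "((k - 1) / (3 powr p * (1 - \<gamma>)) * a powr (1 + e)
             * (1 / ((2 * C) powr e * (1 + 2 * M) powr e)) * n powr (- e)) * h powr (1 + e) = Z * 3 powr (- p)"
  proof -
    have "a powr (1 + e) = a * a powr e" "h powr (1 + e) = h * h powr e" using a h by (simp_all add: powr_add)
    moreover have "(k - 1) / (3 powr p * (1 - \<gamma>)) * a = (k - 1) / (k - \<gamma>) * 3 powr (- p)"
      using kg by (simp add: a_def powr_minus_divide)
    moreover have "(1 / ((2 * C) powr e * (1 + 2 * M) powr e)) * n powr (- e) = 1 / Q powr e"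
      unfolding Qe by (simp add: powr_minus_divide)
    ultimately have "((k - 1) / (3 powr p * (1 - \<gamma>)) * a powr (1 + e)
             * (1 / ((2 * C) powr e * (1 + 2 * M) powr e)) * n powr (- e)) * h powr (1 + e) =
       ((k - 1) / (k - \<gamma>) * 3 powr (- p)) * a powr e * (1 / Q powr e) * (h * h powr e)"
      by (metis (no_types, opaque_lifting) mult.assoc)
    then show ?thesis by (simp add: Z_def)
  qed
  then show ?thesis using Zd unfolding ke e_def[symmetric] a_def[symmetric] p_def[symmetric] by simp
qed

context log_density
begin

text \<open>The tail function is c |x|^(2k) with c = R^(1 - k) 3^(k - 1). For a weight w > R write w
  = w^(1 - k) w^k: the first factor is below R^(1 - k) and convexity splits the second.\<close>

lemma polynomial_moment_bound:
  fixes \<gamma> k C M :: real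
  assumes \<gamma>: "0 \<le> \<gamma>" "\<gamma> < 1" and k: "1 < k" and C: "K = C * N" "0 < C"
    and M: "moment (2 * k) (marginal1 N f) \<le> ennreal M" "0 \<le> M"
  shows "((k - 1) / (3 powr ((2*k - \<gamma>*k - \<gamma>) / (k - 1)) * (1 - \<gamma>))
             * ((1 - \<gamma>) / (k - \<gamma>)) powr ((k - \<gamma>) / (k - 1))
             * (1 / ((2 * C) powr ((1 - \<gamma>) / (k - 1)) * (1 + 2 * M) powr ((1 - \<gamma>) / (k - 1))))
             * real N powr ((\<gamma> - 1) / (k - 1)))
           * (rel_entropy N f / real N) powr (1 + (1 - \<gamma>) / (k - 1)) \<le> entropy_production N \<gamma> f / real N"
proof (cases "rel_entropy N f = 0")
  case True
  then show ?thesis using entropy_production_nonneg[OF \<gamma>(1)] by simp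
next
  case False
  then have h: "0 < rel_entropy N f" using rel_entropy_nonneg by simp
  show ?thesis
  proof (rule optimal_truncation[OF k \<gamma> _ C(2) M(2)])
    show "0 < rel_entropy N f / real N" "0 < real N" using h N0 by simp_all
    fix R :: real assume R: "0 < R"
    define c where "c = R powr (1 - k) * 3 powr (k - 1)"
    have c: "0 \<le> c" by (simp add: c_def)
    have "R powr (\<gamma> - 1) * (rel_entropy N f / 3 - 2 * K * N * (c + 2 * (c * M))) \<le> entropy_production N \<gamma> f"
    proof (rule interpolation[OF \<gamma> R, where \<phi> = "\<lambda>x. c * \<bar>x\<bar> powr (2 * k)"])
      show "(\<lambda>x. c * \<bar>x\<bar> powr (2 * k)) \<in> borel_measurable borel" by measurable
      show "1 + x\<^sup>2 + y\<^sup>2 \<le> c + c * \<bar>x\<bar> powr (2 * k) + c * \<bar>y\<bar> powr (2 * k)" if "R < 1 + x\<^sup>2 + y\<^sup>2" for x y :: real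
      proof -
        let ?w = "1 + x\<^sup>2 + y\<^sup>2"
        have w: "0 < ?w" by (simp add: add_pos_nonneg)
        have "?w = ?w powr (1 - k) * ?w powr k" using w by (simp add: powr_add[symmetric])
        also have "\<dots> \<le> R powr (1 - k) * (3 powr (k - 1) * (1 powr k + (x\<^sup>2) powr k + (y\<^sup>2) powr k))"
          using that R k w by (intro mult_mono powr_mono2' powr_sum3_le) auto
        also have "\<dots> = c + c * \<bar>x\<bar> powr (2 * k) + c * \<bar>y\<bar> powr (2 * k)"
          unfolding square_powr c_def by (simp add: algebra_simps)
        finally show ?thesis .
      qed
      have mm: "(\<lambda>v. ennreal (\<bar>v 0\<bar> powr (2 * k) * f v)) \<in> borel_measurable (sigmaN N)"
      proof -
        have "(\<lambda>v. ennreal (\<bar>v 0\<bar> powr (2 * k) * f v)) \<in> borel_measurable (bor N)" by measurable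
        then show ?thesis using measurable_cong_sets[OF sets_sigmaN refl] by blast
      qed
      have "(\<integral>\<^sup>+v. ennreal (c * \<bar>v 0\<bar> powr (2 * k) * f v) \<partial>sigmaN N) = ennreal c * (\<integral>\<^sup>+v. ennreal (\<bar>v 0\<bar> powr (2 * k) * f v) \<partial>sigmaN N)"
        unfolding nn_integral_cmult[OF mm, symmetric] using c by (intro nn_integral_cong) (simp add: ennreal_mult' mult.assoc)
      also have "\<dots> = ennreal c * moment (2 * k) (marginal1 N f)"
        using pos by (subst moment_marginal1[OF f_bor N0]) (auto intro: less_imp_le)
      also have "\<dots> \<le> ennreal c * ennreal M" using M(1) by (rule mult_left_mono) simp
      also have "\<dots> = ennreal (c * M)" using c M(2) by (simp add: ennreal_mult)
      finally show "(\<integral>\<^sup>+v. ennreal (c * \<bar>v 0\<bar> powr (2 * k) * f v) \<partial>sigmaN N) \<le> ennreal (c * M)" .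
    qed (use c M(2) in auto)
    then have "R powr (\<gamma> - 1) * (rel_entropy N f / 3 - 2 * K * N * (c + 2 * (c * M))) / N \<le> entropy_production N \<gamma> f / N"
      by (rule divide_right_mono) simp
    moreover have "R powr (\<gamma> - 1) * (rel_entropy N f / 3 - 2 * K * N * (c + 2 * (c * M))) / N =
      R powr (\<gamma> - 1) * (rel_entropy N f / real N / 3 - 2 * C * real N * (R powr (1 - k) * 3 powr (k - 1) * (1 + 2 * M)))"
      unfolding c_def[symmetric] C(1) using N0 by (simp add: field_simps)
    ultimately show "R powr (\<gamma> - 1) * (rel_entropy N f / real N / 3 - 2 * C * real N * (R powr (1 - k) * 3 powr (k - 1) * (1 + 2 * M)))
        \<le> entropy_production N \<gamma> f / real N" by (simp only:)
  qed
qed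

lemma exponential_moment_bound:
  fixes \<gamma> a \<mu> C M :: real
  assumes \<gamma>: "0 \<le> \<gamma>" "\<gamma> < 1" and a: "0 < a" and \<mu>: "0 < \<mu>" and C: "K = C * N" "0 < C"
    and M: "(\<integral>\<^sup>+v. ennreal (exp (a * \<bar>v 0\<bar> powr \<mu>) * f v) \<partial>sigmaN N) \<le> ennreal M"
  shows "1 / (6 * 4 powr (1 - \<gamma>) *
                ((2 / a) * ln (96 * C * (4 / (a * \<mu> * exp 1)) powr (2 / \<mu>)
                               * exp (a / 2 powr (\<mu> / 2)) * M)
                 + (2 / a) * ln (real N / (rel_entropy N f / real N)))
                powr (2 * (1 - \<gamma>) / \<mu>))
           * (rel_entropy N f / real N) \<le> entropy_production N \<gamma> f / real N"
proof (cases "rel_entropy N f = 0")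
  case True
  \<comment> \<open>Here the quotient N / 0 is 0 and the logarithm says nothing, but the whole
    right-hand side is multiplied by the vanishing entropy.\<close>
  then show ?thesis using entropy_production_nonneg[OF \<gamma>(1)] by simp
next
  case False
  define h where "h = rel_entropy N f / real N"
  have h: "0 < h" using rel_entropy_nonneg False N0 by (simp add: h_def)
  have hC: "h \<le> C" using rel_entropy_le C N0 by (simp add: h_def field_simps)
  define p where "p = \<mu> / 2"
  have p: "0 < p" using \<mu> by (simp add: p_def)
  define Q where "Q = (4 / (a * \<mu> * exp 1)) powr (2 / \<mu>)"
  define E where "E = exp (a / 2 powr (\<mu> / 2))"
  have Q: "0 < Q" and E: "0 < E" using a \<mu> by (simp_all add: Q_def E_def)
  have Qsup: "z \<le> Q * exp (a / 2 * z powr p)" if "0 < z" for z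
  proof -
    have "4 / (a * \<mu> * exp 1) = 1 / (a / 2 * p * exp 1)" "2 / \<mu> = 1 / p"
      using a \<mu> by (simp_all add: p_def field_simps)
    then show ?thesis using exp_powr_sup[OF that p, of "a / 2"] a by (simp add: Q_def)
  qed
  have Ehalf: "E = exp (a * (1/2) powr p)"
    by (simp add: E_def p_def powr_divide)
  have M1: "1 \<le> M"
  proof -
    have "1 = (\<integral>\<^sup>+v. ennreal (f v) \<partial>sigmaN N)"
    proof -
      have "(\<integral>\<^sup>+v. ennreal (f v) \<partial>SN N) = ennreal (\<integral>v. f v \<partial>SN N)"
        by (rule nn_integral_eq_integral[OF f_integrable AE_I2]) (use pos in \<open>auto simp: space_SN intro: less_imp_le\<close>)
      moreover have "(\<integral>\<^sup>+v. ennreal (f v) \<partial>SN N) = (\<integral>\<^sup>+v. ennreal (f v) \<partial>sigmaN N)"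
        by (rule nn_integral_SN[OF N0]) measurable
      ultimately show ?thesis by (simp add: f_mass)
    qed
    also have "\<dots> \<le> (\<integral>\<^sup>+v. ennreal (exp (a * \<bar>v 0\<bar> powr \<mu>) * f v) \<partial>sigmaN N)"
    proof (rule nn_integral_mono_AE)
      show "AE v in sigmaN N. ennreal (f v) \<le> ennreal (exp (a * \<bar>v 0\<bar> powr \<mu>) * f v)"
        using AE_sph[OF N0]
      proof eventually_elim
        case (elim v)
        have "1 * f v \<le> exp (a * \<bar>v 0\<bar> powr \<mu>) * f v"
          using pos[OF elim] a by (intro mult_right_mono) auto
        then show ?case by (intro ennreal_leI) simp
      qed
    qed
    also have "\<dots> \<le> ennreal M" by (rule M)
    finally show ?thesis by simp
  qed
  \<comment> \<open>The factor 96 makes the tail loss exactly one sixth of the entropy, half of the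
    available third.\<close>
  define A where "A = 96 * C * Q * E * M"
  have A: "0 < A" using C Q E M1 by (simp add: A_def)
  define Bx where "Bx = (2 / a) * ln A + (2 / a) * ln (real N / h)"
  have Bx: "Bx = (2 / a) * ln (A * (real N / h))"
    using A h N0 unfolding Bx_def by (subst ln_mult) (auto simp: distrib_left)
  \<comment> \<open>The case z = 1/2 of \<open>Qsup\<close>.\<close>
  have QE: "1/2 \<le> Q * E"
  proof -
    have "1/2 \<le> Q * exp (a / 2 * (1/2) powr p)" by (rule Qsup) simp
    also have "\<dots> \<le> Q * E" unfolding Ehalf using Q a by (intro mult_left_mono) auto
    finally show ?thesis .
  qed
  \<comment> \<open>This keeps the base of the final power positive: Q E \<ge> 1/2 and M \<ge> 1
    give A \<ge> 48 C, while h \<le> C.\<close>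
  have "1 < A * (real N / h)"
  proof -
    have "h * 1 \<le> C * real N" using hC N h by (intro mult_mono) auto
    moreover have "48 * (C * real N) \<le> A * real N"
    proof -
      have "(1/2) * 1 \<le> (Q * E) * M" using QE M1 Q E by (intro mult_mono) auto
      then have "96 * (C * real N) * (1/2) \<le> 96 * (C * real N) * ((Q * E) * M)"
        using C by (intro mult_left_mono) auto
      then show ?thesis by (simp add: A_def mult_ac)
    qed
    moreover have "0 < C * real N" using C N0 by simp
    ultimately have "h < A * real N" by linarith
    then show ?thesis using h by simp
  qed
  then have Bx0: "0 < Bx" unfolding Bx using a by simp
  have expB: "exp (- (a / 2) * Bx) = h / (A * real N)"
  proof -
    have "(a / 2) * Bx = ln (A * (real N / h))" unfolding Bx using a by simp
    then have "exp (- (a / 2) * Bx) = 1 / exp (ln (A * (real N / h)))" by (simp add: exp_minus inverse_eq_divide)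
    then show ?thesis using A h N0 by simp
  qed
  define R where "R = 4 * Bx powr (2 / \<mu>)"
  have R: "0 < R" using Bx0 by (simp add: R_def)
  define G where "G = 4 * Q * E * exp (- (a / 2) * Bx)"
  have G: "0 \<le> G" using Q E by (simp add: G_def)
  \<comment> \<open>As 1 + x^2 + y^2 is at most 1 + 2 max(x^2, y^2), the larger coordinate alone
    carries the tail, and c0 = 0.\<close>
  define \<phi> where "\<phi> = (\<lambda>x :: real. if 1 + 2 * x\<^sup>2 > R then 1 + 2 * x\<^sup>2 else 0)"
  have \<phi>_le: "\<phi> x \<le> G * exp (a * \<bar>x\<bar> powr \<mu>)" for x
  proof (cases "1 + 2 * x\<^sup>2 > R")
    case True
    \<comment> \<open>A quarter of 1 + 2 x^2, which is also the midpoint of 1/2 and x^2. So y^p is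
      at most the larger of (1/2)^p and (x^2)^p, whether p is above or below 1.\<close>
    define y where "y = 1/4 + x\<^sup>2 / 2"
    have y: "0 < y" by (simp add: y_def add_pos_nonneg)
    have "Bx powr (1 / p) < y" using True by (simp add: R_def y_def p_def)
    then have "(Bx powr (1 / p)) powr p \<le> y powr p" using p by (intro powr_mono2) auto
    then have By: "Bx \<le> y powr p" using p Bx0 by (simp add: powr_powr)
    have "y powr p \<le> (1/2) powr p + (x\<^sup>2) powr p"
    proof (cases "x\<^sup>2 \<le> 1/2")
      case True
      then have "y powr p \<le> (1/2) powr p" using y p by (intro powr_mono2) (auto simp: y_def)
      then show ?thesis by (simp add: add_increasing2)
    next
      case False
      then have "y powr p \<le> (x\<^sup>2) powr p" using y p by (intro powr_mono2) (auto simp: y_def)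
      then show ?thesis by (simp add: add_increasing)
    qed
    moreover have "(x\<^sup>2) powr p = \<bar>x\<bar> powr \<mu>" by (simp add: square_powr p_def)
    ultimately have "a * y powr p \<le> a * (1/2) powr p + a * \<bar>x\<bar> powr \<mu>"
      using mult_left_mono[of "y powr p" "(1/2) powr p + \<bar>x\<bar> powr \<mu>" a] a by (simp add: distrib_left)
    moreover have "a / 2 * Bx \<le> a / 2 * y powr p" using By a by (intro mult_left_mono) auto
    \<comment> \<open>The exponent a/2 y^p is written as a y^p minus its half. The whole is bounded
      by the moment exponent, and the subtracted half, at least a/2 Bx, yields the small factor in
      G.\<close>
    ultimately have ex: "a / 2 * y powr p \<le> a * (1/2) powr p + - (a / 2) * Bx + a * \<bar>x\<bar> powr \<mu>" by linarith
    have "y \<le> Q * exp (a / 2 * y powr p)" by (rule Qsup[OF y])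
    also have "\<dots> \<le> Q * exp (a * (1/2) powr p + - (a / 2) * Bx + a * \<bar>x\<bar> powr \<mu>)"
      using ex Q by (intro mult_left_mono) auto
    also have "\<dots> = Q * E * exp (- (a / 2) * Bx) * exp (a * \<bar>x\<bar> powr \<mu>)"
      unfolding Ehalf by (simp only: exp_add mult.assoc)
    finally have "4 * y \<le> G * exp (a * \<bar>x\<bar> powr \<mu>)" by (simp add: G_def)
    moreover have "\<phi> x = 4 * y" using True by (simp add: \<phi>_def y_def)
    ultimately show ?thesis by simp
  qed (use G in \<open>simp add: \<phi>_def\<close>)
  have "R powr (\<gamma> - 1) * (rel_entropy N f / 3 - 2 * K * N * (0 + 2 * (G * M))) \<le> entropy_production N \<gamma> f"
  proof (rule interpolation[OF \<gamma> R, where \<phi> = \<phi>])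
    show \<phi>m: "\<phi> \<in> borel_measurable borel" unfolding \<phi>_def by measurable
    show "0 \<le> \<phi> x" for x by (simp add: \<phi>_def add_nonneg_nonneg)
    show "1 + x\<^sup>2 + y\<^sup>2 \<le> 0 + \<phi> x + \<phi> y" if "R < 1 + x\<^sup>2 + y\<^sup>2" for x y
      using that by (cases "x\<^sup>2 \<le> y\<^sup>2") (auto simp: \<phi>_def)
    have em: "(\<lambda>v. ennreal (exp (a * \<bar>v 0\<bar> powr \<mu>) * f v)) \<in> borel_measurable (sigmaN N)"
    proof -
      have "(\<lambda>v. ennreal (exp (a * \<bar>v 0\<bar> powr \<mu>) * f v)) \<in> borel_measurable (bor N)" by measurable
      then show ?thesis using measurable_cong_sets[OF sets_sigmaN refl] by blast
    qed
    have "(\<integral>\<^sup>+v. ennreal (\<phi> (v 0) * f v) \<partial>sigmaN N) \<le> (\<integral>\<^sup>+v. ennreal G * ennreal (exp (a * \<bar>v 0\<bar> powr \<mu>) * f v) \<partial>sigmaN N)"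
    proof (rule nn_integral_mono_AE)
      show "AE v in sigmaN N. ennreal (\<phi> (v 0) * f v) \<le> ennreal G * ennreal (exp (a * \<bar>v 0\<bar> powr \<mu>) * f v)"
        using AE_sph[OF N0]
      proof eventually_elim
        case (elim v)
        have "\<phi> (v 0) * f v \<le> G * exp (a * \<bar>v 0\<bar> powr \<mu>) * f v"
          using pos[OF elim] \<phi>_le by (intro mult_right_mono) auto
        then have "ennreal (\<phi> (v 0) * f v) \<le> ennreal (G * (exp (a * \<bar>v 0\<bar> powr \<mu>) * f v))"
          by (intro ennreal_leI) (simp add: mult.assoc)
        then show ?case using G by (simp add: ennreal_mult')
      qed
    qed
    also have "\<dots> \<le> ennreal G * ennreal M"
      unfolding nn_integral_cmult[OF em] using M by (rule mult_left_mono) simp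
    also have "\<dots> = ennreal (G * M)" using G M1 by (simp add: ennreal_mult)
    finally show "(\<integral>\<^sup>+v. ennreal (\<phi> (v 0) * f v) \<partial>sigmaN N) \<le> ennreal (G * M)" .
  qed (use G M1 in auto)
  moreover have "rel_entropy N f / 3 - 2 * K * N * (0 + 2 * (G * M)) = rel_entropy N f / 6"
  proof -
    have "G * M = 4 * Q * E * M * (h / (A * real N))" unfolding G_def expB by simp
    also have "\<dots> = h / (24 * C * real N)"
      using C Q E M1 by (simp add: A_def)
    finally have "2 * K * N * (0 + 2 * (G * M)) = 4 * (C * N) * N * (h / (24 * C * real N))" by (simp add: C(1))
    also have "\<dots> = h * N / 6" using C N0 by simp
    also have "\<dots> = rel_entropy N f / 6" using N0 by (simp add: h_def)
    finally show ?thesis by linarith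
  qed
  ultimately have "R powr (\<gamma> - 1) * (rel_entropy N f / 6) \<le> entropy_production N \<gamma> f" by (simp only:)
  then have "R powr (\<gamma> - 1) * (rel_entropy N f / 6) / N \<le> entropy_production N \<gamma> f / N"
    by (rule divide_right_mono) simp
  moreover have "R powr (\<gamma> - 1) = 1 / (4 powr (1 - \<gamma>) * Bx powr (2 * (1 - \<gamma>) / \<mu>))"
  proof -
    have "R powr (\<gamma> - 1) = R powr (- (1 - \<gamma>))" by simp
    also have "\<dots> = 1 / R powr (1 - \<gamma>)" by (rule powr_minus_divide)
    also have "R powr (1 - \<gamma>) = 4 powr (1 - \<gamma>) * Bx powr (2 * (1 - \<gamma>) / \<mu>)"
      unfolding R_def using Bx0 by (simp add: powr_mult powr_powr mult.commute)
    finally show ?thesis .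
  qed
  ultimately have "1 / (6 * 4 powr (1 - \<gamma>) * Bx powr (2 * (1 - \<gamma>) / \<mu>)) * h \<le> entropy_production N \<gamma> f / real N"
    by (simp add: h_def)
  then show ?thesis unfolding Bx_def A_def Q_def E_def h_def .
qed

end

theorem theorem1p1:
  fixes F :: "nat \<Rightarrow> (nat \<Rightarrow> real) \<Rightarrow> real" and \<gamma> C_F :: real
  assumes gamma: "0 \<le> \<gamma>" "\<gamma> < 1"
    and dens: "\<And>N. N \<ge> 2 \<Longrightarrow> prob_density N (F N)"
    and symm: "\<And>N. N \<ge> 2 \<Longrightarrow> symmetric_density N (F N)"
    and logsc: "log_scalable F C_F"
  shows
   "(\<forall>k::real. k > 1 \<longrightarrow>
      (SUP N\<in>{2..}. moment (2*k) (marginal1 N (F N))) < \<infinity> \<longrightarrow>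
      (let M2k = enn2real (SUP N\<in>{2..}. moment (2*k) (marginal1 N (F N))) in
       \<forall>N\<ge>2.
         entropy_production N \<gamma> (F N) / real N \<ge>
           ((k - 1) / (3 powr ((2*k - \<gamma>*k - \<gamma>) / (k - 1)) * (1 - \<gamma>))
             * ((1 - \<gamma>) / (k - \<gamma>)) powr ((k - \<gamma>) / (k - 1))
             * (1 / ((2 * C_F) powr ((1 - \<gamma>) / (k - 1)) * (1 + 2 * M2k) powr ((1 - \<gamma>) / (k - 1))))
             * real N powr ((\<gamma> - 1) / (k - 1)))
           * (rel_entropy N (F N) / real N) powr (1 + (1 - \<gamma>) / (k - 1))))
    \<and>
    (\<forall>a \<mu> :: real. a > 0 \<longrightarrow> \<mu> > 0 \<longrightarrow>
      (SUP N\<in>{2..}. \<integral>\<^sup>+v. ennreal (exp (a * \<bar>v 0\<bar> powr \<mu>) * F N v) \<partial>sigmaN N) < \<infinity> \<longrightarrow>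
      (let Mexp = enn2real (SUP N\<in>{2..}. \<integral>\<^sup>+v. ennreal (exp (a * \<bar>v 0\<bar> powr \<mu>) * F N v) \<partial>sigmaN N) in
       \<forall>N\<ge>2.
         entropy_production N \<gamma> (F N) / real N \<ge>
           1 / (6 * 4 powr (1 - \<gamma>) *
                ((2 / a) * ln (96 * C_F * (4 / (a * \<mu> * exp 1)) powr (2 / \<mu>)
                               * exp (a / 2 powr (\<mu> / 2)) * Mexp)
                 + (2 / a) * ln (real N / (rel_entropy N (F N) / real N)))
                powr (2 * (1 - \<gamma>) / \<mu>))
           * (rel_entropy N (F N) / real N)))"
proof -
  have C: "0 < C_F" using logsc by (simp add: log_scalable_def)
  have ld: "log_density N (F N) (C_F * N)" if "N \<ge> 2" for N
    using that dens[OF that] symm[OF that] logsc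
    by unfold_locales (auto simp: log_scalable_def)
  \<comment> \<open>\<open>enn2real\<close> sends infinity to 0; finiteness of the supremum is what
    makes the real constant dominate every member of the family.\<close>
  have le_SUP: "g N \<le> ennreal (enn2real (SUP N\<in>{2..}. g N))"
    if "(SUP N\<in>{2..}. g N) < \<infinity>" "N \<ge> 2" for g :: "nat \<Rightarrow> ennreal" and N
  proof -
    have "g N \<le> (SUP N\<in>{2..}. g N)" using that(2) by (intro SUP_upper) auto
    then show ?thesis using that(1) by (simp add: less_top)
  qed
  show ?thesis
    unfolding Let_def
    by (intro conjI allI impI log_density.polynomial_moment_bound[OF ld gamma _ refl C]
        log_density.exponential_moment_bound[OF ld gamma _ _ refl C] le_SUP enn2real_nonneg)
qed

end
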